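(* For every integer $k\ge 1$, the Cannon--Thurston map $\partial\Lambda_k\to\partial\Gamma_k$ exists for the free subgroup $\Lambda_k$ of the hyperbolic hydra group $\Gamma_k$.
   Context: Hyperbolic hydra. Fix $k\ge 1$. Let $F=F(a_0,\ldots,a_k,b_1,\ldots,b_l)$ be a free group and let $\theta$ be an automorphism of $F$ which restricts to an automorphism of $F(b_1,\ldots,b_l)$ and satisfies $\theta(a_0)=Ua_1V$, $\theta(a_1)=a_0$, and $\theta(a_i)=a_ia_{i-1}$ for $1<i\le k$, where $U,V$ are words on $b_1^{\pm1},\ldots,b_l^{\pm1}$. Let $\Gamma_k=F\rtimes_\theta\mathbb{Z}$, where a generator $t$ of the $\mathbb{Z}$-factor satisfies $t^{-1}xt=\theta(x)$ for all $x\in F$. Here $l$, $U$, $V$ and $\theta|_{F(b_1,\ldots,b_l)}$ (which may depend on $k$) are chosen so that $\Gamma_k$ is a (Gromov-)hyperbolic group; it is known that such choices exist for every $k$. Let $\Lambda_k=\langle a_0t,a_1t,\ldots,a_kt,b_1,\ldots,b_l\rangle\le\Gamma_k$; it is known that $\Lambda_k$ is free of rank $k+l+1$, so it is hyperbolic. Cannon--Thurston maps. For a hyperbolic group $G$ with a word metric $d$ from a finite generating set, $(a\cdot b)_e=\frac12(d(a,e)+d(b,e)-d(a,b))$. The boundary $\partial G$ is the set of equivalence classes of sequences $(a_n)$ in $G$ with $(a_m\cdot a_n)_e\to\infty$ as $m,n\to\infty$, where $(a_n)\sim(b_n)$ when $(a_m\cdot b_n)_e\to\infty$ as $m,n\to\infty$.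 $\overline{G}=G\cup\partial G$ carries its usual compact metrizable topology (Gromov compactification), in which a sequence in $G$ converges to a point of $\partial G$ if and only if it represents that point. If $\Lambda\le\Gamma$ are hyperbolic groups, the Cannon--Thurston map exists when the inclusion $\Lambda\hookrightarrow\Gamma$ extends to a continuous map $\overline\Lambda\to\overline\Gamma$; its restriction $\partial\Lambda\to\partial\Gamma$ (sending the class of $(g_n)$ to the class of $(g_n)$) is called the Cannon--Thurston map. *)

theory Defs
  imports
    "HOL-Algebra.Bij"
    "HOL-Algebra.Elementary_Groups"
    "HOL-Analysis.Abstract_Topology"
    "HOL-Library.Extended_Real"
begin

section \<open>Free groups as groups of reduced words\<close>

text \<open>
  The letter \<open>(x, True)\<close> stands for the generator \<open>x\<close> and \<open>(x, False)\<close> for its inverse.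
\<close>

definition inverse_letter :: "'x \<times> bool \<Rightarrow> 'x \<times> bool" where
  "inverse_letter x = (fst x, \<not> snd x)"

definition reduced :: "('x \<times> bool) list \<Rightarrow> bool" where
  "reduced w \<longleftrightarrow> successively (\<lambda>x y. y \<noteq> inverse_letter x) w"

fun cancel_Cons :: "'x \<times> bool \<Rightarrow> ('x \<times> bool) list \<Rightarrow> ('x \<times> bool) list" where
  "cancel_Cons x [] = [x]"
| "cancel_Cons x (y # w) = (if y = inverse_letter x then w else x # y # w)"

definition free_reduce :: "('x \<times> bool) list \<Rightarrow> ('x \<times> bool) list" where
  "free_reduce w = foldr cancel_Cons w []"

definition free_group :: "'x set \<Rightarrow> ('x \<times> bool) list monoid" where
  "free_group X =
    \<lparr>carrier = {w. reduced w \<and> set w \<subseteq> X \<times> UNIV},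
     monoid.mult = (\<lambda>u v. free_reduce (u @ v)),
     one = []\<rparr>"

definition free_gen :: "'x \<Rightarrow> ('x \<times> bool) list" where
  "free_gen x = [(x, True)]"

lemma inverse_letter_inverse_letter [simp]: "inverse_letter (inverse_letter x) = x"
  by (simp add: inverse_letter_def)

lemma reduced_Nil [simp]: "reduced []"
  by (simp add: reduced_def)

lemma reduced_Cons:
  "reduced (x # w) \<longleftrightarrow> reduced w \<and> (w = [] \<or> hd w \<noteq> inverse_letter x)"
  by (cases w) (auto simp: reduced_def)

lemma reduced_cancel_Cons: "reduced w \<Longrightarrow> reduced (cancel_Cons x w)"
  by (cases w) (auto simp: reduced_Cons)

lemma reduced_foldr: "reduced v \<Longrightarrow> reduced (foldr cancel_Cons u v)"
  by (induction u) (auto intro: reduced_cancel_Cons)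

lemma cancel_Cons_inverse:
  "reduced w \<Longrightarrow> cancel_Cons x (cancel_Cons (inverse_letter x) w) = w"
proof (cases w)
  case (Cons y v)
  assume "reduced w"
  with Cons show ?thesis
    by (cases v) (auto simp: reduced_Cons)
qed simp

lemma foldr_cancel_Cons_assoc:
  assumes "reduced w"
  shows "foldr cancel_Cons (foldr cancel_Cons u v) w = foldr cancel_Cons u (foldr cancel_Cons v w)"
proof (induction u)
  case Nil
  show ?case by simp
next
  case (Cons x u)
  define z where "z = foldr cancel_Cons u v"
  have "foldr cancel_Cons (cancel_Cons x z) w = cancel_Cons x (foldr cancel_Cons z w)"
  proof (cases z)
    case (Cons y z')
    show ?thesis
    proof (cases "y = inverse_letter x")
      case True
      then show ?thesis
        using Cons cancel_Cons_inverse[OF reduced_foldr[OF assms], of x z'] by simp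
    qed (simp add: Cons)
  qed simp
  with Cons show ?case by (simp add: z_def)
qed

lemma free_reduce_reduced: "reduced w \<Longrightarrow> free_reduce w = w"
proof (induction w)
  case (Cons x w)
  then show ?case
    by (cases w) (auto simp: free_reduce_def reduced_Cons)
qed (simp add: free_reduce_def)

lemma free_reduce_append:
  "reduced v \<Longrightarrow> free_reduce (u @ v) = foldr cancel_Cons u v"
  using free_reduce_reduced[of v] by (simp add: free_reduce_def)

lemma set_foldr_cancel_Cons: "set (foldr cancel_Cons u v) \<subseteq> set u \<union> set v"
proof (induction u)
  case (Cons x u)
  have "set (cancel_Cons x z) \<subseteq> insert x (set z)" for z
    by (cases z) auto
  with Cons show ?case by fastforce
qed simp

lemma inverse_word:
  assumes "reduced w"
  shows "foldr cancel_Cons (rev (map inverse_letter w)) (w @ v) = v"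
  by (induction w arbitrary: v) auto

lemma group_free_group: "group (free_group X)"
proof (rule groupI)
  fix u assume u: "u \<in> carrier (free_group X)"
  define v where "v = foldr cancel_Cons (rev (map inverse_letter u)) []"
  have "v \<in> carrier (free_group X)"
    using u set_foldr_cancel_Cons[of "rev (map inverse_letter u)" "[]"]
    by (fastforce simp: v_def free_group_def inverse_letter_def reduced_foldr)
  moreover have "v \<otimes>\<^bsub>free_group X\<^esub> u = \<one>\<^bsub>free_group X\<^esub>"
    using u foldr_cancel_Cons_assoc[of u "rev (map inverse_letter u)" "[]"] inverse_word[of u "[]"]
    by (simp add: v_def free_group_def free_reduce_append)
  ultimately show "\<exists>v\<in>carrier (free_group X). v \<otimes>\<^bsub>free_group X\<^esub> u = \<one>\<^bsub>free_group X\<^esub>"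
    by blast
next
  fix u v assume "u \<in> carrier (free_group X)" "v \<in> carrier (free_group X)"
  then show "u \<otimes>\<^bsub>free_group X\<^esub> v \<in> carrier (free_group X)"
    using set_foldr_cancel_Cons[of u v]
    by (auto simp: free_group_def free_reduce_append reduced_foldr)
qed (auto simp: free_group_def free_reduce_append reduced_foldr free_reduce_reduced
      foldr_cancel_Cons_assoc)


section \<open>Semidirect products with the integers\<close>

definition semidirect ::
  "('a, 'c) monoid_scheme \<Rightarrow> ('b, 'd) monoid_scheme \<Rightarrow> ('b \<Rightarrow> 'a \<Rightarrow> 'a) \<Rightarrow> ('a \<times> 'b) monoid" where
  "semidirect N H \<phi> =
    \<lparr>carrier = carrier N \<times> carrier H,
     monoid.mult = (\<lambda>(x, g) (y, h). (x \<otimes>\<^bsub>N\<^esub> \<phi> g y, g \<otimes>\<^bsub>H\<^esub> h)),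
     one = (\<one>\<^bsub>N\<^esub>, \<one>\<^bsub>H\<^esub>)\<rparr>"

text \<open>
  The pair \<open>(x, n)\<close> is the element \<open>x t\<^sup>n\<close>. Conjugation \<open>y \<mapsto> t\<^sup>n y t\<^sup>-\<^sup>n\<close> acts as the power
  \<open>-n\<close> of \<open>\<theta>\<close>, so that \<open>t\<^sup>-\<^sup>1 x t = \<theta> x\<close>; see \<open>mapping_torus_conj\<close> below.
\<close>

definition mapping_torus ::
  "('a, 'c) monoid_scheme \<Rightarrow> ('a \<Rightarrow> 'a) \<Rightarrow> ('a \<times> int) monoid" where
  "mapping_torus F \<theta> = semidirect F integer_group (\<lambda>n. \<theta> [^]\<^bsub>AutoGroup F\<^esub> (- n))"

lemma group_semidirect:
  assumes N: "group N" and H: "group H" and \<phi>: "\<phi> \<in> hom H (AutoGroup N)"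
  shows "group (semidirect N H \<phi>)"
proof -
  interpret N: group N by fact
  interpret H: group H by fact
  interpret A: group "AutoGroup N" by (rule N.AutoGroup)
  interpret \<phi>: group_hom H "AutoGroup N" \<phi>
    by unfold_locales (rule \<phi>)
  have aut: "\<phi> g \<in> auto N" if "g \<in> carrier H" for g
    using \<phi>.hom_closed[OF that] by (simp add: AutoGroup_def)
  have clo: "\<phi> g x \<in> carrier N" if "g \<in> carrier H" "x \<in> carrier N" for g x
    using aut[OF that(1)] that(2) by (auto simp: auto_def hom_def)
  have mul: "\<phi> g (x \<otimes>\<^bsub>N\<^esub> y) = \<phi> g x \<otimes>\<^bsub>N\<^esub> \<phi> g y"
    if "g \<in> carrier H" "x \<in> carrier N" "y \<in> carrier N" for g x y
    using aut[OF that(1)] that(2,3) by (auto simp: auto_def hom_def)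
  have comp: "\<phi> (g \<otimes>\<^bsub>H\<^esub> h) x = \<phi> g (\<phi> h x)"
    if "g \<in> carrier H" "h \<in> carrier H" "x \<in> carrier N" for g h x
    using aut that
    by (simp add: AutoGroup_def BijGroup_def auto_def compose_def)
  have one: "\<phi> \<one>\<^bsub>H\<^esub> x = x" if "x \<in> carrier N" for x
    using \<phi>.hom_one that by (simp add: AutoGroup_def BijGroup_def)
  have one': "\<phi> g \<one>\<^bsub>N\<^esub> = \<one>\<^bsub>N\<^esub>" if "g \<in> carrier H" for g
    by (metis N.l_cancel_one' N.one_closed N.r_one clo mul that)
  show ?thesis
  proof (rule groupI)
    fix p assume "p \<in> carrier (semidirect N H \<phi>)"
    then obtain x g where p: "p = (x, g)" "x \<in> carrier N" "g \<in> carrier H"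
      by (auto simp: semidirect_def)
    have "(\<phi> (inv\<^bsub>H\<^esub> g) (inv\<^bsub>N\<^esub> x), inv\<^bsub>H\<^esub> g) \<otimes>\<^bsub>semidirect N H \<phi>\<^esub> p = \<one>\<^bsub>semidirect N H \<phi>\<^esub>"
      using p mul[of "inv\<^bsub>H\<^esub> g" "inv\<^bsub>N\<^esub> x" x]
      by (simp add: semidirect_def one' del: \<phi>.hom_inv)
    then show "\<exists>q\<in>carrier (semidirect N H \<phi>). q \<otimes>\<^bsub>semidirect N H \<phi>\<^esub> p = \<one>\<^bsub>semidirect N H \<phi>\<^esub>"
      by (rule bexI) (use p in \<open>simp add: semidirect_def clo del: \<phi>.hom_inv\<close>)
  qed (auto simp: semidirect_def clo mul comp one N.m_assoc H.m_assoc
      simp del: \<phi>.hom_mult \<phi>.hom_one)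
qed

lemma group_mapping_torus:
  assumes "group F" "\<theta> \<in> auto F"
  shows "group (mapping_torus F \<theta>)"
proof -
  interpret A: group "AutoGroup F" by (rule group.AutoGroup) fact
  have "\<theta> \<in> carrier (AutoGroup F)"
    using assms(2) by (simp add: AutoGroup_def)
  then have "(\<lambda>n. \<theta> [^]\<^bsub>AutoGroup F\<^esub> (- n :: int)) \<in> hom integer_group (AutoGroup F)"
    by (auto simp: hom_def simp flip: A.int_pow_mult)
  then show ?thesis
    unfolding mapping_torus_def using assms(1) by (intro group_semidirect) simp_all
qed

lemma mapping_torus_conj:
  assumes "group F" "\<theta> \<in> auto F" "x \<in> carrier F"
  defines "t \<equiv> (\<one>\<^bsub>F\<^esub>, 1)"
  shows "inv\<^bsub>mapping_torus F \<theta>\<^esub> t \<otimes>\<^bsub>mapping_torus F \<theta>\<^esub> (x, 0) \<otimes>\<^bsub>mapping_torus F \<theta>\<^esub> t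
           = (\<theta> x, 0)"
proof -
  interpret F: group F by fact
  interpret A: group "AutoGroup F" by (rule F.AutoGroup)
  interpret M: group "mapping_torus F \<theta>" by (rule group_mapping_torus) fact+
  have th: "\<theta> \<in> carrier (AutoGroup F)"
    using assms(2) by (simp add: AutoGroup_def)
  have thx: "\<theta> x \<in> carrier F" and th1: "\<theta> \<one>\<^bsub>F\<^esub> = \<one>\<^bsub>F\<^esub>"
    using assms hom_one[of \<theta> F F] by (auto simp: auto_def hom_def)
  have pow0: "\<theta> [^]\<^bsub>AutoGroup F\<^esub> (0::int) = (\<lambda>x\<in>carrier F. x)"
    by (simp add: AutoGroup_def BijGroup_def)
  have pow1: "\<theta> [^]\<^bsub>AutoGroup F\<^esub> (1::int) = \<theta>"
    using th by (simp add: A.int_pow_1)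
  have "inv\<^bsub>mapping_torus F \<theta>\<^esub> t = (\<one>\<^bsub>F\<^esub>, -1)"
    by (rule M.inv_equality)
       (auto simp: t_def mapping_torus_def semidirect_def pow1 th1)
  then show ?thesis
    using thx assms(3) by (simp add: t_def mapping_torus_def semidirect_def pow0 pow1 th1)
qed


section \<open>Word metrics, hyperbolic groups and their compactifications\<close>

definition finite_generating_set :: "('g, 'c) monoid_scheme \<Rightarrow> 'g set \<Rightarrow> bool" where
  "finite_generating_set G S \<longleftrightarrow> finite S \<and> S \<subseteq> carrier G \<and> generate G S = carrier G"

definition word_length :: "('g, 'c) monoid_scheme \<Rightarrow> 'g set \<Rightarrow> 'g \<Rightarrow> nat" where
  "word_length G S g =
    (LEAST n. \<exists>w. length w = n \<and> set w \<subseteq> S \<union> m_inv G ` S \<and> foldr (monoid.mult G) w \<one>\<^bsub>G\<^esub> = g)"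

definition word_dist :: "('g, 'c) monoid_scheme \<Rightarrow> 'g set \<Rightarrow> 'g \<Rightarrow> 'g \<Rightarrow> real" where
  "word_dist G S a b = real (word_length G S (inv\<^bsub>G\<^esub> a \<otimes>\<^bsub>G\<^esub> b))"

definition gromov_product ::
  "('g, 'c) monoid_scheme \<Rightarrow> 'g set \<Rightarrow> 'g \<Rightarrow> 'g \<Rightarrow> 'g \<Rightarrow> real" where
  "gromov_product G S p a b = (word_dist G S a p + word_dist G S b p - word_dist G S a b) / 2"

definition hyperbolic_group :: "('g, 'c) monoid_scheme \<Rightarrow> bool" where
  "hyperbolic_group G \<longleftrightarrow> group G \<and>
    (\<exists>S. finite_generating_set G S \<and>
      (\<exists>\<delta>. \<forall>p\<in>carrier G. \<forall>a\<in>carrier G. \<forall>b\<in>carrier G. \<forall>c\<in>carrier G.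
        gromov_product G S p a c \<ge> min (gromov_product G S p a b) (gromov_product G S p b c) - \<delta>))"

definition gromov_close ::
  "('g, 'c) monoid_scheme \<Rightarrow> 'g set \<Rightarrow> (nat \<Rightarrow> 'g) \<Rightarrow> (nat \<Rightarrow> 'g) \<Rightarrow> bool" where
  "gromov_close G S a b \<longleftrightarrow>
    filterlim (\<lambda>(m, n). gromov_product G S \<one>\<^bsub>G\<^esub> (a m) (b n)) at_top
      (sequentially \<times>\<^sub>F sequentially)"

definition gromov_sequences :: "('g, 'c) monoid_scheme \<Rightarrow> 'g set \<Rightarrow> (nat \<Rightarrow> 'g) set" where
  "gromov_sequences G S = {a. range a \<subseteq> carrier G \<and> gromov_close G S a a}"

definition gromov_boundary :: "('g, 'c) monoid_scheme \<Rightarrow> 'g set \<Rightarrow> (nat \<Rightarrow> 'g) set set" where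
  "gromov_boundary G S =
    gromov_sequences G S //
      {(a, b). a \<in> gromov_sequences G S \<and> b \<in> gromov_sequences G S \<and> gromov_close G S a b}"

text \<open>
  Points of the compactification are \<open>Inl g\<close> for group elements \<open>g\<close> and \<open>Inr \<xi>\<close> for
  boundary points \<open>\<xi>\<close>.
\<close>

type_synonym 'g bordified = "'g + (nat \<Rightarrow> 'g) set"

definition gromov_points :: "('g, 'c) monoid_scheme \<Rightarrow> 'g set \<Rightarrow> 'g bordified set" where
  "gromov_points G S = carrier G <+> gromov_boundary G S"

primrec representatives :: "'g bordified \<Rightarrow> (nat \<Rightarrow> 'g) set" where
  "representatives (Inl g) = {\<lambda>_. g}"
| "representatives (Inr \<xi>) = \<xi>"

text \<open>
  The usual extension of the Gromov product:
  \<open>(p \<cdot> q)\<^sub>e = sup liminf\<^sub>m\<^sub>,\<^sub>n (a\<^sub>m \<cdot> b\<^sub>n)\<^sub>e\<close>, the supremum being taken over all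
  representatives \<open>a\<close> of \<open>p\<close> and \<open>b\<close> of \<open>q\<close>.
\<close>

definition extended_gromov_product ::
  "('g, 'c) monoid_scheme \<Rightarrow> 'g set \<Rightarrow> 'g bordified \<Rightarrow> 'g bordified \<Rightarrow> ereal" where
  "extended_gromov_product G S p q =
    (SUP a\<in>representatives p. SUP b\<in>representatives q.
      Liminf (sequentially \<times>\<^sub>F sequentially)
        (\<lambda>(m, n). ereal (gromov_product G S \<one>\<^bsub>G\<^esub> (a m) (b n))))"

text \<open>
  Group elements are isolated, and the sets \<open>{q. (\<xi> \<cdot> q)\<^sub>e \<ge> r}\<close> form a neighbourhood base
  at the boundary point \<open>\<xi>\<close>. These sets are neighbourhoods, not open sets in general.
\<close>

definition gromov_compactification ::
  "('g, 'c) monoid_scheme \<Rightarrow> 'g set \<Rightarrow> 'g bordified topology" where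
  "gromov_compactification G S = topology (\<lambda>W. W \<subseteq> gromov_points G S \<and>
    (\<forall>\<xi>. Inr \<xi> \<in> W \<longrightarrow>
      (\<exists>r::real. {q \<in> gromov_points G S. extended_gromov_product G S (Inr \<xi>) q \<ge> ereal r} \<subseteq> W)))"

lemma openin_gromov_compactification:
  "openin (gromov_compactification G S) W \<longleftrightarrow> W \<subseteq> gromov_points G S \<and>
    (\<forall>\<xi>. Inr \<xi> \<in> W \<longrightarrow>
      (\<exists>r::real. {q \<in> gromov_points G S. extended_gromov_product G S (Inr \<xi>) q \<ge> ereal r} \<subseteq> W))"
proof -
  define U where "U \<xi> r = {q \<in> gromov_points G S. extended_gromov_product G S (Inr \<xi>) q \<ge> ereal r}"
    for \<xi> and r :: real
  define L where "L W \<longleftrightarrow> W \<subseteq> gromov_points G S \<and> (\<forall>\<xi>. Inr \<xi> \<in> W \<longrightarrow> (\<exists>r. U \<xi> r \<subseteq> W))" for W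
  have mono: "U \<xi> (max r s) \<subseteq> U \<xi> r \<inter> U \<xi> s" for \<xi> r s
    by (auto simp: U_def intro: order_trans[rotated])
  have "istopology L"
    unfolding istopology_def
  proof (intro conjI allI impI)
    fix V W assume V: "L V" and W: "L W"
    have "\<exists>r. U \<xi> r \<subseteq> V \<inter> W" if VW: "Inr \<xi> \<in> V \<inter> W" for \<xi>
    proof -
      obtain r s where "U \<xi> r \<subseteq> V" "U \<xi> s \<subseteq> W"
        using V W VW unfolding L_def by (metis IntD1 IntD2)
      then show ?thesis using mono[of \<xi> r s] by blast
    qed
    then show "L (V \<inter> W)" using V unfolding L_def by (metis inf.coboundedI1)
  next
    fix K assume K: "\<forall>W\<in>K. L W"
    have "\<exists>r. U \<xi> r \<subseteq> \<Union> K" if xi: "Inr \<xi> \<in> \<Union> K" for \<xi>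
    proof -
      obtain W where W: "W \<in> K" "Inr \<xi> \<in> W" using xi by blast
      then have "L W" using K by blast
      then obtain r where "U \<xi> r \<subseteq> W" using W(2) unfolding L_def by metis
      then show ?thesis using W(1) by (meson Union_upper order_trans)
    qed
    moreover have "\<Union> K \<subseteq> gromov_points G S"
      using K unfolding L_def by (meson Sup_least)
    ultimately show "L (\<Union> K)" unfolding L_def by metis
  qed
  moreover have "gromov_compactification G S = topology L"
    unfolding gromov_compactification_def L_def U_def ..
  ultimately have "openin (gromov_compactification G S) W \<longleftrightarrow> L W"
    by (simp only: topology_inverse')
  then show ?thesis by (simp only: L_def U_def)
qed

lemma topspace_gromov_compactification:
  "topspace (gromov_compactification G S) = gromov_points G S"
proof
  show "topspace (gromov_compactification G S) \<subseteq> gromov_points G S"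
    using openin_topspace[of "gromov_compactification G S"]
    by (simp only: openin_gromov_compactification)
  have "openin (gromov_compactification G S) (gromov_points G S)"
    unfolding openin_gromov_compactification by blast
  then show "gromov_points G S \<subseteq> topspace (gromov_compactification G S)"
    by (rule openin_subset)
qed

definition cannon_thurston_map_exists ::
  "('g, 'c) monoid_scheme \<Rightarrow> 'g set \<Rightarrow> ('g, 'd) monoid_scheme \<Rightarrow> 'g set \<Rightarrow> bool" where
  "cannon_thurston_map_exists \<Lambda> T \<Gamma> S \<longleftrightarrow>
    (\<exists>f. continuous_map (gromov_compactification \<Lambda> T) (gromov_compactification \<Gamma> S) f \<and>
         (\<forall>g\<in>carrier \<Lambda>. f (Inl g) = Inl g))"


section \<open>Hyperbolic hydra groups\<close>

datatype hydra_letter = Letter_a nat | Letter_b nat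

type_synonym hydra_word = "(hydra_letter \<times> bool) list"

abbreviation gen_a :: "nat \<Rightarrow> hydra_word" where
  "gen_a i \<equiv> free_gen (Letter_a i)"

abbreviation gen_b :: "nat \<Rightarrow> hydra_word" where
  "gen_b j \<equiv> free_gen (Letter_b j)"

definition hydra_free :: "nat \<Rightarrow> nat \<Rightarrow> hydra_word monoid" where
  "hydra_free k l = free_group (Letter_a ` {0..k} \<union> Letter_b ` {1..l})"

definition hydra_free_b :: "nat \<Rightarrow> nat \<Rightarrow> hydra_word monoid" where
  "hydra_free_b k l = subgroup_generated (hydra_free k l) (gen_b ` {1..l})"

definition hydra_automorphism ::
  "nat \<Rightarrow> nat \<Rightarrow> hydra_word \<Rightarrow> hydra_word \<Rightarrow> (hydra_word \<Rightarrow> hydra_word) \<Rightarrow> bool" where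
  "hydra_automorphism k l U V \<theta> \<longleftrightarrow>
    \<theta> \<in> auto (hydra_free k l) \<and>
    restrict \<theta> (carrier (hydra_free_b k l)) \<in> auto (hydra_free_b k l) \<and>
    U \<in> carrier (hydra_free_b k l) \<and> V \<in> carrier (hydra_free_b k l) \<and>
    \<theta> (gen_a 0) = U \<otimes>\<^bsub>hydra_free k l\<^esub> gen_a 1 \<otimes>\<^bsub>hydra_free k l\<^esub> V \<and>
    \<theta> (gen_a 1) = gen_a 0 \<and>
    (\<forall>i. 1 < i \<and> i \<le> k \<longrightarrow> \<theta> (gen_a i) = gen_a i \<otimes>\<^bsub>hydra_free k l\<^esub> gen_a (i - 1))"

definition hydra_group ::
  "nat \<Rightarrow> nat \<Rightarrow> (hydra_word \<Rightarrow> hydra_word) \<Rightarrow> (hydra_word \<times> int) monoid" where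
  "hydra_group k l \<theta> = mapping_torus (hydra_free k l) \<theta>"

text \<open>
  The generators \<open>a\<^sub>i t\<close> and \<open>b\<^sub>j\<close> of the subgroup are the pairs \<open>(a\<^sub>i, 1)\<close> and \<open>(b\<^sub>j, 0)\<close>.
\<close>

definition hydra_subgroup ::
  "nat \<Rightarrow> nat \<Rightarrow> (hydra_word \<Rightarrow> hydra_word) \<Rightarrow> (hydra_word \<times> int) monoid" where
  "hydra_subgroup k l \<theta> =
    subgroup_generated (hydra_group k l \<theta>)
      ((\<lambda>i. (gen_a i, 1)) ` {0..k} \<union> (\<lambda>j. (gen_b j, 0)) ` {1..l})"

end

theory Submission
  imports Defs "HOL-Library.Sublist" "HOL-Real_Asymp.Real_Asymp"
begin

text \<open>
  Write an element of \<open>\<Gamma> = F \<rtimes> \<int>\<close> as \<open>(f, n)\<close>, standing for \<open>f t\<^sup>n\<close>, and let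
  \<open>\<Gamma>\<^sub>0 = F(b\<^sub>1, \<dots>, b\<^sub>l) \<rtimes> \<int>\<close> and \<open>\<Gamma>\<^sub>i = F(a\<^sub>0, \<dots>, a\<^sub>i, b\<^sub>1, \<dots>, b\<^sub>l) \<rtimes> \<int>\<close> for
  \<open>i \<ge> 1\<close>. Each \<open>\<Gamma>\<^sub>i\<close> is obtained from \<open>\<Gamma>\<^sub>i\<^sub>-\<^sub>1\<close> by adding stable letters over infinite
  cyclic subgroups. By induction on \<open>i\<close>, two elements of the subgroup generated by the \<open>b\<^sub>j\<close> and
  \<open>a\<^sub>0 t, \<dots>, a\<^sub>i t\<close> (by the \<open>b\<^sub>j\<close> alone if \<open>i = 0\<close>) whose words have a long common prefix have a large
  Gromov product; all distances are measured in the hyperbolic group \<open>\<Gamma>\<close>.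

  Everything rests on the fact that the image of a Lipschitz retraction of a hyperbolic group is
  quasiconvex. For \<open>i = 0\<close> the subgroup is normal in \<open>\<Gamma>\<^sub>0\<close>, and Mitra's ladder of a geodesic is
  such an image. In the induction step a half space of the Bass--Serre tree, together with its
  bounding cyclic coset, is a retract of \<open>\<Gamma>\<^sub>i\<close>, because the height \<open>(f, n) \<mapsto> n\<close> already retracts
  \<open>\<Gamma>\<close> onto the cyclic coset; folding the half spaces away retracts \<open>\<Gamma>\<^sub>i\<close> onto \<open>\<Gamma>\<^sub>i\<^sub>-\<^sub>1\<close>. Only
  finitely many half spaces meet a given ball, and distinct initial segments of words over the
  generators of the subgroup determine distinct half spaces, because the subgroup meets the
  conjugates \<open>\<langle>t\<rangle>\<close> and \<open>\<langle>a\<^sub>i\<^sup>-\<^sup>1 t\<rangle>\<close> trivially, as right multiplication by \<open>a\<^sub>i\<close> only ever lowers the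
  exponent in a coset of \<open>t\<^sup>-\<^sup>n\<close>.
\<close>


section \<open>Word metrics and the Morse lemma\<close>

text \<open>The obstacle is distortion: a long reduced word over the generators of the subgroup may
  represent an element close to the identity, so its length gives no direct lower bound on a
  distance. The thresholds on prefix lengths therefore come from finiteness: a ball contains
  finitely many elements, and each of them excludes only words of bounded prefix length.

  Hyperbolicity is assumed for \<open>\<Gamma>\<close> alone, so a retraction defined on
  \<open>\<Gamma>\<^sub>i\<close> is first composed with a retraction of \<open>\<Gamma>\<close>
  onto \<open>\<Gamma>\<^sub>i\<close>. Controlled families are designed for such compositions, and
  they give one quasiconvexity constant for all half spaces, or all ladders, at once. The boundary
  of a half space has exactly one point at each height, so a point outside is sent to the boundary
  point of its own height.

  The letters \<open>a\<^sub>0\<close> and \<open>a\<^sub>1\<close> form a single layer because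
  \<theta> interchanges them up to the factors \<open>U\<close> and \<open>V\<close>.\<close>

locale word_metric = group G for G :: "('g, 'c) monoid_scheme" (structure) +
  fixes S :: "'g set"
  assumes fgs: "finite_generating_set G S"
begin

abbreviation letters :: "'g set" where "letters \<equiv> S \<union> m_inv G ` S"
abbreviation eval :: "'g list \<Rightarrow> 'g" where "eval w \<equiv> foldr (\<otimes>) w \<one>"
abbreviation len :: "'g \<Rightarrow> nat" where "len g \<equiv> word_length G S g"
abbreviation dis :: "'g \<Rightarrow> 'g \<Rightarrow> real" where "dis \<equiv> word_dist G S"
abbreviation gp :: "'g \<Rightarrow> 'g \<Rightarrow> 'g \<Rightarrow> real" where "gp \<equiv> gromov_product G S"

lemma mult_inv_cancel [simp]:
  "a \<in> carrier G \<Longrightarrow> b \<in> carrier G \<Longrightarrow> a \<otimes> (inv a \<otimes> b) = b"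
  "a \<in> carrier G \<Longrightarrow> b \<in> carrier G \<Longrightarrow> inv a \<otimes> (a \<otimes> b) = b"
  by (simp_all add: m_assoc[symmetric])

lemma letters_closed: "letters \<subseteq> carrier G"
  using fgs by (auto simp: finite_generating_set_def)

lemma finite_letters: "finite letters"
  using fgs by (auto simp: finite_generating_set_def)

lemma inv_letters: "x \<in> letters \<Longrightarrow> inv x \<in> letters"
  using fgs by (auto simp: finite_generating_set_def subset_iff)

lemma eval_closed [simp]: "set w \<subseteq> letters \<Longrightarrow> eval w \<in> carrier G"
  using letters_closed by (induction w) auto

lemma eval_append: "set u \<subseteq> letters \<Longrightarrow> set v \<subseteq> letters \<Longrightarrow> eval (u @ v) = eval u \<otimes> eval v"
proof (induction u)
  case (Cons x u)
  have "x \<in> carrier G" "set u \<subseteq> letters" using Cons.prems letters_closed by auto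
  with Cons show ?case
    using m_assoc[of x "eval u" "eval v"] eval_closed[of u] eval_closed[of v] by simp
qed simp

lemma eval_rev: "set w \<subseteq> letters \<Longrightarrow> eval (rev (map (m_inv G) w)) = inv (eval w)"
proof (induction w)
  case (Cons x w)
  have x: "x \<in> carrier G" "inv x \<in> letters"
    using Cons.prems letters_closed inv_letters by auto
  have w: "set w \<subseteq> letters" using Cons.prems by simp
  then have w': "set (rev (map (m_inv G) w)) \<subseteq> letters"
    using inv_letters subsetD[OF w] by (simp only: set_rev set_map image_subset_iff) blast
  have "eval (rev (map (m_inv G) (x # w))) = eval (rev (map (m_inv G) w)) \<otimes> eval [inv x]"
    using eval_append[of "rev (map (m_inv G) w)" "[inv x]"] w' x by simp
  then show ?case
    using Cons.IH[OF w] x eval_closed[OF w] by (simp add: inv_mult_group)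
qed simp

lemma ex_word: "g \<in> carrier G \<Longrightarrow> \<exists>w. set w \<subseteq> letters \<and> eval w = g"
proof -
  assume "g \<in> carrier G"
  then have "g \<in> generate G S" using fgs by (simp add: finite_generating_set_def)
  then show ?thesis
  proof (induction rule: generate.induct)
    case one
    show ?case by (rule exI[of _ "[]"]) simp
  next
    case (incl h)
    then show ?case using letters_closed by (intro exI[of _ "[h]"]) auto
  next
    case (inv h)
    then show ?case using letters_closed by (intro exI[of _ "[inv h]"]) auto
  next
    case (eng h1 h2)
    then obtain u v where "set u \<subseteq> letters" "eval u = h1" "set v \<subseteq> letters" "eval v = h2" by blast
    then show ?case using eval_append[of u v] by (intro exI[of _ "u @ v"]) auto
  qed
qed

lemma len_word: "g \<in> carrier G \<Longrightarrow> \<exists>w. length w = len g \<and> set w \<subseteq> letters \<and> eval w = g"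
  unfolding word_length_def by (rule LeastI_ex) (use ex_word in auto)

lemma len_le: "set w \<subseteq> letters \<Longrightarrow> len (eval w) \<le> length w"
  unfolding word_length_def by (rule Least_le) auto

lemma len_one [simp]: "len \<one> = 0"
  using len_le[of "[]"] by simp

lemma len_mult: "g \<in> carrier G \<Longrightarrow> h \<in> carrier G \<Longrightarrow> len (g \<otimes> h) \<le> len g + len h"
proof -
  assume "g \<in> carrier G" "h \<in> carrier G"
  then obtain u v where "length u = len g" "set u \<subseteq> letters" "eval u = g"
    "length v = len h" "set v \<subseteq> letters" "eval v = h" using len_word by metis
  then show ?thesis using len_le[of "u @ v"] eval_append[of u v] by simp
qed

lemma len_inv_le: "g \<in> carrier G \<Longrightarrow> len (inv g) \<le> len g"
proof -
  assume "g \<in> carrier G"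
  then obtain u where u: "length u = len g" "set u \<subseteq> letters" "eval u = g"
    using len_word by metis
  then have "set (rev (map (m_inv G) u)) \<subseteq> letters" using inv_letters by auto
  then show ?thesis using len_le[of "rev (map (m_inv G) u)"] eval_rev[of u] u by simp
qed

lemma len_inv: "g \<in> carrier G \<Longrightarrow> len (inv g) = len g"
  using len_inv_le[of g] len_inv_le[of "inv g"] by simp

lemma finite_ball: "finite {g \<in> carrier G. len g \<le> n}"
proof (rule finite_subset)
  show "{g \<in> carrier G. len g \<le> n} \<subseteq> eval ` {w. set w \<subseteq> letters \<and> length w \<le> n}"
  proof
    fix g assume "g \<in> {g \<in> carrier G. len g \<le> n}"
    then show "g \<in> eval ` {w. set w \<subseteq> letters \<and> length w \<le> n}"
      using len_word[of g] by auto
  qed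
  show "finite (eval ` {w. set w \<subseteq> letters \<and> length w \<le> n})"
    by (intro finite_imageI finite_lists_length_le finite_letters)
qed

lemma finite_len_bound:
  assumes "finite E" shows "\<exists>C. \<forall>e\<in>E. real (len e) \<le> C"
  using finite_imageI[OF assms, of "\<lambda>e. real (len e)"] by (meson Max_ge imageI)

lemma len_split:
  assumes "g \<in> carrier G" "j \<le> len g"
  shows "\<exists>h\<in>carrier G. len h = j \<and> len (inv h \<otimes> g) = len g - j"
proof -
  obtain w where w: "length w = len g" "set w \<subseteq> letters" "eval w = g"
    using len_word[OF assms(1)] by metis
  have s: "set (take j w) \<subseteq> letters" "set (drop j w) \<subseteq> letters"
    using w(2) set_take_subset[of j w] set_drop_subset[of j w] by auto
  define h where "h = eval (take j w)"
  have h: "h \<in> carrier G" unfolding h_def using s by simp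
  have g: "g = h \<otimes> eval (drop j w)"
    using eval_append[OF s] w(3) unfolding h_def append_take_drop_id by simp
  have e: "inv h \<otimes> g = eval (drop j w)"
    unfolding g using h s by (simp add: m_assoc[symmetric])
  have "len h \<le> j" "len (inv h \<otimes> g) \<le> len g - j"
    unfolding e unfolding h_def using len_le[OF s(1)] len_le[OF s(2)] w(1) assms(2) by auto
  moreover have "len g \<le> len h + len (inv h \<otimes> g)"
    using len_mult[of h "inv h \<otimes> g"] h assms(1) by (simp add: m_assoc[symmetric])
  ultimately have "len h = j" "len (inv h \<otimes> g) = len g - j" using assms(2) by linarith+
  with h show ?thesis by blast
qed

lemma dis_ge0 [simp]: "0 \<le> dis a b"
  by (simp add: word_dist_def)

lemma dis_self [simp]: "a \<in> carrier G \<Longrightarrow> dis a a = 0"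
  by (simp add: word_dist_def)

lemma dis_commute: "a \<in> carrier G \<Longrightarrow> b \<in> carrier G \<Longrightarrow> dis a b = dis b a"
  using len_inv[of "inv a \<otimes> b"] by (simp add: word_dist_def inv_mult_group)

lemma dis_triangle:
  assumes "a \<in> carrier G" "b \<in> carrier G" "c \<in> carrier G"
  shows "dis a c \<le> dis a b + dis b c"
proof -
  have "inv a \<otimes> c = (inv a \<otimes> b) \<otimes> (inv b \<otimes> c)"
    using assms by (simp add: m_assoc)
  then show ?thesis
    using len_mult[of "inv a \<otimes> b" "inv b \<otimes> c"] assms by (simp add: word_dist_def)
qed

lemma dis_translate:
  assumes "a \<in> carrier G" "b \<in> carrier G" "c \<in> carrier G"
  shows "dis (c \<otimes> a) (c \<otimes> b) = dis a b"
proof -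
  have "inv (c \<otimes> a) \<otimes> (c \<otimes> b) = inv a \<otimes> b"
    using assms by (simp add: inv_mult_group m_assoc)
  then show ?thesis by (simp add: word_dist_def)
qed

lemma dis_one: "g \<in> carrier G \<Longrightarrow> dis \<one> g = real (len g)" "g \<in> carrier G \<Longrightarrow> dis g \<one> = real (len g)"
  by (simp_all add: word_dist_def len_inv)

lemma dis_mult_right: "a \<in> carrier G \<Longrightarrow> h \<in> carrier G \<Longrightarrow> dis a (a \<otimes> h) = real (len h)"
  by (simp add: word_dist_def m_assoc[symmetric])

lemma dis_nat: "dis a b = real (nat \<lfloor>dis a b\<rfloor>)"
  by (simp add: word_dist_def)

lemma dis_split:
  assumes "a \<in> carrier G" "b \<in> carrier G" "real j \<le> dis a b"
  shows "\<exists>c\<in>carrier G. dis a c = real j \<and> dis c b = dis a b - real j"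
proof -
  have "j \<le> len (inv a \<otimes> b)" using assms(3) by (simp add: word_dist_def)
  then obtain h where h: "h \<in> carrier G" "len h = j"
    "len (inv h \<otimes> (inv a \<otimes> b)) = len (inv a \<otimes> b) - j"
    using len_split[of "inv a \<otimes> b" j] assms by auto
  have "dis (a \<otimes> h) b = dis a b - real j"
    using h assms by (simp add: word_dist_def inv_mult_group m_assoc of_nat_diff)
  moreover have "dis a (a \<otimes> h) = real j" using h assms dis_mult_right by simp
  ultimately show ?thesis using h assms by (meson m_closed)
qed

lemma geodesic_path:
  assumes "a \<in> carrier G" "b \<in> carrier G"
  obtains x where "x 0 = a" "x (len (inv a \<otimes> b)) = b"
    "\<And>i. x i \<in> carrier G" "\<And>i. dis (x i) (x (Suc i)) \<le> 1"
proof -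
  obtain w where w: "length w = len (inv a \<otimes> b)" "set w \<subseteq> letters" "eval w = inv a \<otimes> b"
    using len_word[of "inv a \<otimes> b"] assms by auto
  have st: "set (take i w) \<subseteq> letters" for i using w(2) set_take_subset[of i w] by auto
  define x where "x i = a \<otimes> eval (take i w)" for i
  have xc: "x i \<in> carrier G" for i unfolding x_def using st assms by simp
  have "dis (x i) (x (Suc i)) \<le> 1" for i
  proof (cases "i < length w")
    case True
    have wi: "w ! i \<in> letters" using nth_mem[OF True] w(2) by blast
    then have wc: "w ! i \<in> carrier G" using letters_closed by auto
    have "eval (take (Suc i) w) = eval (take i w) \<otimes> w ! i"
      using eval_append[OF st[of i], of "[w ! i]"] wi wc True by (simp add: take_Suc_conv_app_nth)
    then have "x (Suc i) = x i \<otimes> w ! i" unfolding x_def using st[of i] assms wc by (simp add: m_assoc)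
    moreover have "len (w ! i) \<le> 1" using len_le[of "[w ! i]"] wi wc by simp
    ultimately show ?thesis using dis_mult_right[OF xc wc] by simp
  next
    case False
    then have "x (Suc i) = x i" by (simp add: x_def)
    then show ?thesis using xc by simp
  qed
  moreover have "x 0 = a" "x (len (inv a \<otimes> b)) = b"
    unfolding x_def using w assms by (simp_all add: w(1)[symmetric] m_assoc[symmetric])
  ultimately show thesis using that xc by blast
qed

lemma gp_commute: "a \<in> carrier G \<Longrightarrow> b \<in> carrier G \<Longrightarrow> gp p a b = gp p b a"
  by (simp add: gromov_product_def dis_commute)

lemma gp_le_dis:
  assumes "p \<in> carrier G" "a \<in> carrier G" "b \<in> carrier G"
  shows "gp p a b \<le> dis p a" "gp p a b \<le> dis p b"
  using dis_triangle[of a b p] dis_triangle[of b a p] assms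
  by (simp_all add: gromov_product_def dis_commute field_simps)

lemma gp_ge_0: "p \<in> carrier G \<Longrightarrow> a \<in> carrier G \<Longrightarrow> b \<in> carrier G \<Longrightarrow> 0 \<le> gp p a b"
  using dis_triangle[of a p b] by (simp add: gromov_product_def dis_commute)

lemma gp_Lipschitz:
  assumes "p \<in> carrier G" "a \<in> carrier G" "b \<in> carrier G" "c \<in> carrier G"
  shows "gp p a b - dis b c \<le> gp p a c"
  using dis_triangle[of b c p] dis_triangle[of a b c] assms
  by (simp add: gromov_product_def dis_commute field_simps)

lemma gp_base:
  assumes "p \<in> carrier G" "q \<in> carrier G" "a \<in> carrier G" "b \<in> carrier G"
  shows "gp p a b - dis p q \<le> gp q a b"
  using dis_triangle[of a q p] dis_triangle[of b q p] assms
  by (simp add: gromov_product_def dis_commute field_simps)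

lemma gp_translate:
  assumes "p \<in> carrier G" "a \<in> carrier G" "b \<in> carrier G" "c \<in> carrier G"
  shows "gp (c \<otimes> p) (c \<otimes> a) (c \<otimes> b) = gp p a b"
  using assms by (simp add: gromov_product_def dis_translate)

end

section \<open>Quasiconvexity in a hyperbolic group\<close>

locale hyperbolic_word_metric = word_metric +
  fixes \<delta> :: real
  assumes delta_ge_1: "1 \<le> \<delta>"
    and gp_min: "\<And>p a b c. p \<in> carrier G \<Longrightarrow> a \<in> carrier G \<Longrightarrow> b \<in> carrier G \<Longrightarrow> c \<in> carrier G \<Longrightarrow>
       min (gp p a b) (gp p b c) - \<delta> \<le> gp p a c"
begin

text \<open>Bisecting the chain applies the four-point inequality once per level of a binary tree,
  so \<open>2 ^ N\<close> steps cost only \<open>N\<close> times \<delta>. This logarithmic loss is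
  what the Morse argument lives on.\<close>

lemma gp_path:
  assumes "q \<in> carrier G" "\<And>i. x i \<in> carrier G" "\<And>i. m \<le> i \<Longrightarrow> i < n \<Longrightarrow> r \<le> gp q (x i) (x (Suc i))"
    "m < n" "n - m \<le> 2 ^ N"
  shows "r - real N * \<delta> \<le> gp q (x m) (x n)"
  using assms(3-5)
proof (induction N arbitrary: m n)
  case 0
  then have "n = Suc m" by simp
  with 0 show ?case by simp
next
  case (Suc N)
  show ?case
  proof (cases "n - m \<le> 2 ^ N")
    case True
    then have "r - real N * \<delta> \<le> gp q (x m) (x n)" using Suc by blast
    then show ?thesis using delta_ge_1 by (simp add: algebra_simps)
  next
    case False
    define j where "j = m + 2 ^ N"
    have j: "m < j" "j < n" "j - m \<le> 2 ^ N" "n - j \<le> 2 ^ N"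
      using False Suc.prems by (auto simp: j_def)
    have "r - real N * \<delta> \<le> gp q (x m) (x j)"
      by (rule Suc.IH) (use j Suc.prems in auto)
    moreover have "r - real N * \<delta> \<le> gp q (x j) (x n)"
      by (rule Suc.IH) (use j Suc.prems in auto)
    moreover have "min (gp q (x m) (x j)) (gp q (x j) (x n)) - \<delta> \<le> gp q (x m) (x n)"
      by (rule gp_min) (use assms in auto)
    ultimately show ?thesis by (simp add: algebra_simps)
  qed
qed

text \<open>A coarse substitute for a quasigeodesic or a quasiconvex set: only the number of steps
  is bounded, linearly in the distance of the end points. Both the image of a Lipschitz retraction
  and a geodesic for another generating set have this property.\<close>

definition linearly_connected :: "real \<Rightarrow> 'a set \<Rightarrow> bool" where
  "linearly_connected C B \<longleftrightarrow> B \<subseteq> carrier G \<and>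
    (\<forall>a\<in>B. \<forall>b\<in>B. \<exists>x n. x 0 = a \<and> x n = b \<and> real n \<le> C * dis a b \<and> (\<forall>i::nat. x i \<in> B) \<and>
      (\<forall>i<n. dis (x i) (x (Suc i)) \<le> C))"

definition interval :: "'a \<Rightarrow> 'a \<Rightarrow> 'a set" where
  "interval u v = {q \<in> carrier G. dis u q + dis q v = dis u v}"

text \<open>
  Let \<open>q\<close> be a point of an interval at maximal distance \<open>D\<close> from a linearly connected set. A path of
  length \<open>O(D)\<close> that stays at distance about \<open>D\<close> from \<open>q\<close> joins two points on either side of \<open>q\<close>,
  so that \<open>gp_path\<close> gives \<open>D \<le> O(log D)\<close>.
\<close>

lemma Morse_bound:
  assumes "1 \<le> C"
  shows "\<exists>K. \<forall>D::nat. (\<forall>N. 6 * C * real D \<le> 2 ^ N \<longrightarrow> real D \<le> C / 2 + (real N + 2) * \<delta>) \<longrightarrow> real D \<le> K"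
proof -
  have "eventually (\<lambda>N. C / 2 + (real N + 2) * \<delta> < 2 ^ (N - 1) / (6 * C)) sequentially"
    using assms delta_ge_1 by real_asymp
  then obtain N0 where N0: "\<And>N. N0 \<le> N \<Longrightarrow> C / 2 + (real N + 2) * \<delta> < 2 ^ (N - 1) / (6 * C)"
    by (auto simp: eventually_sequentially)
  show ?thesis
  proof (intro exI[of _ "2 ^ N0 / (6 * C)"] allI impI)
    fix D :: nat
    assume D: "\<forall>N. 6 * C * real D \<le> 2 ^ N \<longrightarrow> real D \<le> C / 2 + (real N + 2) * \<delta>"
    show "real D \<le> 2 ^ N0 / (6 * C)"
    proof (rule ccontr)
      assume "\<not> ?thesis"
      then have big: "2 ^ N0 < 6 * C * real D" using assms by (simp add: field_simps)
      obtain N1 where "6 * C * real D < 2 ^ N1" using real_arch_pow[of 2] by auto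
      then have ex: "\<exists>N. 6 * C * real D \<le> 2 ^ N" by (meson less_imp_le)
      \<comment> \<open>For the least such \<open>N\<close> one has
        \<open>2 ^ (N - 1) < 6 * C * D\<close> as soon as \<open>N\<close> is positive. So
        \<open>D\<close> exceeds an exponential in \<open>N\<close>, while the hypothesis bounds it
        linearly in \<open>N\<close>.\<close>
      define N where "N = (LEAST N. 6 * C * real D \<le> 2 ^ N)"
      have N: "6 * C * real D \<le> 2 ^ N" unfolding N_def by (rule LeastI_ex[OF ex])
      have "N0 < N"
      proof (rule ccontr)
        assume "\<not> N0 < N"
        then have "(2::real) ^ N \<le> 2 ^ N0" by (intro power_increasing) auto
        with big N show False by linarith
      qed
      then have "\<not> 6 * C * real D \<le> 2 ^ (N - 1)"
        unfolding N_def using not_less_Least[of "N - 1"] by (metis N_def diff_less less_nat_zero_code not_gr_zero zero_less_one)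
      then have "2 ^ (N - 1) / (6 * C) < real D" using assms by (simp add: field_simps)
      moreover have "real D \<le> C / 2 + (real N + 2) * \<delta>" using D N by blast
      ultimately show False using N0[of N] \<open>N0 < N\<close> by linarith
    qed
  qed
qed

lemma interval_near_linearly_connected:
  assumes C: "1 \<le> C"
  obtains K where "0 \<le> K" "\<And>B u v q. linearly_connected C B \<Longrightarrow> u \<in> B \<Longrightarrow> v \<in> B \<Longrightarrow> q \<in> interval u v \<Longrightarrow>
     \<exists>b\<in>B. dis q b \<le> K"
proof -
  obtain K where K: "\<And>D::nat. (\<And>N. 6 * C * real D \<le> 2 ^ N \<Longrightarrow> real D \<le> C / 2 + (real N + 2) * \<delta>) \<Longrightarrow> real D \<le> K"
    using Morse_bound[OF C] by blast
  have main: "\<exists>b\<in>B. dis q0 b \<le> K"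
    if B: "linearly_connected C B" and u: "u \<in> B" and v: "v \<in> B" and q0: "q0 \<in> interval u v" for B u v q0
  proof -
    have Bc: "B \<subseteq> carrier G" using B by (simp add: linearly_connected_def)
    have uc: "u \<in> carrier G" and vc: "v \<in> carrier G" using Bc u v by auto
    \<comment> \<open>Distances are natural numbers, so the distance from \<open>q\<close> to
      \<open>B\<close> is attained.\<close>
    define e where "e q = (LEAST n. \<exists>b\<in>B. dis q b = real n)" for q
    have e_ex: "\<exists>b\<in>B. dis q b = real (e q)" for q
      unfolding e_def by (rule LeastI_ex) (use u dis_nat in blast)
    have e_le: "real (e q) \<le> dis q b" if "b \<in> B" for q b
    proof -
      have "e q \<le> nat \<lfloor>dis q b\<rfloor>"
        unfolding e_def by (rule Least_le) (use that dis_nat in blast)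
      then show ?thesis using dis_nat[of q b] by linarith
    qed
    \<comment> \<open>On the interval \<open>e\<close> is bounded by the distance to
      \<open>v\<close>, hence has a maximum. Bounding it at the maximiser \<open>q\<close> bounds it
      at \<open>q0\<close> as well.\<close>
    have "\<exists>q. q \<in> interval u v \<and> (\<forall>y. y \<in> interval u v \<longrightarrow> e y \<le> e q)"
    proof (rule Lattices_Big.ex_has_greatest_nat[of _ q0 _ "Suc (nat \<lceil>dis u v\<rceil>)"])
      show "\<forall>y. y \<in> interval u v \<longrightarrow> e y < Suc (nat \<lceil>dis u v\<rceil>)"
      proof (intro allI impI)
        fix y assume y: "y \<in> interval u v"
        have "real (e y) \<le> dis y v" by (rule e_le[OF v])
        also have "\<dots> \<le> dis u v" using y dis_ge0[of u y] by (simp add: interval_def del: dis_ge0)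
        finally show "e y < Suc (nat \<lceil>dis u v\<rceil>)" by linarith
      qed
    qed (rule q0)
    then obtain q where q: "q \<in> interval u v" and qmax: "\<And>y. y \<in> interval u v \<Longrightarrow> e y \<le> e q" by blast
    define D where "D = e q"
    have qc: "q \<in> carrier G" and quv: "dis u q + dis q v = dis u v" using q by (auto simp: interval_def)
    \<comment> \<open>Walk from \<open>q\<close> towards \<open>w\<close> for \<open>2 * D\<close>,
      or up to \<open>w\<close> if that comes sooner. After a full walk maximality gives a point
      \<open>b\<close> of \<open>B\<close> within \<open>D\<close> of \<open>u'\<close>, and
      \<open>b\<close> is at least \<open>D\<close> away from \<open>q\<close>, so the product at
      \<open>q\<close> is at least \<open>(2 * D + D - D) / 2\<close>. If \<open>w\<close> is
      reached, it serves as \<open>b\<close> itself.\<close>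
    have near: "\<exists>u' b. u' \<in> interval u v \<and> b \<in> B \<and> dis q u' + dis u' w = dis q w \<and> dis q u' \<le> 2 * real D
        \<and> dis u' b \<le> real D \<and> real D \<le> gp q u' b" if w: "w = u \<or> w = v" for w
    proof -
      have wB: "w \<in> B" and wc: "w \<in> carrier G" using w u v uc vc by auto
      have "real (min (2 * D) (nat \<lfloor>dis q w\<rfloor>)) \<le> dis q w" using dis_nat[of q w] by linarith
      then obtain u' where u': "u' \<in> carrier G" "dis q u' = real (min (2 * D) (nat \<lfloor>dis q w\<rfloor>))"
        "dis u' w = dis q w - dis q u'" using dis_split[OF qc wc] by metis
      have uI: "u' \<in> interval u v"
        using w
      proof
        assume "w = u"
        then have "dis u u' + dis u' q = dis u q" using u' uc qc dis_commute by force
        moreover have "dis u' v \<le> dis u' q + dis q v" "dis u v \<le> dis u u' + dis u' v"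
          using dis_triangle u'(1) uc qc vc by blast+
        ultimately show ?thesis using quv u'(1) by (simp add: interval_def)
      next
        assume "w = v"
        then have "dis q u' + dis u' v = dis q v" using u' by simp
        moreover have "dis u u' \<le> dis u q + dis q u'" "dis u v \<le> dis u u' + dis u' v"
          using dis_triangle u'(1) uc qc vc by blast+
        ultimately show ?thesis using quv u'(1) by (simp add: interval_def)
      qed
      have sum: "dis q u' + dis u' w = dis q w" using u' by simp
      have le: "dis q u' \<le> 2 * real D" unfolding u'(2) by simp
      show ?thesis
      proof (cases "dis q w \<le> 2 * real D")
        case True
        have "nat \<lfloor>dis q w\<rfloor> \<le> 2 * D" using True dis_nat[of q w] by linarith
        then have d: "dis q u' = dis q w" using u' dis_nat[of q w] by simp
        have "dis u' w = 0" using sum d by simp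
        have wq: "real D \<le> dis q w" unfolding D_def by (rule e_le[OF wB])
        have "real D \<le> gp q u' w" using wq d \<open>dis u' w = 0\<close> u'(1) qc wc
          by (simp add: gromov_product_def dis_commute)
        then show ?thesis using uI wB sum le \<open>dis u' w = 0\<close> by (intro exI[of _ u'] exI[of _ w]) auto
      next
        case False
        then have "2 * D \<le> nat \<lfloor>dis q w\<rfloor>" using dis_nat[of q w] by linarith
        then have d: "dis q u' = 2 * real D" using u'(2) by simp
        obtain b where b: "b \<in> B" "dis u' b = real (e u')" using e_ex by blast
        have ub: "dis u' b \<le> real D" using b qmax[OF uI] by (simp add: D_def)
        have "real D \<le> dis q b" unfolding D_def by (rule e_le[OF b(1)])
        then have "real D \<le> gp q u' b" using ub d b Bc u'(1) qc
          by (simp add: gromov_product_def dis_commute subset_iff)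
        then show ?thesis using uI b sum le ub by blast
      qed
    qed
    obtain u' b where u': "u' \<in> interval u v" "b \<in> B" "dis q u' + dis u' u = dis q u" "dis q u' \<le> 2 * real D"
        "dis u' b \<le> real D" "real D \<le> gp q u' b" using near[of u] by blast
    obtain v' b' where v': "v' \<in> interval u v" "b' \<in> B" "dis q v' + dis v' v = dis q v" "dis q v' \<le> 2 * real D"
        "dis v' b' \<le> real D" "real D \<le> gp q v' b'" using near[of v] by blast
    have c: "u' \<in> carrier G" "v' \<in> carrier G" "b \<in> carrier G" "b' \<in> carrier G"
      using u' v' Bc by (auto simp: interval_def)
    \<comment> \<open>The points \<open>u'\<close> and \<open>v'\<close> lie on opposite sides of
      \<open>q\<close> on the interval. This upper bound is what the chain of lower bounds below
      collides with.\<close>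
    have g0: "gp q u' v' \<le> 0"
    proof -
      have "dis u v \<le> dis u u' + dis u' v" "dis u' v \<le> dis u' v' + dis v' v"
        using dis_triangle c uc vc by auto
      then show ?thesis using u'(3) v'(3) quv c uc vc qc
        by (simp add: gromov_product_def dis_commute)
    qed
    have bb: "dis b b' \<le> 6 * real D"
    proof -
      have "dis b b' \<le> dis b u' + dis u' b'" "dis u' b' \<le> dis u' q + dis q b'" "dis q b' \<le> dis q v' + dis v' b'"
        using dis_triangle c qc by auto
      then show ?thesis using u' v' c qc by (simp add: dis_commute)
    qed
    obtain x n where x: "x 0 = b" "x n = b'" "real n \<le> C * dis b b'" "\<And>i. x i \<in> B"
        "\<And>i. i < n \<Longrightarrow> dis (x i) (x (Suc i)) \<le> C"
      using B u'(2) v'(2) unfolding linearly_connected_def by metis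
    have "real D \<le> C / 2 + (real N + 2) * \<delta>" if N: "6 * C * real D \<le> 2 ^ N" for N
    proof -
      have "C * dis b b' \<le> C * (6 * real D)" using bb C by (intro mult_left_mono) auto
      then have "real n \<le> 2 ^ N" using x(3) N by linarith
      then have n: "n \<le> 2 ^ N" by (metis of_nat_le_iff of_nat_numeral of_nat_power)
      \<comment> \<open>No point of the path comes closer to \<open>q\<close> than \<open>D\<close>,
        and neighbours on it are at most \<open>C\<close> apart.\<close>
      have gpx: "real D - C / 2 \<le> gp q (x i) (x (Suc i))" if "i < n" for i
      proof -
        have "real D \<le> dis q (x i)" "real D \<le> dis q (x (Suc i))"
          unfolding D_def using x(4) e_le by auto
        then show ?thesis using x(5)[OF that] x(4) Bc qc
          by (simp add: gromov_product_def dis_commute subset_iff field_simps)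
      qed
      have "real D - C / 2 - real N * \<delta> \<le> gp q b b'"
      proof (cases "n = 0")
        case True
        have "real D \<le> dis q b" unfolding D_def using u'(2) e_le by auto
        moreover have "0 \<le> real N * \<delta>" using delta_ge_1 by simp
        ultimately show ?thesis using True x c qc C by (simp add: gromov_product_def dis_commute)
      next
        case False
        then show ?thesis using gp_path[of q x 0 n "real D - C / 2" N] gpx n x Bc qc by (auto simp: subset_iff)
      qed
      moreover have "0 \<le> real N * \<delta>" using delta_ge_1 by simp
      moreover have "min (gp q u' b) (gp q b b') - \<delta> \<le> gp q u' b'"
        "min (gp q u' b') (gp q b' v') - \<delta> \<le> gp q u' v'" using gp_min c qc by auto
      moreover have "gp q b' v' = gp q v' b'" using gp_commute c by simp
      ultimately show ?thesis using g0 u'(6) v'(6) C by (simp add: algebra_simps)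
    qed
    then have "real D \<le> K" by (rule K)
    moreover have "e q0 \<le> D" unfolding D_def by (rule qmax[OF q0])
    moreover obtain b0 where "b0 \<in> B" "dis q0 b0 = real (e q0)" using e_ex by blast
    ultimately show ?thesis by force
  qed
  have "\<exists>b\<in>B. dis q b \<le> max K 0"
    if "linearly_connected C B" "u \<in> B" "v \<in> B" "q \<in> interval u v" for B u v q
    using main[OF that] by force
  then show thesis by (intro that[of "max K 0"]) simp_all
qed

text \<open>Take the point of the interval at distance \<open>gp u p v\<close> from
  \<open>u\<close>, the foot of \<open>p\<close> in the approximating tripod. Rounding this distance
  down to a natural number costs the summand 1.\<close>

lemma interval_near_basepoint:
  assumes "p \<in> carrier G" "u \<in> carrier G" "v \<in> carrier G"
  shows "\<exists>q\<in>interval u v. dis p q \<le> gp p u v + 2 * \<delta> + 1"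
proof -
  define j where "j = nat \<lfloor>gp u p v\<rfloor>"
  have g: "0 \<le> gp u p v" "gp u p v \<le> dis u v" using gp_ge_0 gp_le_dis assms by auto
  then have j: "real j \<le> gp u p v" "gp u p v \<le> real j + 1" unfolding j_def by linarith+
  then obtain q where q: "q \<in> carrier G" "dis u q = real j" "dis q v = dis u v - real j"
    using dis_split[of u v j] assms g by auto
  have gg: "gp u p v = (dis u p + dis u v - dis p v) / 2"
    "gp u p q = (dis u p + dis u q - dis p q) / 2"
    "gp u q v = (dis u q + dis u v - dis q v) / 2"
    "gp p u v = (dis u p + dis p v - dis u v) / 2"
    using assms q by (simp_all add: gromov_product_def dis_commute)
  have "min (gp u p v) (gp u v q) - \<delta> \<le> gp u p q" by (rule gp_min) (use assms q in auto)
  moreover have "gp u v q = real j" using gp_commute[of v q u] assms q gg(3) by simp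
  ultimately have "real j - \<delta> \<le> gp u p q" using j by simp
  then have "dis p q \<le> dis u p - real j + 2 * \<delta>" unfolding gg(2) q(2) by (simp add: field_simps)
  moreover have "dis u p + dis u v - dis p v \<le> 2 * real j + 2" using j(2) unfolding gg(1) by (simp add: field_simps)
  ultimately have "dis p q \<le> gp p u v + 2 * \<delta> + 1" unfolding gg(4) by (simp add: field_simps)
  then show ?thesis using q by (auto simp: interval_def)
qed

text \<open>This is the form in which quasiconvexity is used: if \<open>B\<close> stays away from a
  large ball around \<open>p\<close>, then any two points of \<open>B\<close> have a large Gromov
  product at \<open>p\<close>.\<close>

lemma linearly_connected_quasiconvex:
  assumes C: "1 \<le> C"
  obtains K where "\<And>B u v p. linearly_connected C B \<Longrightarrow> u \<in> B \<Longrightarrow> v \<in> B \<Longrightarrow> p \<in> carrier G \<Longrightarrow>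
     \<exists>b\<in>B. dis p b \<le> gp p u v + K"
proof -
  obtain K where K: "0 \<le> K" "\<And>B u v q. linearly_connected C B \<Longrightarrow> u \<in> B \<Longrightarrow> v \<in> B \<Longrightarrow> q \<in> interval u v \<Longrightarrow>
     \<exists>b\<in>B. dis q b \<le> K" using interval_near_linearly_connected[OF C] by blast
  show thesis
  proof (rule that[of "2 * \<delta> + 1 + K"])
    fix B u v p assume B: "linearly_connected C B" "u \<in> B" "v \<in> B" and p: "p \<in> carrier G"
    have Bc: "B \<subseteq> carrier G" using B by (simp add: linearly_connected_def)
    obtain q where q: "q \<in> interval u v" "dis p q \<le> gp p u v + 2 * \<delta> + 1"
      using interval_near_basepoint[of p u v] p B Bc by auto
    obtain b where b: "b \<in> B" "dis q b \<le> K" using K B q by blast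
    have "dis p b \<le> dis p q + dis q b" using dis_triangle p q b Bc by (auto simp: interval_def)
    then show "\<exists>b\<in>B. dis p b \<le> gp p u v + (2 * \<delta> + 1 + K)" using b q by force
  qed
qed

end


section \<open>Controlled retractions and change of generators\<close>

text \<open>
  Uniformly Lipschitz maps, expressed without a choice of generators so that different subgroups of
  a word metric can be compared.
\<close>

definition controlled :: "('g, 'c) monoid_scheme \<Rightarrow> 'g set \<Rightarrow> ('g \<Rightarrow> 'g) set \<Rightarrow> bool" where
  "controlled G A R \<longleftrightarrow> (\<forall>\<rho>\<in>R. \<forall>g\<in>A. \<rho> g \<in> carrier G) \<and>
    (\<forall>e\<in>A. \<exists>E. finite E \<and> E \<subseteq> carrier G \<and>
      (\<forall>\<rho>\<in>R. \<forall>g\<in>A. inv\<^bsub>G\<^esub> (\<rho> g) \<otimes>\<^bsub>G\<^esub> \<rho> (g \<otimes>\<^bsub>G\<^esub> e) \<in> E))"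

context group
begin

lemma finite_product_set:
  assumes "finite E1" "E1 \<subseteq> carrier G" "finite E2" "E2 \<subseteq> carrier G"
  shows "finite ((\<lambda>(a, b). a \<otimes> b) ` (E1 \<times> E2))" "(\<lambda>(a, b). a \<otimes> b) ` (E1 \<times> E2) \<subseteq> carrier G"
  using assms by auto

lemma telescope:
  assumes "a \<in> carrier G" "b \<in> carrier G" "c \<in> carrier G"
  shows "(inv a \<otimes> b) \<otimes> (inv b \<otimes> c) = inv a \<otimes> c"
proof -
  have "(inv a \<otimes> b) \<otimes> (inv b \<otimes> c) = inv a \<otimes> ((b \<otimes> inv b) \<otimes> c)"
    using assms by (simp only: m_assoc m_closed inv_closed)
  then show ?thesis using assms by simp
qed

text \<open>Displacements multiply along a product of generators, and the displacement for an
  inverse generator is the inverse of a displacement read at the other end. Finite sets of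
  displacements for the generators thus yield finite sets for all elements.\<close>

lemma controlled_generate:
  assumes A: "subgroup A G" and Y: "Y \<subseteq> A" "A \<subseteq> generate G Y"
    and clo: "\<And>\<rho> g. \<rho> \<in> R \<Longrightarrow> g \<in> A \<Longrightarrow> \<rho> g \<in> carrier G"
    and gen: "\<And>y. y \<in> Y \<Longrightarrow> \<exists>E. finite E \<and> E \<subseteq> carrier G \<and>
      (\<forall>\<rho>\<in>R. \<forall>g\<in>A. inv (\<rho> g) \<otimes> \<rho> (g \<otimes> y) \<in> E)"
  shows "controlled G A R"
proof -
  note sub = subgroup.subset[OF A] subgroup.m_closed[OF A] subgroup.m_inv_closed[OF A]
  have YA: "generate G Y \<subseteq> A" by (rule generate_subgroup_incl[OF Y(1) A])
  have "\<exists>E. finite E \<and> E \<subseteq> carrier G \<and> (\<forall>\<rho>\<in>R. \<forall>g\<in>A. inv (\<rho> g) \<otimes> \<rho> (g \<otimes> e) \<in> E)"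
    if "e \<in> generate G Y" for e
    using that
  proof (induction rule: generate.induct)
    case one
    show ?case using sub(1) clo by (intro exI[of _ "{\<one>}"]) (auto simp: subset_iff)
  next
    case (incl h)
    then show ?case by (rule gen)
  next
    case (inv h)
    obtain E where E: "finite E" "E \<subseteq> carrier G" "\<And>\<rho> g. \<rho> \<in> R \<Longrightarrow> g \<in> A \<Longrightarrow> inv (\<rho> g) \<otimes> \<rho> (g \<otimes> h) \<in> E"
      using gen[OF inv] by blast
    have hA: "h \<in> A" "inv h \<in> A" using inv Y sub by auto
    have "inv (\<rho> g) \<otimes> \<rho> (g \<otimes> inv h) \<in> m_inv G ` E" if r: "\<rho> \<in> R" and g: "g \<in> A" for \<rho> g
    proof -
      have gh: "g \<otimes> inv h \<in> A" using g hA sub by blast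
      have "g \<otimes> inv h \<otimes> h = g" using g hA sub(1) by (simp add: m_assoc subset_iff)
      then have "inv (\<rho> (g \<otimes> inv h)) \<otimes> \<rho> g \<in> E" using E(3)[OF r gh] by simp
      moreover have "inv (inv (\<rho> (g \<otimes> inv h)) \<otimes> \<rho> g) = inv (\<rho> g) \<otimes> \<rho> (g \<otimes> inv h)"
        using clo[OF r gh] clo[OF r g] by (simp add: inv_mult_group)
      ultimately show ?thesis by (metis imageI)
    qed
    then show ?case using E(1,2) by (intro exI[of _ "m_inv G ` E"]) auto
  next
    case (eng h1 h2)
    obtain E1 where E1: "finite E1" "E1 \<subseteq> carrier G" "\<And>\<rho> g. \<rho> \<in> R \<Longrightarrow> g \<in> A \<Longrightarrow> inv (\<rho> g) \<otimes> \<rho> (g \<otimes> h1) \<in> E1"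
      using eng.IH(1) by blast
    obtain E2 where E2: "finite E2" "E2 \<subseteq> carrier G" "\<And>\<rho> g. \<rho> \<in> R \<Longrightarrow> g \<in> A \<Longrightarrow> inv (\<rho> g) \<otimes> \<rho> (g \<otimes> h2) \<in> E2"
      using eng.IH(2) by blast
    have hA: "h1 \<in> A" "h2 \<in> A" using eng.hyps YA by auto
    have "inv (\<rho> g) \<otimes> \<rho> (g \<otimes> (h1 \<otimes> h2)) \<in> (\<lambda>(a, b). a \<otimes> b) ` (E1 \<times> E2)" if r: "\<rho> \<in> R" and g: "g \<in> A" for \<rho> g
    proof -
      have g1: "g \<otimes> h1 \<in> A" using g hA sub by blast
      have g2: "g \<otimes> h1 \<otimes> h2 \<in> A" using g1 hA sub by blast
      have eq: "g \<otimes> (h1 \<otimes> h2) = g \<otimes> h1 \<otimes> h2" using g hA sub(1) by (simp add: m_assoc subset_iff)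
      have "inv (\<rho> g) \<otimes> \<rho> (g \<otimes> (h1 \<otimes> h2)) =
          (inv (\<rho> g) \<otimes> \<rho> (g \<otimes> h1)) \<otimes> (inv (\<rho> (g \<otimes> h1)) \<otimes> \<rho> (g \<otimes> h1 \<otimes> h2))"
        unfolding eq using telescope[OF clo[OF r g] clo[OF r g1] clo[OF r g2]] by simp
      then show ?thesis using E1(3)[OF r g] E2(3)[OF r g1] by (auto simp: image_iff)
    qed
    then show ?case using finite_product_set[OF E1(1,2) E2(1,2)] by blast
  qed
  then show ?thesis using clo Y(2) unfolding controlled_def by blast
qed

lemma controlled_comp:
  assumes R: "controlled G A R" and A: "A \<subseteq> carrier G"
    and A': "subgroup A' G" "\<And>\<rho> g. \<rho> \<in> R \<Longrightarrow> g \<in> A \<Longrightarrow> \<rho> g \<in> A'"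
    and mul: "\<And>g e. g \<in> A \<Longrightarrow> e \<in> A \<Longrightarrow> g \<otimes> e \<in> A"
    and R': "controlled G A' R'"
  shows "controlled G A {\<rho>' \<circ> \<rho> | \<rho>' \<rho>. \<rho>' \<in> R' \<and> \<rho> \<in> R}"
  unfolding controlled_def
proof (intro conjI ballI)
  fix \<sigma> g assume "\<sigma> \<in> {\<rho>' \<circ> \<rho> | \<rho>' \<rho>. \<rho>' \<in> R' \<and> \<rho> \<in> R}" "g \<in> A"
  then show "\<sigma> g \<in> carrier G" using R' A'(2) unfolding controlled_def by auto
next
  note sub = subgroup.subset[OF A'(1)] subgroup.m_closed[OF A'(1)] subgroup.m_inv_closed[OF A'(1)]
  fix e assume e: "e \<in> A"
  obtain E where E: "finite E" "E \<subseteq> carrier G" "\<And>\<rho> g. \<rho> \<in> R \<Longrightarrow> g \<in> A \<Longrightarrow> inv (\<rho> g) \<otimes> \<rho> (g \<otimes> e) \<in> E"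
    using R e unfolding controlled_def by metis
  have "\<forall>e'\<in>A'. \<exists>E'. finite E' \<and> E' \<subseteq> carrier G \<and> (\<forall>\<rho>\<in>R'. \<forall>g\<in>A'. inv (\<rho> g) \<otimes> \<rho> (g \<otimes> e') \<in> E')"
    using R' unfolding controlled_def by blast
  then obtain E' where E': "\<And>e'. e' \<in> A' \<Longrightarrow> finite (E' e') \<and> E' e' \<subseteq> carrier G \<and>
      (\<forall>\<rho>\<in>R'. \<forall>g\<in>A'. inv (\<rho> g) \<otimes> \<rho> (g \<otimes> e') \<in> E' e')" by metis
  show "\<exists>E. finite E \<and> E \<subseteq> carrier G \<and> (\<forall>\<rho>\<in>{\<rho>' \<circ> \<rho> | \<rho>' \<rho>. \<rho>' \<in> R' \<and> \<rho> \<in> R}. \<forall>g\<in>A. inv (\<rho> g) \<otimes> \<rho> (g \<otimes> e) \<in> E)"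
  \<comment> \<open>Each displacement of \<open>\<rho>\<close> acts as a move for
    \<open>\<rho>'\<close>. Displacements outside \<open>A'\<close> are discarded, since
    \<open>\<rho>\<close> has values in the subgroup \<open>A'\<close> and \<open>R'\<close> is
    controlled only there.\<close>
  proof (intro exI[of _ "\<Union>(E' ` (E \<inter> A'))"] conjI ballI)
    show "finite (\<Union>(E' ` (E \<inter> A')))" using E(1) E' by auto
    show "\<Union>(E' ` (E \<inter> A')) \<subseteq> carrier G" using E' by blast
    fix \<sigma> g assume "\<sigma> \<in> {\<rho>' \<circ> \<rho> | \<rho>' \<rho>. \<rho>' \<in> R' \<and> \<rho> \<in> R}" and g: "g \<in> A"
    then obtain \<rho>' \<rho> where s: "\<sigma> = \<rho>' \<circ> \<rho>" "\<rho>' \<in> R'" "\<rho> \<in> R" by blast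
    define e' where "e' = inv (\<rho> g) \<otimes> \<rho> (g \<otimes> e)"
    have c: "\<rho> g \<in> A'" "\<rho> (g \<otimes> e) \<in> A'" using A'(2) s g e mul by auto
    have e': "e' \<in> E \<inter> A'" unfolding e'_def using E(3) s g c sub by blast
    have "\<rho> (g \<otimes> e) = \<rho> g \<otimes> e'" unfolding e'_def using c sub(1) by (simp add: m_assoc[symmetric] subset_iff)
    then have "inv (\<sigma> g) \<otimes> \<sigma> (g \<otimes> e) = inv (\<rho>' (\<rho> g)) \<otimes> \<rho>' (\<rho> g \<otimes> e')" by (simp add: s)
    moreover have "inv (\<rho>' (\<rho> g)) \<otimes> \<rho>' (\<rho> g \<otimes> e') \<in> E' e'" using E' e' s c by blast
    ultimately show "inv (\<sigma> g) \<otimes> \<sigma> (g \<otimes> e) \<in> \<Union>(E' ` (E \<inter> A'))" using e' by (metis UN_I)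
  qed
qed

end

context hyperbolic_word_metric
begin

text \<open>The fixed points of an idempotent \<open>\<rho>\<close> are its image, and
  \<open>\<rho>\<close> carries a geodesic between two of them to a path inside the image with steps
  of bounded length. The bound comes from finitely many sets \<open>E\<close>, common to the whole
  family, so \<open>K\<close> does not depend on \<open>\<rho>\<close>.\<close>

lemma controlled_retractions_quasiconvex:
  assumes R: "controlled G (carrier G) R" and idem: "\<And>\<rho> g. \<rho> \<in> R \<Longrightarrow> g \<in> carrier G \<Longrightarrow> \<rho> (\<rho> g) = \<rho> g"
  obtains K where "\<And>\<rho> u v p. \<rho> \<in> R \<Longrightarrow> u \<in> carrier G \<Longrightarrow> v \<in> carrier G \<Longrightarrow> p \<in> carrier G \<Longrightarrow> \<rho> u = u \<Longrightarrow> \<rho> v = v \<Longrightarrow>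
    \<exists>b\<in>carrier G. \<rho> b = b \<and> dis p b \<le> gp p u v + K"
proof -
  have clo: "\<rho> g \<in> carrier G" if "\<rho> \<in> R" "g \<in> carrier G" for \<rho> g
    using R that unfolding controlled_def by blast
  have "\<forall>e\<in>carrier G. \<exists>E. finite E \<and> E \<subseteq> carrier G \<and> (\<forall>\<rho>\<in>R. \<forall>g\<in>carrier G. inv (\<rho> g) \<otimes> \<rho> (g \<otimes> e) \<in> E)"
    using R unfolding controlled_def by blast
  then obtain E where E: "\<And>e. e \<in> carrier G \<Longrightarrow> finite (E e) \<and> E e \<subseteq> carrier G \<and>
      (\<forall>\<rho>\<in>R. \<forall>g\<in>carrier G. inv (\<rho> g) \<otimes> \<rho> (g \<otimes> e) \<in> E e)" by metis
  have "finite (\<Union>(E ` {g \<in> carrier G. len g \<le> 1}))" using E finite_ball[of 1] by auto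
  then obtain C0 where C0: "\<And>e. e \<in> \<Union>(E ` {g \<in> carrier G. len g \<le> 1}) \<Longrightarrow> real (len e) \<le> C0"
    using finite_len_bound by metis
  define C where "C = max 1 C0"
  have step: "dis (\<rho> a) (\<rho> b) \<le> C" if "\<rho> \<in> R" "a \<in> carrier G" "b \<in> carrier G" "dis a b \<le> 1" for \<rho> a b
  proof -
    define e where "e = inv a \<otimes> b"
    have e: "e \<in> carrier G" "len e \<le> 1" "b = a \<otimes> e"
      using that by (auto simp: e_def word_dist_def)
    have "inv (\<rho> a) \<otimes> \<rho> (a \<otimes> e) \<in> E e" using E e that by blast
    then have "real (len (inv (\<rho> a) \<otimes> \<rho> b)) \<le> C0" using C0 e by blast
    then show ?thesis by (simp add: word_dist_def C_def)
  qed
  have lin: "linearly_connected C {b \<in> carrier G. \<rho> b = b}" if r: "\<rho> \<in> R" for \<rho>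
    unfolding linearly_connected_def
  proof (intro conjI ballI)
    fix a b assume "a \<in> {b \<in> carrier G. \<rho> b = b}" "b \<in> {b \<in> carrier G. \<rho> b = b}"
    then have ab: "a \<in> carrier G" "b \<in> carrier G" "\<rho> a = a" "\<rho> b = b" by auto
    obtain x where x: "x 0 = a" "x (len (inv a \<otimes> b)) = b"
      "\<And>i. x i \<in> carrier G" "\<And>i. dis (x i) (x (Suc i)) \<le> 1"
      using geodesic_path[OF ab(1,2)] by blast
    have "real (len (inv a \<otimes> b)) \<le> C * dis a b"
      by (simp add: word_dist_def C_def mult_le_cancel_right1)
    then show "\<exists>x n. x 0 = a \<and> x n = b \<and> real n \<le> C * dis a b \<and> (\<forall>i::nat. x i \<in> {b \<in> carrier G. \<rho> b = b}) \<and>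
      (\<forall>i<n. dis (x i) (x (Suc i)) \<le> C)"
      using x ab step[OF r] idem[OF r] clo[OF r]
      by (intro exI[of _ "\<lambda>i. \<rho> (x i)"] exI[of _ "len (inv a \<otimes> b)"]) auto
  qed auto
  have C1: "1 \<le> C" by (simp add: C_def)
  obtain K where K: "\<And>B u v p. linearly_connected C B \<Longrightarrow> u \<in> B \<Longrightarrow> v \<in> B \<Longrightarrow> p \<in> carrier G \<Longrightarrow>
     \<exists>b\<in>B. dis p b \<le> gp p u v + K" using linearly_connected_quasiconvex[OF C1] by blast
  show thesis
  proof (rule that[of K])
    fix \<rho> u v p assume "\<rho> \<in> R" "u \<in> carrier G" "v \<in> carrier G" "p \<in> carrier G" "\<rho> u = u" "\<rho> v = v"
    then show "\<exists>b\<in>carrier G. \<rho> b = b \<and> dis p b \<le> gp p u v + K"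
      using K[OF lin, of \<rho> u v p] by auto
  qed
qed

end

section \<open>Comparison of two finite generating sets\<close>

lemma word_length_le_mult:
  assumes "word_metric G S" "word_metric G T"
  obtains L where "1 \<le> L" "\<And>g. g \<in> carrier G \<Longrightarrow> real (word_length G T g) \<le> L * real (word_length G S g)"
proof -
  interpret S: word_metric G S by fact
  interpret T: word_metric G T by fact
  obtain L0 where L0: "\<And>s. s \<in> S.letters \<Longrightarrow> real (T.len s) \<le> L0"
    using T.finite_len_bound[OF S.finite_letters] by blast
  define L where "L = max 1 L0"
  have "real (T.len (S.eval w)) \<le> L * real (length w)" if "set w \<subseteq> S.letters" for w
    using that
  proof (induction w)
    case (Cons s w)
    have s: "s \<in> S.letters" "s \<in> carrier G" and w: "set w \<subseteq> S.letters"
      using Cons.prems S.letters_closed by auto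
    have "real (T.len (S.eval (s # w))) \<le> real (T.len s) + real (T.len (S.eval w))"
      using T.len_mult[OF s(2) S.eval_closed[OF w]] by simp
    moreover have "real (T.len s) \<le> L" using L0[OF s(1)] by (simp add: L_def)
    ultimately show ?case using Cons.IH[OF w] by (simp add: algebra_simps)
  qed simp
  moreover have "1 \<le> L" by (simp add: L_def)
  ultimately show thesis using that S.len_word by metis
qed

text \<open>Bilipschitz equivalence of the metrics alone does not control Gromov products, because
  distances are subtracted. The Morse lemma repairs this: a \<open>T\<close>-geodesic passes close
  to every point of an \<open>S\<close>-geodesic with the same ends. Two \<open>S\<close>-geodesics
  that fellow travel for long give points \<open>y\<close> and \<open>z\<close> on the two
  \<open>T\<close>-geodesics, close to each other and far from the identity.\<close>

lemma gromov_product_change_generators: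
  assumes "hyperbolic_word_metric G S \<delta>" "word_metric G T"
  shows "\<exists>M. \<forall>u\<in>carrier G. \<forall>v\<in>carrier G. M \<le> gromov_product G S \<one>\<^bsub>G\<^esub> u v \<longrightarrow> r \<le> gromov_product G T \<one>\<^bsub>G\<^esub> u v"
proof -
  interpret S: hyperbolic_word_metric G S \<delta> by fact
  interpret T: word_metric G T by fact
  have SW: "word_metric G S" by unfold_locales
  obtain L1 where L1: "1 \<le> L1" "\<And>g. g \<in> carrier G \<Longrightarrow> real (T.len g) \<le> L1 * real (S.len g)"
    using word_length_le_mult[OF SW assms(2)] by blast
  obtain L2 where L2: "1 \<le> L2" "\<And>g. g \<in> carrier G \<Longrightarrow> real (S.len g) \<le> L2 * real (T.len g)"
    using word_length_le_mult[OF assms(2) SW] by blast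
  define C where "C = max L1 L2"
  have C1: "1 \<le> C" using L1(1) by (simp add: C_def)
  obtain K where K: "0 \<le> K" "\<And>B u v q. S.linearly_connected C B \<Longrightarrow> u \<in> B \<Longrightarrow> v \<in> B \<Longrightarrow> q \<in> S.interval u v \<Longrightarrow>
     \<exists>b\<in>B. S.dis q b \<le> K" using S.interval_near_linearly_connected[OF C1] by blast
  have T_le: "T.dis a b \<le> L1 * S.dis a b" if "a \<in> carrier G" "b \<in> carrier G" for a b
    using L1(2) that by (simp add: word_dist_def)
  have S_le: "S.dis a b \<le> L2 * T.dis a b" if "a \<in> carrier G" "b \<in> carrier G" for a b
    using L2(2) that by (simp add: word_dist_def)
  have near: "\<exists>y\<in>carrier G. S.dis q y \<le> K \<and> T.dis \<one>\<^bsub>G\<^esub> y + T.dis y u = T.dis \<one>\<^bsub>G\<^esub> u"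
    if u: "u \<in> carrier G" and q: "q \<in> S.interval \<one>\<^bsub>G\<^esub> u" for u q
  proof -
    define n where "n = T.len (inv\<^bsub>G\<^esub> \<one>\<^bsub>G\<^esub> \<otimes>\<^bsub>G\<^esub> u)"
    obtain x where x: "x 0 = \<one>\<^bsub>G\<^esub>" "x n = u" "\<And>i. x i \<in> carrier G" "\<And>i. T.dis (x i) (x (Suc i)) \<le> 1"
      unfolding n_def using T.geodesic_path[of "\<one>\<^bsub>G\<^esub>" u] u by blast
    have n: "T.dis \<one>\<^bsub>G\<^esub> u = real n" unfolding n_def by (simp add: word_dist_def)
    have le: "T.dis (x i) (x (i + j)) \<le> real j" for i j
    proof (induction j)
      case (Suc j)
      have "T.dis (x i) (x (i + Suc j)) \<le> T.dis (x i) (x (i + j)) + T.dis (x (i + j)) (x (Suc (i + j)))"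
        using T.dis_triangle x(3) by simp
      then show ?case using Suc x(4)[of "i + j"] by simp
    qed (use x in simp)
    have le': "T.dis (x i) (x j) \<le> real j - real i" if "i \<le> j" for i j
      using le[of i "j - i"] that by (simp add: of_nat_diff)
    have eq: "T.dis (x i) (x j) = real j - real i" if ij: "i \<le> j" "j \<le> n" for i j
    proof -
      have "T.dis (x 0) (x n) \<le> T.dis (x 0) (x i) + T.dis (x i) (x n)"
        "T.dis (x i) (x n) \<le> T.dis (x i) (x j) + T.dis (x j) (x n)"
        using T.dis_triangle x(3) by auto
      then show ?thesis using le'[of 0 i] le'[of j n] le'[of i j] ij n x(1,2) by simp
    qed
    \<comment> \<open>The vertices of a \<open>T\<close>-geodesic: walking along it forwards or
      backwards shows that they are linearly connected for \<open>S\<close>.\<close>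
    define B where "B = x ` {..n}"
    have Bc: "B \<subseteq> carrier G" using x by (auto simp: B_def)
    have "\<exists>y k. y 0 = a \<and> y k = b \<and> real k \<le> C * S.dis a b \<and> (\<forall>i::nat. y i \<in> B) \<and>
        (\<forall>i<k. S.dis (y i) (y (Suc i)) \<le> C)" if ab: "a \<in> B" "b \<in> B" for a b
    proof -
      obtain i j where ij: "a = x i" "b = x j" "i \<le> n" "j \<le> n" using ab by (auto simp: B_def)
      define y where "y m = (if i \<le> j then x (min (i + m) j) else x (i - m))" for m
      define k where "k = (if i \<le> j then j - i else i - j)"
      have y0: "y 0 = a" "y k = b" using ij by (auto simp: y_def k_def)
      have yB: "y m \<in> B" for m using ij by (auto simp: y_def B_def)
      have yc: "y m \<in> carrier G" for m using x(3) by (simp add: y_def)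
      have "real k = T.dis a b"
        using eq[of i j] eq[of j i] ij x(3) T.dis_commute[of a b] by (auto simp: k_def of_nat_diff)
      also have "\<dots> \<le> L1 * S.dis a b" using T_le ij x(3) by simp
      also have "\<dots> \<le> C * S.dis a b" by (intro mult_right_mono) (auto simp: C_def)
      finally have k: "real k \<le> C * S.dis a b" .
      have "S.dis (y m) (y (Suc m)) \<le> C" if m: "m < k" for m
      proof -
        have "T.dis (y m) (y (Suc m)) \<le> 1"
        proof (cases "i \<le> j")
          case True
          then have "y m = x (i + m)" "y (Suc m) = x (Suc (i + m))" using m by (auto simp: y_def k_def)
          then show ?thesis using x(4) by simp
        next
          case False
          then have "y m = x (Suc (i - Suc m))" "y (Suc m) = x (i - Suc m)" using m
            by (auto simp: y_def k_def Suc_diff_Suc)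
          then show ?thesis using x(4)[of "i - Suc m"] T.dis_commute x(3) by simp
        qed
        moreover have "0 \<le> L2" using L2(1) by linarith
        ultimately have "L2 * T.dis (y m) (y (Suc m)) \<le> L2" by (simp add: mult_left_le)
        then show ?thesis using S_le[OF yc yc, of m "Suc m"] by (simp add: C_def)
      qed
      with y0 yB k show ?thesis by blast
    qed
    then have lin: "S.linearly_connected C B" using Bc unfolding S.linearly_connected_def by blast
    have "x 0 \<in> B" "x n \<in> B" by (auto simp: B_def)
    then have "\<exists>b\<in>B. S.dis q b \<le> K" using K(2)[OF lin _ _ q] x(1,2) by simp
    then obtain i where i: "i \<le> n" "S.dis q (x i) \<le> K" by (auto simp: B_def)
    then show ?thesis using eq[of 0 i] eq[of i n] n x by (intro bexI[of _ "x i"]) auto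
  qed
  \<comment> \<open>The factor \<open>L2\<close> turns an \<open>S\<close>-distance into a
    \<open>T\<close>-distance. The summand \<open>L1 * (K + 2 * \<delta>)\<close> is half the bound
    on \<open>T.dis y z\<close>, \<open>K\<close> pays for passing from \<open>p\<close> to
    \<open>y\<close>, and 1 for rounding \<open>g\<close> down to \<open>j\<close>.\<close>
  define M where "M = L2 * (r + L1 * (K + 2 * \<delta>)) + K + 1"
  have "r \<le> T.gp \<one>\<^bsub>G\<^esub> u v" if u: "u \<in> carrier G" and v: "v \<in> carrier G" and M: "M \<le> S.gp \<one>\<^bsub>G\<^esub> u v" for u v
  proof -
    define g where "g = S.gp \<one>\<^bsub>G\<^esub> u v"
    have o: "\<one>\<^bsub>G\<^esub> \<in> carrier G" by simp
    have g: "0 \<le> g" "g \<le> S.dis \<one>\<^bsub>G\<^esub> u" "g \<le> S.dis \<one>\<^bsub>G\<^esub> v"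
      using S.gp_ge_0 S.gp_le_dis u v by (auto simp: g_def)
    define j where "j = nat \<lfloor>g\<rfloor>"
    have j: "real j \<le> g" "g \<le> real j + 1" using g(1) unfolding j_def by linarith+
    obtain p where p: "p \<in> carrier G" "S.dis \<one>\<^bsub>G\<^esub> p = real j" "S.dis p u = S.dis \<one>\<^bsub>G\<^esub> u - real j"
      using S.dis_split[OF o u, of j] j g by auto
    obtain q where q: "q \<in> carrier G" "S.dis \<one>\<^bsub>G\<^esub> q = real j" "S.dis q v = S.dis \<one>\<^bsub>G\<^esub> v - real j"
      using S.dis_split[OF o v, of j] j g by auto
    \<comment> \<open>Two applications of the four-point inequality, from \<open>p\<close> through
      \<open>u\<close> and \<open>v\<close> to \<open>q\<close>, lose \<open>2 * \<delta>\<close> in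
      the product and hence \<open>4 * \<delta>\<close> in the distance.\<close>
    have pq: "S.dis p q \<le> 4 * \<delta>"
    proof -
      have "S.gp \<one>\<^bsub>G\<^esub> p u = real j" "S.gp \<one>\<^bsub>G\<^esub> v q = real j"
        using p q u v S.dis_commute by (simp_all add: gromov_product_def)
      moreover have "min (S.gp \<one>\<^bsub>G\<^esub> p u) (S.gp \<one>\<^bsub>G\<^esub> u v) - \<delta> \<le> S.gp \<one>\<^bsub>G\<^esub> p v"
        "min (S.gp \<one>\<^bsub>G\<^esub> p v) (S.gp \<one>\<^bsub>G\<^esub> v q) - \<delta> \<le> S.gp \<one>\<^bsub>G\<^esub> p q"
        using S.gp_min p q u v by auto
      ultimately have "real j - 2 * \<delta> \<le> S.gp \<one>\<^bsub>G\<^esub> p q"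
        using j S.delta_ge_1 unfolding g_def by linarith
      then show ?thesis using p q by (simp add: gromov_product_def S.dis_commute field_simps)
    qed
    obtain y where y: "y \<in> carrier G" "S.dis p y \<le> K" "T.dis \<one>\<^bsub>G\<^esub> y + T.dis y u = T.dis \<one>\<^bsub>G\<^esub> u"
      using near[OF u, of p] p by (auto simp: S.interval_def)
    obtain z where z: "z \<in> carrier G" "S.dis q z \<le> K" "T.dis \<one>\<^bsub>G\<^esub> z + T.dis z v = T.dis \<one>\<^bsub>G\<^esub> v"
      using near[OF v, of q] q by (auto simp: S.interval_def)
    have "S.dis y z \<le> S.dis y p + S.dis p z" "S.dis p z \<le> S.dis p q + S.dis q z"
      using S.dis_triangle y z p q by auto
    then have "S.dis y z \<le> 2 * K + 4 * \<delta>" using pq y z p S.dis_commute by force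
    then have "L1 * S.dis y z \<le> L1 * (2 * K + 4 * \<delta>)" using L1(1) by (intro mult_left_mono) auto
    then have yz: "T.dis y z \<le> L1 * (2 * K + 4 * \<delta>)" using T_le[of y z] y z by linarith
    have low: "r + L1 * (K + 2 * \<delta>) \<le> T.dis \<one>\<^bsub>G\<^esub> w" if w: "w \<in> carrier G" "s \<in> carrier G" "S.dis \<one>\<^bsub>G\<^esub> s = real j" "S.dis s w \<le> K" for w s
    proof -
      have "S.dis \<one>\<^bsub>G\<^esub> s \<le> S.dis \<one>\<^bsub>G\<^esub> w + S.dis w s" by (rule S.dis_triangle[OF o w(1,2)])
      then have "real j - K \<le> S.dis \<one>\<^bsub>G\<^esub> w" using w S.dis_commute by force
      then have "L2 * (r + L1 * (K + 2 * \<delta>)) \<le> L2 * T.dis \<one>\<^bsub>G\<^esub> w"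
        using S_le[OF o w(1)] M j unfolding M_def g_def by linarith
      then show ?thesis using L2(1) by (simp add: mult_le_cancel_left)
    qed
    have "r + L1 * (K + 2 * \<delta>) \<le> T.dis \<one>\<^bsub>G\<^esub> y" "r + L1 * (K + 2 * \<delta>) \<le> T.dis \<one>\<^bsub>G\<^esub> z"
      using low[of y p] low[of z q] p q y z by auto
    moreover have "T.dis u v \<le> T.dis u y + T.dis y v" "T.dis y v \<le> T.dis y z + T.dis z v"
      using T.dis_triangle u v y z by auto
    moreover have "T.dis u y = T.dis y u" "T.dis u \<one>\<^bsub>G\<^esub> = T.dis \<one>\<^bsub>G\<^esub> u" "T.dis v \<one>\<^bsub>G\<^esub> = T.dis \<one>\<^bsub>G\<^esub> v"
      using T.dis_commute u v y by auto
    ultimately show ?thesis using y(3) z(3) yz by (simp add: gromov_product_def algebra_simps)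
  qed
  then show ?thesis by blast
qed

lemma hyperbolic_groupE:
  assumes "hyperbolic_group G"
  obtains S \<delta> where "hyperbolic_word_metric G S \<delta>"
proof -
  obtain S \<delta> where S: "group G" "finite_generating_set G S"
    "\<And>p a b c. p \<in> carrier G \<Longrightarrow> a \<in> carrier G \<Longrightarrow> b \<in> carrier G \<Longrightarrow> c \<in> carrier G \<Longrightarrow>
       gromov_product G S p a c \<ge> min (gromov_product G S p a b) (gromov_product G S p b c) - \<delta>"
    using assms unfolding hyperbolic_group_def by blast
  interpret group G by fact
  have "hyperbolic_word_metric G S (max 1 \<delta>)"
  proof
    fix p a b c assume "p \<in> carrier G" "a \<in> carrier G" "b \<in> carrier G" "c \<in> carrier G"
    from S(3)[OF this] show "min (gromov_product G S p a b) (gromov_product G S p b c) - max 1 \<delta> \<le> gromov_product G S p a c"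
      by linarith
  qed (use S in auto)
  then show thesis by (rule that)
qed


section \<open>A criterion for the Cannon--Thurston map\<close>

text \<open>The hypothesis is uniform continuity of the inclusion at infinity. It carries Gromov
  sequences and their equivalence from \<Lambda> to \<Gamma>. Continuity at a boundary point follows
  because representatives of \<open>q\<close> are also representatives of \<open>f q\<close>, so a
  lower bound on a product over \<Lambda> passes to the supremum over \<Gamma>.\<close>

lemma cannon_thurston_criterion:
  fixes \<Lambda> :: "('g, 'c) monoid_scheme" and \<Gamma> :: "('g, 'd) monoid_scheme"
  assumes sub: "carrier \<Lambda> \<subseteq> carrier \<Gamma>"
    and unif: "\<And>r. \<exists>M. \<forall>u\<in>carrier \<Lambda>. \<forall>v\<in>carrier \<Lambda>.
      M \<le> gromov_product \<Lambda> T \<one>\<^bsub>\<Lambda>\<^esub> u v \<longrightarrow> r \<le> gromov_product \<Gamma> S \<one>\<^bsub>\<Gamma>\<^esub> u v"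
  shows "cannon_thurston_map_exists \<Lambda> T \<Gamma> S"
proof -
  let ?F = "sequentially \<times>\<^sub>F sequentially"
  let ?T = "\<lambda>a b (m, n). gromov_product \<Lambda> T \<one>\<^bsub>\<Lambda>\<^esub> (a m) (b n)"
  let ?S = "\<lambda>a b (m, n). gromov_product \<Gamma> S \<one>\<^bsub>\<Gamma>\<^esub> (a m) (b n)"
  let ?relT = "{(a, b). a \<in> gromov_sequences \<Lambda> T \<and> b \<in> gromov_sequences \<Lambda> T \<and> gromov_close \<Lambda> T a b}"
  let ?relS = "{(a, b). a \<in> gromov_sequences \<Gamma> S \<and> b \<in> gromov_sequences \<Gamma> S \<and> gromov_close \<Gamma> S a b}"
  have ev: "eventually (\<lambda>x. r \<le> ?S a b x) ?F"
    if M: "\<forall>u\<in>carrier \<Lambda>. \<forall>v\<in>carrier \<Lambda>. M \<le> gromov_product \<Lambda> T \<one>\<^bsub>\<Lambda>\<^esub> u v \<longrightarrow> r \<le> gromov_product \<Gamma> S \<one>\<^bsub>\<Gamma>\<^esub> u v"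
      and ab: "range a \<subseteq> carrier \<Lambda>" "range b \<subseteq> carrier \<Lambda>" and e: "eventually (\<lambda>x. M \<le> ?T a b x) ?F" for r M a b
    using e by (rule eventually_mono) (use M ab in \<open>auto simp: image_subset_iff\<close>)
  have close: "gromov_close \<Gamma> S a b" if "gromov_close \<Lambda> T a b" "range a \<subseteq> carrier \<Lambda>" "range b \<subseteq> carrier \<Lambda>" for a b
    unfolding gromov_close_def filterlim_at_top
  proof
    fix r
    obtain M where M: "\<forall>u\<in>carrier \<Lambda>. \<forall>v\<in>carrier \<Lambda>.
      M \<le> gromov_product \<Lambda> T \<one>\<^bsub>\<Lambda>\<^esub> u v \<longrightarrow> r \<le> gromov_product \<Gamma> S \<one>\<^bsub>\<Gamma>\<^esub> u v" using unif by blast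
    have "eventually (\<lambda>x. M \<le> ?T a b x) ?F"
      using that(1) unfolding gromov_close_def filterlim_at_top by blast
    then show "eventually (\<lambda>x. r \<le> ?S a b x) ?F" by (rule ev[OF M that(2,3)])
  qed
  have seq: "gromov_sequences \<Lambda> T \<subseteq> gromov_sequences \<Gamma> S"
    using close sub unfolding gromov_sequences_def by blast
  \<comment> \<open>The class of a sequence in \<Gamma> can be larger than its class in \<Lambda>,
    so a representative is chosen and its class formed again.\<close>
  define h where "h \<xi> = ?relS `` {SOME a. a \<in> gromov_sequences \<Lambda> T \<and> \<xi> = ?relT `` {a}}" for \<xi>
  have h: "h \<xi> \<in> gromov_boundary \<Gamma> S" "\<xi> \<subseteq> h \<xi>" "\<xi> \<subseteq> gromov_sequences \<Lambda> T"
    if xi: "\<xi> \<in> gromov_boundary \<Lambda> T" for \<xi>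
  proof -
    define a where "a = (SOME a. a \<in> gromov_sequences \<Lambda> T \<and> \<xi> = ?relT `` {a})"
    have "\<exists>a. a \<in> gromov_sequences \<Lambda> T \<and> \<xi> = ?relT `` {a}"
      using xi unfolding gromov_boundary_def quotient_def by blast
    then have a: "a \<in> gromov_sequences \<Lambda> T" "\<xi> = ?relT `` {a}"
      unfolding a_def by (rule someI2_ex, blast)+
    have ha: "h \<xi> = ?relS `` {a}" by (simp add: h_def a_def)
    show "h \<xi> \<in> gromov_boundary \<Gamma> S"
      unfolding ha gromov_boundary_def quotient_def using a(1) seq by blast
    show "\<xi> \<subseteq> gromov_sequences \<Lambda> T" using a by auto
    have "b \<in> h \<xi>" if "b \<in> \<xi>" for b
    proof -
      have b: "b \<in> gromov_sequences \<Lambda> T" "gromov_close \<Lambda> T a b" using that a by auto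
      have "gromov_close \<Gamma> S a b"
        by (rule close[OF b(2)]) (use a(1) b(1) in \<open>auto simp: gromov_sequences_def\<close>)
      then show ?thesis unfolding ha using a(1) b(1) seq by blast
    qed
    then show "\<xi> \<subseteq> h \<xi>" by blast
  qed
  define f :: "'g bordified \<Rightarrow> 'g bordified" where "f = case_sum Inl (\<lambda>\<xi>. Inr (h \<xi>))"
  have f: "f (Inl g) = Inl g" "f (Inr \<xi>) = Inr (h \<xi>)" for g \<xi> by (simp_all add: f_def)
  have fp: "f q \<in> gromov_points \<Gamma> S" "representatives q \<subseteq> representatives (f q)"
    "\<And>a. a \<in> representatives q \<Longrightarrow> range a \<subseteq> carrier \<Lambda>" if qp: "q \<in> gromov_points \<Lambda> T" for q
  proof -
    consider g where "q = Inl g" "g \<in> carrier \<Lambda>" | \<xi> where "q = Inr \<xi>" "\<xi> \<in> gromov_boundary \<Lambda> T"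
      using qp unfolding gromov_points_def Plus_def by blast
    note cases = this
    show "f q \<in> gromov_points \<Gamma> S"
      by (rule cases) (use sub h(1) in \<open>auto simp: f gromov_points_def\<close>)
    show "representatives q \<subseteq> representatives (f q)"
      by (rule cases) (use h(2) in \<open>simp_all add: f\<close>)
    show "range a \<subseteq> carrier \<Lambda>" if "a \<in> representatives q" for a
      by (rule cases) (use that h(3) in \<open>force simp: gromov_sequences_def\<close>)+
  qed
  have "continuous_map (gromov_compactification \<Lambda> T) (gromov_compactification \<Gamma> S) f"
    unfolding continuous_map topspace_gromov_compactification
  proof (intro conjI allI impI)
    show "f ` gromov_points \<Lambda> T \<subseteq> gromov_points \<Gamma> S" using fp by blast
    fix W assume W: "openin (gromov_compactification \<Gamma> S) W"
    show "openin (gromov_compactification \<Lambda> T) {x \<in> gromov_points \<Lambda> T. f x \<in> W}"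
      unfolding openin_gromov_compactification
    proof (intro conjI allI impI)
      fix \<xi> assume xi: "Inr \<xi> \<in> {x \<in> gromov_points \<Lambda> T. f x \<in> W}"
      then have "Inr (h \<xi>) \<in> W" and xb: "Inr \<xi> \<in> gromov_points \<Lambda> T" by (simp_all add: f)
      then obtain r where r: "{q \<in> gromov_points \<Gamma> S. extended_gromov_product \<Gamma> S (Inr (h \<xi>)) q \<ge> ereal r} \<subseteq> W"
        using W unfolding openin_gromov_compactification by blast
      obtain M where M: "\<forall>u\<in>carrier \<Lambda>. \<forall>v\<in>carrier \<Lambda>.
        M \<le> gromov_product \<Lambda> T \<one>\<^bsub>\<Lambda>\<^esub> u v \<longrightarrow> r \<le> gromov_product \<Gamma> S \<one>\<^bsub>\<Gamma>\<^esub> u v" using unif by blast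
      have "f q \<in> W" if q: "q \<in> gromov_points \<Lambda> T" and ge: "extended_gromov_product \<Lambda> T (Inr \<xi>) q \<ge> ereal (M + 1)" for q
      proof -
        \<comment> \<open>The extra 1 makes the inequality strict, which is what extracts actual
          representatives from the two suprema.\<close>
        have "ereal M < extended_gromov_product \<Lambda> T (Inr \<xi>) q" using ge by (rule less_le_trans[rotated]) simp
        then obtain a b where ab: "a \<in> \<xi>" "b \<in> representatives q"
          "ereal M < Liminf ?F (\<lambda>(m, n). ereal (gromov_product \<Lambda> T \<one>\<^bsub>\<Lambda>\<^esub> (a m) (b n)))"
          unfolding extended_gromov_product_def less_SUP_iff by auto
        have "eventually (\<lambda>x. M \<le> ?T a b x) ?F"
          using less_LiminfD[OF ab(3)] by (rule eventually_mono) auto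
        then have "eventually (\<lambda>x. r \<le> ?S a b x) ?F"
          using ev[OF M, of a b] fp(3)[OF xb, of a] fp(3)[OF q, of b] ab by simp
        then have "ereal r \<le> Liminf ?F (\<lambda>(m, n). ereal (gromov_product \<Gamma> S \<one>\<^bsub>\<Gamma>\<^esub> (a m) (b n)))"
          by (intro Liminf_bounded) (auto elim!: eventually_mono)
        moreover have "a \<in> representatives (Inr (h \<xi>))" "b \<in> representatives (f q)"
          using ab fp(2)[OF q] fp(2)[OF xb] by (auto simp: f)
        ultimately have "ereal r \<le> extended_gromov_product \<Gamma> S (Inr (h \<xi>)) (f q)"
          unfolding extended_gromov_product_def by (meson SUP_upper2)
        then show ?thesis using r fp(1)[OF q] by blast
      qed
      then show "\<exists>r::real. {q \<in> gromov_points \<Lambda> T. extended_gromov_product \<Lambda> T (Inr \<xi>) q \<ge> ereal r}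
          \<subseteq> {x \<in> gromov_points \<Lambda> T. f x \<in> W}" by blast
    qed blast
  qed
  then show ?thesis unfolding cannon_thurston_map_exists_def using f(1) by blast
qed


section \<open>Words in free groups\<close>

abbreviation words :: "'x set \<Rightarrow> ('x \<times> bool) list set" where
  "words A \<equiv> carrier (free_group A)"

definition fmul :: "('x \<times> bool) list \<Rightarrow> ('x \<times> bool) list \<Rightarrow> ('x \<times> bool) list" where
  "fmul u v = free_reduce (u @ v)"

definition finv :: "('x \<times> bool) list \<Rightarrow> ('x \<times> bool) list" where
  "finv w = rev (map inverse_letter w)"

lemma mult_free_group [simp]: "u \<otimes>\<^bsub>free_group A\<^esub> v = fmul u v"
  by (simp add: free_group_def fmul_def)

lemma one_free_group [simp]: "\<one>\<^bsub>free_group A\<^esub> = []"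
  by (simp add: free_group_def)

lemma words_iff: "w \<in> words A \<longleftrightarrow> reduced w \<and> set w \<subseteq> A \<times> UNIV"
  by (simp add: free_group_def)

lemma words_iff_Ball: "w \<in> words A \<longleftrightarrow> reduced w \<and> (\<forall>x\<in>set w. fst x \<in> A)"
  by (force simp: words_iff)

lemma words_reduced: "w \<in> words A \<Longrightarrow> reduced w"
  by (simp add: words_iff)

lemma words_mono: "A \<subseteq> B \<Longrightarrow> w \<in> words A \<Longrightarrow> w \<in> words B"
  by (auto simp: words_iff)

lemma fst_inverse_letter [simp]: "fst (inverse_letter x) = fst x"
  by (simp add: inverse_letter_def)

lemma inverse_letter_eq_iff [simp]: "inverse_letter x = inverse_letter y \<longleftrightarrow> x = y"
  by (metis inverse_letter_inverse_letter)

lemma words_fmul [simp]: "u \<in> words A \<Longrightarrow> v \<in> words A \<Longrightarrow> fmul u v \<in> words A"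
  using monoid.m_closed[OF group.is_monoid[OF group_free_group[of A]]] by simp

lemma words_Nil [simp]: "[] \<in> words A"
  by (simp add: words_iff)

lemma words_single [simp]: "[x] \<in> words A \<longleftrightarrow> fst x \<in> A"
  by (cases x) (auto simp: words_iff reduced_def)

lemma fmul_reduced [simp]: "reduced (fmul u v)"
  by (simp add: fmul_def free_reduce_def reduced_foldr)

lemma reduced_UNIV: "reduced w \<longleftrightarrow> w \<in> words UNIV"
  by (auto simp: words_iff)

lemma fmul_assoc: "reduced u \<Longrightarrow> reduced v \<Longrightarrow> reduced w \<Longrightarrow> fmul (fmul u v) w = fmul u (fmul v w)"
  using monoid.m_assoc[OF group.is_monoid[OF group_free_group[of UNIV]]] by (simp add: reduced_UNIV)

lemma fmul_Nil [simp]: "reduced u \<Longrightarrow> fmul u [] = u" "reduced u \<Longrightarrow> fmul [] u = u"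
  by (simp_all add: fmul_def free_reduce_reduced)

lemma reduced_append:
  "reduced (u @ v) \<longleftrightarrow> reduced u \<and> reduced v \<and> (u = [] \<or> v = [] \<or> hd v \<noteq> inverse_letter (last u))"
  by (auto simp: reduced_def successively_append_iff)

lemma fmul_append: "reduced (u @ v) \<Longrightarrow> fmul u v = u @ v"
  by (simp add: fmul_def free_reduce_reduced)

lemma finv_Nil [simp]: "finv [] = []"
  by (simp add: finv_def)

lemma finv_Cons [simp]: "finv (x # w) = finv w @ [inverse_letter x]"
  by (simp add: finv_def)

lemma finv_append [simp]: "finv (u @ v) = finv v @ finv u"
  by (simp add: finv_def)

lemma finv_finv [simp]: "finv (finv w) = w"
  by (simp add: finv_def rev_map comp_def)

lemma length_finv [simp]: "length (finv w) = length w"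
  by (simp add: finv_def)

lemma finv_eq_Nil [simp]: "finv w = [] \<longleftrightarrow> w = []"
  by (simp add: finv_def)

lemma last_finv: "w \<noteq> [] \<Longrightarrow> last (finv w) = inverse_letter (hd w)"
  by (simp add: finv_def last_rev hd_map)

lemma reduced_finv [simp]: "reduced (finv w) \<longleftrightarrow> reduced w"
proof -
  have "reduced w \<Longrightarrow> reduced (finv w)" for w :: "('a \<times> bool) list"
  proof (induction w)
    case (Cons x w)
    then show ?case
      by (cases w) (auto simp: finv_def reduced_append reduced_Cons)
  qed simp
  then show ?thesis by (metis finv_finv)
qed

lemma words_finv [simp]: "finv w \<in> words A \<longleftrightarrow> w \<in> words A"
proof -
  have "set v \<subseteq> A \<times> UNIV \<longleftrightarrow> fst ` set v \<subseteq> A" for v :: "('a \<times> bool) list"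
    by (auto simp: mem_Times_iff subset_iff)
  moreover have "fst ` set (finv w) = fst ` set w" by (simp add: finv_def image_image)
  ultimately have "set (finv w) \<subseteq> A \<times> UNIV \<longleftrightarrow> set w \<subseteq> A \<times> UNIV" by simp
  then show ?thesis by (simp add: words_iff)
qed

lemma fmul_finv [simp]: "reduced w \<Longrightarrow> fmul (finv w) w = []" "reduced w \<Longrightarrow> fmul w (finv w) = []"
proof -
  have *: "fmul (finv w) w = []" if "reduced w" for w :: "('a \<times> bool) list"
    using inverse_word[OF that, of "[]"] that
    by (simp add: fmul_def free_reduce_append finv_def)
  show "reduced w \<Longrightarrow> fmul (finv w) w = []" by (rule *)
  show "reduced w \<Longrightarrow> fmul w (finv w) = []" using *[of "finv w"] by simp
qed

lemma inv_free_group [simp]: "w \<in> words A \<Longrightarrow> inv\<^bsub>free_group A\<^esub> w = finv w"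
  by (rule group.inv_equality[OF group_free_group]) (auto simp: words_reduced)

lemma fmul_finv_cancel [simp]:
  "reduced u \<Longrightarrow> reduced v \<Longrightarrow> fmul u (fmul (finv u) v) = v"
  "reduced u \<Longrightarrow> reduced v \<Longrightarrow> fmul (finv u) (fmul u v) = v"
  by (simp_all flip: fmul_assoc)

lemma finv_fmul: "reduced u \<Longrightarrow> reduced v \<Longrightarrow> finv (fmul u v) = fmul (finv v) (finv u)"
  using group.inv_mult_group[OF group_free_group[of UNIV], of u v]
  by (simp add: reduced_UNIV[symmetric])

lemma fmul_left_cancel: "reduced u \<Longrightarrow> reduced v \<Longrightarrow> reduced w \<Longrightarrow> fmul u v = fmul u w \<longleftrightarrow> v = w"
  by (metis fmul_finv_cancel(2))

lemma fmul_append3: "reduced (u @ v) \<Longrightarrow> reduced w \<Longrightarrow> fmul (u @ v) w = fmul u (fmul v w)"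
  by (metis fmul_append fmul_assoc reduced_append)

lemma fmul_letter:
  assumes "reduced f"
  shows "fmul f [y] = (if f \<noteq> [] \<and> last f = inverse_letter y then butlast f else f @ [y])"
proof (cases "f \<noteq> [] \<and> last f = inverse_letter y")
  case True
  then have f: "f = butlast f @ [inverse_letter y]" by (metis append_butlast_last_id)
  then have r: "reduced (butlast f @ [inverse_letter y])" using assms by simp
  then have b: "reduced (butlast f)" by (simp add: reduced_append)
  have "fmul f [y] = fmul (butlast f) (fmul [inverse_letter y] [y])"
    using fmul_append3[OF r, of "[y]"] f by (simp add: reduced_Cons)
  also have "fmul [inverse_letter y] [y] = []" using fmul_finv(1)[of "[y]"] by (simp add: reduced_Cons)
  finally show ?thesis using True b by simp
next
  case False
  then have "reduced (f @ [y])" using assms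
    by (auto simp: reduced_append reduced_Cons)
  then show ?thesis using False by (auto simp: fmul_append)
qed

text \<open>Right multiplication by letters from \<open>A\<close> can cancel only letters from
  \<open>A\<close>, so it never reaches back past \<open>y\<close>.\<close>

lemma prefix_fmul:
  assumes "reduced f" "prefix (c @ [y]) f" "p \<in> words A" "fst y \<notin> A"
  shows "prefix (c @ [y]) (fmul f p)"
  using assms(1-3)
proof (induction p arbitrary: f)
  case (Cons x p)
  have x: "fst x \<in> A" "p \<in> words A" "reduced (x # p)" "reduced p" "reduced [x]"
    using Cons.prems by (auto simp: words_iff reduced_Cons)
  have "fmul f (x # p) = fmul (fmul f [x]) p"
    using fmul_append[of "[x]" p] fmul_assoc[of f "[x]" p] x Cons.prems by simp
  moreover have "prefix (c @ [y]) (fmul f [x])"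
  proof (cases "f \<noteq> [] \<and> last f = inverse_letter x")
    case True
    obtain g where g: "f = c @ [y] @ g" using Cons.prems by (auto simp: prefix_def)
    have "g \<noteq> []" using True x(1) assms(4) unfolding g by auto
    then have "butlast f = c @ [y] @ butlast g" unfolding g by (simp add: butlast_append)
    then show ?thesis using True Cons.prems(1) by (simp add: fmul_letter prefix_def)
  next
    case False
    then show ?thesis using Cons.prems(1,2) by (auto simp: fmul_letter prefix_def)
  qed
  ultimately show ?case using Cons.IH x by simp
qed simp

lemma reduced_sandwich:
  assumes "p \<in> words A" "q \<in> words A" "fst y \<notin> A"
  shows "reduced (p @ [y])" "reduced ([y] @ q)" "reduced (p @ [y] @ q)"
proof -
  have 1: "last p \<in> A \<times> UNIV" if "p \<noteq> []" using that assms by (auto simp: words_iff)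
  have 2: "hd q \<in> A \<times> UNIV" if "q \<noteq> []" using that assms by (auto simp: words_iff)
  show "reduced (p @ [y])"
    using 1 assms by (cases y) (auto simp: reduced_append words_iff reduced_Cons inverse_letter_def mem_Times_iff)
  moreover show "reduced ([y] @ q)"
    using 2 assms by (cases y) (auto simp: words_iff reduced_Cons inverse_letter_def mem_Times_iff)
  ultimately show "reduced (p @ [y] @ q)"
    by (auto simp: reduced_append reduced_Cons)
qed

lemma fmul_sandwich:
  assumes "p \<in> words A" "q \<in> words A" "fst y \<notin> A"
  shows "fmul (fmul p [y]) q = p @ [y] @ q"
  using reduced_sandwich[OF assms] fmul_append[of p "[y]"] fmul_append[of "p @ [y]" q] by simp

section \<open>Common prefixes as Gromov products in the Cayley tree\<close>

abbreviation lcp :: "'a list \<Rightarrow> 'a list \<Rightarrow> 'a list" where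
  "lcp \<equiv> longest_common_prefix"

lemma lcp_split:
  obtains x y where "u = lcp u v @ x" "v = lcp u v @ y" "x = [] \<or> y = [] \<or> hd x \<noteq> hd y"
proof -
  have "\<exists>x y. u = lcp u v @ x \<and> v = lcp u v @ y \<and> (x = [] \<or> y = [] \<or> hd x \<noteq> hd y)"
    by (induction u v rule: longest_common_prefix.induct) auto
  then show thesis using that by blast
qed

lemma fmul_finv_lcp:
  assumes "reduced u" "reduced v" "u = m @ x" "v = m @ y" "x = [] \<or> y = [] \<or> hd x \<noteq> hd y"
  shows "fmul (finv u) v = finv x @ y" "reduced (finv x @ y)"
proof -
  have r: "reduced m" "reduced x" "reduced y" using assms(1-4) by (auto simp: reduced_append)
  show xy: "reduced (finv x @ y)"
    unfolding reduced_append using r assms(5) last_finv[of x] by auto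
  have "fmul (finv u) v = fmul (fmul (finv x) (finv m)) (fmul m y)"
    using assms(1-4) fmul_append[of m y] fmul_append[of "finv x" "finv m"] reduced_finv[of u] by simp
  also have "\<dots> = fmul (finv x) y" using r by (simp add: fmul_assoc)
  finally show "fmul (finv u) v = finv x @ y" using fmul_append[OF xy] by simp
qed

text \<open>In the Cayley tree the common prefix is the branch point of the geodesics from the
  identity to \<open>u\<close> and to \<open>v\<close>, and its length is their Gromov
  product.\<close>

lemma length_fmul_finv:
  assumes "reduced u" "reduced v"
  shows "length (fmul (finv u) v) + 2 * length (lcp u v) = length u + length v"
proof -
  obtain x y where xy: "u = lcp u v @ x" "v = lcp u v @ y" "x = [] \<or> y = [] \<or> hd x \<noteq> hd y"
    by (rule lcp_split)
  have "length u = length (lcp u v) + length x" "length v = length (lcp u v) + length y"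
    using xy(1,2) by (metis length_append)+
  then show ?thesis using fmul_finv_lcp[OF assms xy] by simp
qed

lemma length_fmul_le: "reduced u \<Longrightarrow> reduced v \<Longrightarrow> length (fmul u v) \<le> length u + length v"
  using length_fmul_finv[of "finv u" v] by simp

lemma prefix_finv_fmul: "reduced (z @ x) \<Longrightarrow> fmul (finv z) (z @ x) = x"
  by (metis fmul_append fmul_finv_cancel(2) reduced_append)

text \<open>A tree is separated by each of its vertices: the first \<open>y i\<close> behind
  \<open>z\<close> is reached by a jump whose geodesic passes through \<open>z\<close>, so it is
  within one jump of \<open>z\<close>.\<close>

lemma path_near_prefix:
  assumes red: "\<And>i. i \<le> n \<Longrightarrow> reduced (y i)" and y0: "y 0 = []" and z: "prefix z (y n)"
    and step: "\<And>i. i < n \<Longrightarrow> length (fmul (finv (y i)) (y (Suc i))) \<le> L"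
  shows "\<exists>i\<le>n. length (fmul (finv z) (y i)) \<le> L"
proof (cases "z = []")
  case True
  then show ?thesis using y0 by (intro exI[of _ 0]) simp
next
  case False
  define i where "i = (LEAST i. prefix z (y i))"
  have i: "prefix z (y i)" unfolding i_def by (rule LeastI[of "\<lambda>i. prefix z (y i)", OF z])
  have le: "i \<le> n" unfolding i_def by (rule Least_le[of "\<lambda>i. prefix z (y i)", OF z])
  have "i \<noteq> 0"
  proof
    assume "i = 0"
    then have "prefix z []" using i y0 by metis
    then show False using False by simp
  qed
  then obtain j where j: "i = Suc j" by (cases i) auto
  have nj: "\<not> prefix z (y j)" using not_less_Least[of j "\<lambda>i. prefix z (y i)"] j unfolding i_def by simp
  obtain x where x: "y i = z @ x" using i by (auto simp: prefix_def)
  have "length (lcp (y j) (y i)) \<le> length z"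
  proof (rule ccontr)
    assume "\<not> ?thesis"
    then have "prefix z (lcp (y j) (y i))"
      using prefix_length_prefix[OF i longest_common_prefix_prefix2] by (metis nat_le_linear)
    then show False using nj longest_common_prefix_prefix1 prefix_order.trans by blast
  qed
  moreover have "length (lcp (y j) (y i)) \<le> length (y j)"
    by (simp add: longest_common_prefix_prefix1 prefix_length_le)
  moreover have "length (fmul (finv (y j)) (y i)) + 2 * length (lcp (y j) (y i)) = length (y j) + length (y i)"
    by (rule length_fmul_finv) (use red le j in auto)
  ultimately have "length x \<le> L" using step[of j] j le x by simp
  moreover have "fmul (finv z) (y i) = x" using prefix_finv_fmul red[OF le] x by metis
  ultimately show ?thesis using le by auto
qed

lemma free_group_induct [consumes 1, case_names Nil Cons]:
  assumes "w \<in> words A" "P []"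
    "\<And>x w. fst x \<in> A \<Longrightarrow> w \<in> words A \<Longrightarrow> x # w \<in> words A \<Longrightarrow> fmul [x] w = x # w \<Longrightarrow> P w \<Longrightarrow> P (x # w)"
  shows "P w"
  using assms(1)
proof (induction w)
  case (Cons x w)
  then have "fst x \<in> A" "w \<in> words A" by (auto simp: words_iff reduced_Cons)
  then show ?case using Cons assms(3) fmul_append[of "[x]" w] by (simp add: words_reduced)
qed (rule assms(2))


section \<open>Free-by-cyclic groups and their cyclic splittings\<close>

text \<open>
  \<open>Th n\<close> is conjugation \<open>f \<mapsto> t\<^sup>n f t\<^sup>-\<^sup>n\<close>, and the subgroup to be studied is generated by the
  \<open>x t\<^bsup>e x\<^esup>\<close> for \<open>x \<in> X\<close>.
\<close>

locale free_by_cyclic =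
  fixes X :: "'x set" and Th :: "int \<Rightarrow> ('x \<times> bool) list \<Rightarrow> ('x \<times> bool) list" and e :: "'x \<Rightarrow> int"
  assumes finite_X: "finite X"
    and Th_closed: "w \<in> words X \<Longrightarrow> Th n w \<in> words X"
    and Th_fmul: "u \<in> words X \<Longrightarrow> v \<in> words X \<Longrightarrow> Th n (fmul u v) = fmul (Th n u) (Th n v)"
    and Th_0: "w \<in> words X \<Longrightarrow> Th 0 w = w"
    and Th_add: "w \<in> words X \<Longrightarrow> Th (m + n) w = Th m (Th n w)"
begin

lemma red_X [simp]: "w \<in> words X \<Longrightarrow> reduced w"
  by (rule words_reduced)

lemmas [simp] = Th_closed

definition G :: "(('x \<times> bool) list \<times> int) monoid" where
  "G = \<lparr>carrier = words X \<times> UNIV, monoid.mult = (\<lambda>(f, n) (g, m). (fmul f (Th n g), n + m)), one = ([], 0)\<rparr>"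

lemma carrier_G: "carrier G = words X \<times> UNIV"
  by (simp add: G_def)

lemma carrier_G_iff [simp]: "(f, n) \<in> carrier G \<longleftrightarrow> f \<in> words X"
  by (simp add: G_def)

lemma mult_G [simp]: "(f, n) \<otimes>\<^bsub>G\<^esub> (g, m) = (fmul f (Th n g), n + m)"
  by (simp add: G_def)

lemma one_G: "\<one>\<^bsub>G\<^esub> = ([], 0)"
  by (simp add: G_def)

lemma Th_Nil [simp]: "Th n [] = []"
proof -
  have "fmul (Th n []) (Th n []) = fmul (Th n []) []"
    using Th_fmul[of "[]" "[]" n] Th_closed[of "[]" n] by (simp add: words_reduced)
  then show ?thesis
    using fmul_left_cancel[of "Th n []" "Th n []" "[]"] Th_closed[of "[]" n] by (simp add: words_reduced)
qed

lemma Th_finv: "w \<in> words X \<Longrightarrow> Th n (finv w) = finv (Th n w)"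
proof -
  assume w: "w \<in> words X"
  have "fmul (Th n w) (Th n (finv w)) = fmul (Th n w) (finv (Th n w))"
    using Th_fmul[of w "finv w" n] w Th_closed[of w n] by (simp add: words_reduced)
  then show ?thesis
    using fmul_left_cancel[of "Th n w" "Th n (finv w)" "finv (Th n w)"] w Th_closed[of _ n]
    by (simp add: words_reduced)
qed

lemma Th_inverse [simp]: "w \<in> words X \<Longrightarrow> Th (- n) (Th n w) = w" "w \<in> words X \<Longrightarrow> Th n (Th (- n) w) = w"
  using Th_add[of w "- n" n] Th_add[of w n "- n"] Th_0[of w] by simp_all

lemma Th_eq_Nil: "w \<in> words X \<Longrightarrow> Th n w = [] \<longleftrightarrow> w = []"
  by (metis Th_Nil Th_inverse(1))

lemma group_G: "group G"
proof (rule groupI)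
  fix p q r assume "p \<in> carrier G" "q \<in> carrier G" "r \<in> carrier G"
  then show "p \<otimes>\<^bsub>G\<^esub> q \<otimes>\<^bsub>G\<^esub> r = p \<otimes>\<^bsub>G\<^esub> (q \<otimes>\<^bsub>G\<^esub> r)"
    by (cases p; cases q; cases r)
       (simp add: Th_fmul Th_closed Th_add fmul_assoc words_reduced)
next
  fix p assume p: "p \<in> carrier G"
  obtain f n where fn: "p = (f, n)" "f \<in> words X" using p by (cases p) auto
  have "(finv (Th (- n) f), - n) \<otimes>\<^bsub>G\<^esub> p = \<one>\<^bsub>G\<^esub>"
    using fn by (simp add: one_G Th_closed words_reduced)
  moreover have "(finv (Th (- n) f), - n) \<in> carrier G" using fn by (simp add: Th_closed)
  ultimately show "\<exists>q\<in>carrier G. q \<otimes>\<^bsub>G\<^esub> p = \<one>\<^bsub>G\<^esub>" by blast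
qed (auto simp: carrier_G one_G Th_closed Th_0 words_reduced)

sublocale G: group G by (rule group_G)

lemma inv_G: "f \<in> words X \<Longrightarrow> inv\<^bsub>G\<^esub> (f, n) = (finv (Th (- n) f), - n)"
  by (rule G.inv_equality) (simp_all add: one_G Th_closed words_reduced)

definition lev :: "'x set \<Rightarrow> (('x \<times> bool) list \<times> int) set" where
  "lev A = words A \<times> UNIV"

lemma lev_iff [simp]: "(f, n) \<in> lev A \<longleftrightarrow> f \<in> words A"
  by (simp add: lev_def)

definition invariant :: "'x set \<Rightarrow> bool" where
  "invariant A \<longleftrightarrow> A \<subseteq> X \<and> (\<forall>n. \<forall>w\<in>words A. Th n w \<in> words A)"

lemma subgroup_lev:
  assumes "invariant A"
  shows "subgroup (lev A) G"
proof (rule G.subgroupI)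
  note inv = assms[unfolded invariant_def]
  show sub: "lev A \<subseteq> carrier G" using inv words_mono by (auto simp: lev_def carrier_G)
  show "lev A \<noteq> {}" by (use words_Nil[of A] in \<open>auto simp: lev_def simp del: words_Nil\<close>)
  fix a assume a: "a \<in> lev A"
  then obtain f n where fn: "a = (f, n)" "f \<in> words A" by (auto simp: lev_def)
  then have "f \<in> words X" using inv words_mono by auto
  then show "inv\<^bsub>G\<^esub> a \<in> lev A" using fn inv by (simp add: inv_G)
  fix b assume b: "b \<in> lev A"
  then obtain g m where "b = (g, m)" "g \<in> words A" by (auto simp: lev_def)
  then show "a \<otimes>\<^bsub>G\<^esub> b \<in> lev A" using fn inv by simp
qed

definition \<tau> :: "('x \<times> bool) list \<times> int" where
  "\<tau> = ([], 1)"

lemma tau_closed [simp]: "\<tau> \<in> carrier G"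
  by (simp add: \<tau>_def)

lemma tau_pow: "\<tau> [^]\<^bsub>G\<^esub> (n :: int) = ([], n)"
proof -
  have nat: "\<tau> [^]\<^bsub>G\<^esub> (m :: nat) = ([], int m)" for m
    by (induction m) (simp_all add: one_G \<tau>_def)
  show ?thesis
    by (cases n rule: int_cases2) (simp_all add: int_pow_int nat G.int_pow_neg_int inv_G)
qed

definition level_gens :: "'x set \<Rightarrow> (('x \<times> bool) list \<times> int) set" where
  "level_gens A = insert \<tau> ((\<lambda>x. ([(x, True)], 0)) ` A)"

lemma lev_generate:
  assumes "invariant A"
  shows "level_gens A \<subseteq> lev A" "lev A \<subseteq> generate G (level_gens A)"
proof -
  have AX: "A \<subseteq> X" using assms by (simp add: invariant_def)
  show sub: "level_gens A \<subseteq> lev A" by (auto simp: level_gens_def \<tau>_def)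
  have gc: "level_gens A \<subseteq> carrier G" using AX by (auto simp: level_gens_def)
  have pow: "([], n) \<in> generate G (level_gens A)" for n
    unfolding tau_pow[symmetric]
    by (rule G.subgroup_int_pow_closed[OF G.generate_is_subgroup[OF gc]])
       (auto simp: level_gens_def intro: generate.incl)
  have "(w, 0) \<in> generate G (level_gens A)" if "w \<in> words A" for w
    using that
  proof (induction rule: free_group_induct)
    case Nil
    show ?case by (rule pow)
  next
    case (Cons x w)
    obtain a b where x: "x = (a, b)" by (cases x)
    have a: "a \<in> A" "[(a, True)] \<in> words X" using Cons x AX by auto
    have w: "w \<in> words X" using Cons.hyps AX words_mono by blast
    have "([x], 0) \<in> generate G (level_gens A)"
    proof (cases b)
      case True
      then show ?thesis using a x by (auto simp: level_gens_def intro!: generate.incl)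
    next
      case False
      have "inv\<^bsub>G\<^esub> ([(a, True)], 0) \<in> generate G (level_gens A)"
        using a by (auto simp: level_gens_def intro!: generate.inv)
      moreover have "inv\<^bsub>G\<^esub> ([(a, True)], 0) = ([x], 0)"
        using a False x by (simp add: inv_G Th_0 inverse_letter_def)
      ultimately show ?thesis by simp
    qed
    then have "([x], 0) \<otimes>\<^bsub>G\<^esub> (w, 0) \<in> generate G (level_gens A)"
      using Cons.IH by (rule generate.eng)
    then show ?case using Cons.hyps w by (simp add: Th_0)
  qed
  then have "(w, 0) \<otimes>\<^bsub>G\<^esub> ([], n) \<in> generate G (level_gens A)" if "w \<in> words A" for w n
    using that pow by (metis generate.eng)
  then show "lev A \<subseteq> generate G (level_gens A)"
    by (auto simp: lev_def words_reduced)
qed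

text \<open>The generators of \<open>lev A\<close> give two kinds of moves: \<tau> raises the height
  by one, and a letter \<open>x\<close> at height \<open>n\<close> multiplies the free part by
  \<open>Th n [(x, True)]\<close>.\<close>

lemma controlled_lev:
  assumes "invariant A"
    and "\<And>\<rho> f n. \<rho> \<in> R \<Longrightarrow> f \<in> words A \<Longrightarrow> \<rho> (f, n) \<in> carrier G"
    and "\<exists>E. finite E \<and> E \<subseteq> carrier G \<and> (\<forall>\<rho>\<in>R. \<forall>f\<in>words A. \<forall>n. inv\<^bsub>G\<^esub> (\<rho> (f, n)) \<otimes>\<^bsub>G\<^esub> \<rho> (f, n + 1) \<in> E)"
    and "\<And>x. x \<in> A \<Longrightarrow> \<exists>E. finite E \<and> E \<subseteq> carrier G \<and>
       (\<forall>\<rho>\<in>R. \<forall>f\<in>words A. \<forall>n. inv\<^bsub>G\<^esub> (\<rho> (f, n)) \<otimes>\<^bsub>G\<^esub> \<rho> (fmul f (Th n [(x, True)]), n) \<in> E)"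
  shows "controlled G (lev A) R"
proof (rule G.controlled_generate[OF subgroup_lev[OF assms(1)] lev_generate[OF assms(1)]])
  fix \<rho> g assume "\<rho> \<in> R" "g \<in> lev A"
  then show "\<rho> g \<in> carrier G" using assms(2) by (auto simp: lev_def)
next
  fix y assume "y \<in> level_gens A"
  then consider "y = \<tau>" | x where "x \<in> A" "y = ([(x, True)], 0)" by (auto simp: level_gens_def)
  then show "\<exists>E. finite E \<and> E \<subseteq> carrier G \<and> (\<forall>\<rho>\<in>R. \<forall>g\<in>lev A. inv\<^bsub>G\<^esub> (\<rho> g) \<otimes>\<^bsub>G\<^esub> \<rho> (g \<otimes>\<^bsub>G\<^esub> y) \<in> E)"
  proof cases
    case 1
    then show ?thesis using assms(3) by (auto simp: lev_def \<tau>_def words_reduced Ball_def)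
  next
    case 2
    then show ?thesis using assms(4)[OF 2(1)] by (auto simp: lev_def Ball_def)
  qed
qed

end

text \<open>\<open>lev A\<close> plays the vertex group and \<open>Z\<close> the stable letters.
  Every power of \<open>t\<close> conjugates a stable letter into a stable letter flanked by words
  over \<open>A\<close>, which is why the edge groups are cyclic. Allowing \<open>z'\<close> to
  differ from \<open>z\<close> covers a layer whose letters are permuted.\<close>

locale cyclic_step = free_by_cyclic +
  fixes A Z :: "'a set"
  assumes inv_A: "invariant A" and Z_X: "Z \<subseteq> X" and AZ: "A \<inter> Z = {}"
    and e_Z: "z \<in> Z \<Longrightarrow> e z = 1"
    and Th_Z: "z \<in> Z \<Longrightarrow> \<exists>p\<in>words A. \<exists>q\<in>words A. \<exists>z'\<in>Z. Th n [(z, True)] = p @ [(z', True)] @ q"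
begin

lemma A_X: "A \<subseteq> X"
  using inv_A by (simp add: invariant_def)

lemma Th_A: "w \<in> words A \<Longrightarrow> Th n w \<in> words A"
  using inv_A by (simp add: invariant_def)

lemma words_A_X: "w \<in> words A \<Longrightarrow> w \<in> words X"
  using words_mono[OF A_X] .

lemma Th_letter:
  assumes "fst y \<in> Z"
  obtains p q y' where "p \<in> words A" "q \<in> words A" "fst y' \<in> Z" "snd y' = snd y" "Th n [y] = p @ [y'] @ q"
    "Th n [y] = fmul (fmul p [y']) q"
proof -
  obtain z b where y: "y = (z, b)" by (cases y)
  obtain p q z' where p: "p \<in> words A" "q \<in> words A" "z' \<in> Z" "Th n [(z, True)] = p @ [(z', True)] @ q"
    using Th_Z[of z n] assms y by auto
  have "\<exists>p q y'. p \<in> words A \<and> q \<in> words A \<and> fst y' \<in> Z \<and> snd y' = snd y \<and> Th n [y] = p @ [y'] @ q"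
  proof (cases b)
    case True
    then show ?thesis using p y by (metis fst_conv snd_conv)
  next
    case False
    have "Th n (finv [(z, True)]) = finv (p @ [(z', True)] @ q)"
      unfolding p(4)[symmetric] by (rule Th_finv) (use assms y Z_X in auto)
    then have "Th n [y] = finv q @ [(z', False)] @ finv p"
      using False y by (simp add: inverse_letter_def)
    then show ?thesis using p False y
      by (intro exI[of _ "finv q"] exI[of _ "finv p"] exI[of _ "(z', False)"]) simp
  qed
  then obtain p q y' where *: "p \<in> words A" "q \<in> words A" "fst y' \<in> Z" "snd y' = snd y" "Th n [y] = p @ [y'] @ q" by blast
  have "fst y' \<notin> A" using * AZ by auto
  then have "fmul (fmul p [y']) q = p @ [y'] @ q" by (rule fmul_sandwich[OF *(1,2)])
  then show thesis using that * by metis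
qed

lemma invariant_AZ: "invariant (A \<union> Z)"
  unfolding invariant_def
proof (intro conjI allI ballI)
  show AZX: "A \<union> Z \<subseteq> X" using A_X Z_X by simp
  fix n w assume "w \<in> words (A \<union> Z)"
  then show "Th n w \<in> words (A \<union> Z)"
  proof (induction rule: free_group_induct)
    case (Cons x w)
    have x: "[x] \<in> words X" "w \<in> words X" using Cons.hyps(1) AZX words_mono[OF AZX Cons.hyps(2)] by auto
    have "Th n [x] \<in> words (A \<union> Z)"
    proof (cases "fst x \<in> A")
      case True
      then have "Th n [x] \<in> words A" by (intro Th_A) simp
      then show ?thesis by (rule words_mono[rotated]) simp
    next
      case False
      then have "fst x \<in> Z" using Cons.hyps by simp
      then obtain p q y' where *: "p \<in> words A" "q \<in> words A" "fst y' \<in> Z" "Th n [x] = fmul (fmul p [y']) q"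
        by (rule Th_letter)
      have "p \<in> words (A \<union> Z)" "q \<in> words (A \<union> Z)" using * words_mono[of A "A \<union> Z"] by auto
      then show ?thesis using * by simp
    qed
    moreover have "Th n (x # w) = fmul (Th n [x]) (Th n w)"
      using Th_fmul[OF x, of n] Cons.hyps by simp
    ultimately show ?case using Cons.IH by simp
  qed simp
qed

definition pre :: "('a \<times> bool) list \<Rightarrow> ('a \<times> bool) list" where
  "pre w = takeWhile (\<lambda>x. fst x \<in> A) w"

lemma pre_append [simp]: "p \<in> words A \<Longrightarrow> fst y \<notin> A \<Longrightarrow> pre (p @ y # q) = p"
  by (auto simp: pre_def words_iff takeWhile_tail takeWhile_append2 mem_Times_iff subset_iff)

lemma Z_not_A: "z \<in> Z \<Longrightarrow> z \<notin> A"
  using AZ by auto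

text \<open>
  The half space of \<open>c y\<close> consists of all \<open>(f, n)\<close> such that \<open>c @ [y]\<close> is a prefix of \<open>f\<close>. It is
  entered at height \<open>n\<close> only through \<open>gate c y n\<close>, by lemma \<open>crossing_gate\<close> below.
\<close>

definition gate :: "('a \<times> bool) list \<Rightarrow> 'a \<times> bool \<Rightarrow> int \<Rightarrow> ('a \<times> bool) list \<times> int" where
  "gate c y n = (fmul c (Th n (pre (Th (- n) [y]))), n)"

lemma gate_factor:
  assumes "fst y \<in> Z"
  shows "Th n (pre (Th (- n) [y])) \<in> words A" "pre (Th (- n) [y]) \<in> words A"
proof -
  obtain p q y' where *: "p \<in> words A" "q \<in> words A" "fst y' \<in> Z" "Th (- n) [y] = p @ [y'] @ q"
    using Th_letter[OF assms] by metis
  then show 1: "pre (Th (- n) [y]) \<in> words A" using Z_not_A by simp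
  then show "Th n (pre (Th (- n) [y])) \<in> words A" by (rule Th_A)
qed

lemma gate_closed: "c \<in> words X \<Longrightarrow> fst y \<in> Z \<Longrightarrow> gate c y n \<in> carrier G"
  using gate_factor words_A_X by (simp add: gate_def)

text \<open>If \<open>Th (- n) [y]\<close> has the stable letter \<open>y1\<close>, then passing to
  height \<open>n + 1\<close> multiplies the gate by \<open>(Th 1 \<alpha>, 1)\<close>, where
  \<alpha> is the part of \<open>Th (- 1) [y1]\<close> before its stable letter. This depends on
  \<open>y1\<close> alone, and there are finitely many letters.\<close>

lemma gate_step:
  "\<exists>E. finite E \<and> E \<subseteq> carrier G \<and>
    (\<forall>c y n. c \<in> words X \<longrightarrow> fst y \<in> Z \<longrightarrow> inv\<^bsub>G\<^esub> (gate c y n) \<otimes>\<^bsub>G\<^esub> gate c y (n + 1) \<in> E)"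
proof -
  define E where "E = (\<lambda>y. (Th 1 (pre (Th (- 1) [y])), 1 :: int)) ` (Z \<times> UNIV)"
  have fin: "finite E" unfolding E_def using finite_X Z_X finite_subset by (intro finite_imageI finite_cartesian_product) auto
  have sub: "E \<subseteq> carrier G" using gate_factor words_A_X by (auto simp: E_def)
  have "inv\<^bsub>G\<^esub> (gate c y n) \<otimes>\<^bsub>G\<^esub> gate c y (n + 1) \<in> E" if c: "c \<in> words X" and y: "fst y \<in> Z" for c y n
  proof -
    have yX: "[y] \<in> words X" using y Z_X by auto
    obtain p q y1 where 1: "p \<in> words A" "q \<in> words A" "fst y1 \<in> Z" "Th (- n) [y] = p @ [y1] @ q"
      "Th (- n) [y] = fmul (fmul p [y1]) q"
      using Th_letter[OF y] by metis
    obtain \<alpha> \<beta> y2 where 2: "\<alpha> \<in> words A" "\<beta> \<in> words A" "fst y2 \<in> Z" "Th (- 1) [y1] = \<alpha> @ [y2] @ \<beta>"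
      "Th (- 1) [y1] = fmul (fmul \<alpha> [y2]) \<beta>"
      using Th_letter[OF 1(3)] by metis
    have X: "p \<in> words X" "q \<in> words X" "\<alpha> \<in> words X" "\<beta> \<in> words X" "[y1] \<in> words X" "[y2] \<in> words X"
      using 1 2 words_A_X Z_X by auto
    define p' q' where "p' = fmul (Th (- 1) p) \<alpha>" and "q' = fmul \<beta> (Th (- 1) q)"
    have p': "p' \<in> words A" "q' \<in> words A" using 1 2 Th_A by (auto simp: p'_def q'_def)
    have "- (n + 1) = - 1 + - n" by simp
    then have "Th (- (n + 1)) [y] = Th (- 1) (fmul (fmul p [y1]) q)"
      using Th_add[OF yX, of "- 1" "- n"] 1(5) by (simp only:)
    also have "\<dots> = fmul (fmul (Th (- 1) p) (fmul (fmul \<alpha> [y2]) \<beta>)) (Th (- 1) q)"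
      using X by (simp add: Th_fmul 2(5))
    also have "\<dots> = fmul (fmul p' [y2]) q'"
      using X by (simp add: p'_def q'_def fmul_assoc words_reduced Th_closed)
    also have "\<dots> = p' @ y2 # q'"
      using fmul_sandwich[OF p' Z_not_A[OF 2(3)]] by simp
    finally have pre2: "pre (Th (- (n + 1)) [y]) = p'" using p' 2(3) Z_not_A by simp
    have pre1: "pre (Th (- n) [y]) = p" using 1 Z_not_A by simp
    have Tp: "Th (n + 1) p' = fmul (Th n p) (Th (n + 1) \<alpha>)"
      using X Th_add[of p "n + 1" "- 1"] by (simp add: p'_def Th_fmul Th_closed)
    then have g2: "gate c y (n + 1) = (fmul c (fmul (Th n p) (Th (n + 1) \<alpha>)), n + 1)"
      by (simp only: gate_def pre2 Tp)
    have "gate c y n \<otimes>\<^bsub>G\<^esub> (Th 1 \<alpha>, 1) = gate c y (n + 1)"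
      unfolding g2 using X c Th_add[of \<alpha> n 1]
      by (simp add: gate_def pre1 fmul_assoc words_reduced Th_closed)
    then have "inv\<^bsub>G\<^esub> (gate c y n) \<otimes>\<^bsub>G\<^esub> gate c y (n + 1) = (Th 1 \<alpha>, 1)"
      using gate_closed[OF c y] X Th_closed G.inv_solve_left'[of "(Th 1 \<alpha>, 1)" "gate c y n" "gate c y (n + 1)"] gate_closed[OF c y]
      by simp
    moreover have "pre (Th (- 1) [y1]) = \<alpha>" using 2 Z_not_A by simp
    ultimately show ?thesis using 1(3) unfolding E_def by (cases y1) force
  qed
  with fin sub show ?thesis by blast
qed

lemma prefix_fmul_iff:
  assumes "f \<in> words X" "p \<in> words A" "fst y \<in> Z"
  shows "prefix (c @ [y]) (fmul f p) \<longleftrightarrow> prefix (c @ [y]) f"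
proof
  assume "prefix (c @ [y]) f"
  then show "prefix (c @ [y]) (fmul f p)"
    using prefix_fmul[of f c y p A] assms Z_not_A by (simp add: words_reduced)
next
  assume "prefix (c @ [y]) (fmul f p)"
  then have "prefix (c @ [y]) (fmul (fmul f p) (finv p))"
    using prefix_fmul[of "fmul f p" c y "finv p" A] assms Z_not_A by simp
  then show "prefix (c @ [y]) f" using assms by (simp add: fmul_assoc words_reduced)
qed

lemma gate_not_behind:
  assumes "c \<in> words X" "fst y \<in> Z"
  shows "\<not> prefix (c @ [y]) (fst (gate c y n))"
  using prefix_fmul_iff[OF assms(1) gate_factor(1)[OF assms(2), of n] assms(2), of c]
  by (auto simp: gate_def prefix_def)

text \<open>With \<open>Th n [x] = p x' q\<close>, the factors \<open>p\<close> and \<open>q\<close>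
  cannot change the side, so it is the letter \<open>x'\<close> that completes the prefix:
  \<open>c = fmul f p\<close> and \<open>y = x'\<close>. It remains to recognise
  \<open>finv p\<close> as the correction in the gate.\<close>

lemma crossing_gate:
  assumes f: "f \<in> words X" and c: "c \<in> words X" and y: "fst y \<in> Z" and x: "fst x \<in> Z"
    and nb: "\<not> prefix (c @ [y]) f" and b: "prefix (c @ [y]) (fmul f (Th n [x]))"
  shows "(f, n) = gate c y n"
proof -
  obtain p q x' where *: "p \<in> words A" "q \<in> words A" "fst x' \<in> Z" "Th n [x] = fmul (fmul p [x']) q"
    using Th_letter[OF x] by metis
  have X: "p \<in> words X" "q \<in> words X" "[x'] \<in> words X" "[x] \<in> words X" using * words_A_X Z_X x by auto
  have "fmul f (Th n [x]) = fmul (fmul (fmul f p) [x']) q"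
    using X f by (simp add: *(4) fmul_assoc words_reduced)
  then have b': "prefix (c @ [y]) (fmul (fmul f p) [x'])"
    using b prefix_fmul_iff[of "fmul (fmul f p) [x']" q y c] * y X f by simp
  have nb': "\<not> prefix (c @ [y]) (fmul f p)" using nb prefix_fmul_iff f *(1) y by simp
  have red: "reduced (fmul f p)" by simp
  have ne: "\<not> (fmul f p \<noteq> [] \<and> last (fmul f p) = inverse_letter x')"
  proof
    assume "fmul f p \<noteq> [] \<and> last (fmul f p) = inverse_letter x'"
    then have "fmul (fmul f p) [x'] = butlast (fmul f p)" by (simp add: fmul_letter)
    then have "prefix (c @ [y]) (fmul f p)" using b' prefixeq_butlast prefix_order.trans by metis
    with nb' show False ..
  qed
  have "prefix (c @ [y]) (fmul f p @ [x'])" using b' unfolding fmul_letter[OF red] if_not_P[OF ne] .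
  then have "c @ [y] = fmul f p @ [x']" using nb' by (auto simp: prefix_snoc)
  then have cx: "c = fmul f p" "y = x'" by auto
  \<comment> \<open>Solving this identity for \<open>Th (- n) [x']\<close> exhibits its part before
    the stable letter, \<open>finv (Th (- n) p)\<close>.\<close>
  have "[x] = Th (- n) (Th n [x])" using X by simp
  also have "\<dots> = fmul (fmul (Th (- n) p) (Th (- n) [x'])) (Th (- n) q)"
    unfolding *(4) using X by (simp add: Th_fmul)
  finally have "[x] = fmul (fmul (Th (- n) p) (Th (- n) [x'])) (Th (- n) q)" .
  then have "fmul (finv (Th (- n) p)) (fmul [x] (finv (Th (- n) q))) = Th (- n) [x']"
    using X Th_closed by (simp add: fmul_assoc words_reduced)
  moreover have P: "finv (Th (- n) p) \<in> words A" "finv (Th (- n) q) \<in> words A" using * Th_A by auto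
  moreover have "fmul (finv (Th (- n) p)) (fmul [x] (finv (Th (- n) q))) = finv (Th (- n) p) @ [x] @ finv (Th (- n) q)"
    using reduced_sandwich[OF P Z_not_A[OF x]] fmul_append[of "[x]" "finv (Th (- n) q)"]
      fmul_append[of "finv (Th (- n) p)" "[x] @ finv (Th (- n) q)"] by simp
  ultimately have "pre (Th (- n) [x']) = finv (Th (- n) p)" using x Z_not_A pre_append[of "finv (Th (- n) p)" x] by (metis append_Cons append_Nil)
  then have "Th n (pre (Th (- n) [x'])) = finv p"
    using X by (simp add: Th_finv Th_closed)
  then show ?thesis using cx X f by (simp add: gate_def fmul_assoc words_reduced)
qed

text \<open>The retraction onto the half space together with its gates; a point outside keeps its
  height.\<close>

definition behind_map :: "('a \<times> bool) list \<Rightarrow> 'a \<times> bool \<Rightarrow> ('a \<times> bool) list \<times> int \<Rightarrow> ('a \<times> bool) list \<times> int" where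
  "behind_map c y g = (if prefix (c @ [y]) (fst g) then g else gate c y (snd g))"

text \<open>The first stable letter of the word names an outermost half space containing the point.
  Its gate at the same height lies in \<open>lev A\<close>, since everything before that letter is a
  word over \<open>A\<close>.\<close>

definition fold_map :: "('a \<times> bool) list \<times> int \<Rightarrow> ('a \<times> bool) list \<times> int" where
  "fold_map g = (if fst g \<in> words A then g
     else gate (pre (fst g)) (hd (dropWhile (\<lambda>x. fst x \<in> A) (fst g))) (snd g))"

lemma behind_map_idem: "c \<in> words X \<Longrightarrow> fst y \<in> Z \<Longrightarrow> behind_map c y (behind_map c y g) = behind_map c y g"
  using gate_not_behind[of c y "snd g"] by (simp add: behind_map_def gate_def)

lemma inv_mult_G [simp]:
  "f \<in> words X \<Longrightarrow> g \<in> words X \<Longrightarrow> inv\<^bsub>G\<^esub> (f, n) \<otimes>\<^bsub>G\<^esub> (fmul f (Th n g), n) = (g, 0)"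
  by (simp add: inv_G Th_fmul Th_closed Th_finv flip: Th_0)

lemma tau_mult [simp]: "f \<in> words X \<Longrightarrow> inv\<^bsub>G\<^esub> (f, n) \<otimes>\<^bsub>G\<^esub> (f, n + 1) = \<tau>"
  by (simp add: inv_G \<tau>_def)

lemma words_AZ_X: "w \<in> words (A \<union> Z) \<Longrightarrow> w \<in> words X"
  using words_mono[of "A \<union> Z" X] A_X Z_X by auto

lemma snoc_wordsD: "c @ [y] \<in> words B \<Longrightarrow> c \<in> words B" "c @ [y] \<in> words B \<Longrightarrow> fst y \<in> B"
  by (auto simp: words_iff reduced_append mem_Times_iff)

lemma cancel_letter:
  "f \<in> words X \<Longrightarrow> x \<in> X \<Longrightarrow> fmul (fmul f (Th n [(x, True)])) (Th n [(x, False)]) = f"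
  using Th_fmul[of "[(x, True)]" "[(x, False)]" n] fmul_finv(2)[of "[(x, True)]"]
  by (simp add: fmul_assoc inverse_letter_def)

lemma finite_G_pair:
  "x \<in> X \<Longrightarrow> finite {([(x, True)], 0 :: int), \<one>\<^bsub>G\<^esub>} \<and> {([(x, True)], 0), \<one>\<^bsub>G\<^esub>} \<subseteq> carrier G"
  by (simp add: one_G)

text \<open>Letters of \<open>A\<close> never change the side, and a stable letter changes it only
  at a gate, which the map fixes. Hence a letter displaces the image by itself or not at all. Height
  moves outside the half space are gate steps, taken from one finite set for all half
  spaces.\<close>

lemma controlled_behind_map:
  "controlled G (lev (A \<union> Z)) {behind_map c y | c y. c @ [y] \<in> words (A \<union> Z) \<and> fst y \<in> Z}" (is "controlled G _ ?R")
proof (rule controlled_lev[OF invariant_AZ])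
  obtain E where E: "finite E" "E \<subseteq> carrier G"
    "\<And>c y n. c \<in> words X \<Longrightarrow> fst y \<in> Z \<Longrightarrow> inv\<^bsub>G\<^esub> (gate c y n) \<otimes>\<^bsub>G\<^esub> gate c y (n + 1) \<in> E"
    using gate_step by blast
  have R: "\<exists>c y. \<rho> = behind_map c y \<and> c \<in> words X \<and> fst y \<in> Z" if "\<rho> \<in> ?R" for \<rho>
    using that snoc_wordsD(1) words_AZ_X by blast
  show "\<rho> (f, n) \<in> carrier G" if "\<rho> \<in> ?R" "f \<in> words (A \<union> Z)" for \<rho> f n
    using R[OF that(1)] that(2) gate_closed words_AZ_X by (auto simp: behind_map_def)
  show "\<exists>E. finite E \<and> E \<subseteq> carrier G \<and> (\<forall>\<rho>\<in>?R. \<forall>f\<in>words (A \<union> Z). \<forall>n. inv\<^bsub>G\<^esub> (\<rho> (f, n)) \<otimes>\<^bsub>G\<^esub> \<rho> (f, n + 1) \<in> E)"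
  proof (intro exI[of _ "insert \<tau> E"] conjI ballI allI)
    fix \<rho> f n assume r: "\<rho> \<in> ?R" and f: "f \<in> words (A \<union> Z)"
    obtain c y where cy: "\<rho> = behind_map c y" "c \<in> words X" "fst y \<in> Z" using R[OF r] by blast
    show "inv\<^bsub>G\<^esub> (\<rho> (f, n)) \<otimes>\<^bsub>G\<^esub> \<rho> (f, n + 1) \<in> insert \<tau> E"
      using E(3)[OF cy(2,3), of n] words_AZ_X[OF f] by (simp add: cy behind_map_def)
  qed (use E in auto)
  fix x assume x: "x \<in> A \<union> Z"
  then have xX: "x \<in> X" using A_X Z_X by auto
  let ?E = "{([(x, True)], 0 :: int), \<one>\<^bsub>G\<^esub>}"
  have "inv\<^bsub>G\<^esub> (\<rho> (f, n)) \<otimes>\<^bsub>G\<^esub> \<rho> (fmul f (Th n [(x, True)]), n) \<in> ?E"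
    if r: "\<rho> \<in> ?R" and f: "f \<in> words (A \<union> Z)" for \<rho> f n
  proof -
    obtain c y where cy: "\<rho> = behind_map c y" "c \<in> words X" "fst y \<in> Z" using R[OF r] by blast
    define f' where "f' = fmul f (Th n [(x, True)])"
    have fX: "f \<in> words X" "f' \<in> words X" using words_AZ_X[OF f] xX by (simp_all add: f'_def)
    have mv: "inv\<^bsub>G\<^esub> (f, n) \<otimes>\<^bsub>G\<^esub> (f', n) = ([(x, True)], 0)"
      unfolding f'_def using fX(1) xX by simp
    have gc: "gate c y n \<in> carrier G" using gate_closed cy by blast
    consider "x \<in> A" | "x \<in> Z" using x by blast
    then have "inv\<^bsub>G\<^esub> (\<rho> (f, n)) \<otimes>\<^bsub>G\<^esub> \<rho> (f', n) \<in> ?E"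
    proof cases
      case 1
      then have "Th n [(x, True)] \<in> words A" by (intro Th_A) simp
      then have "prefix (c @ [y]) f' \<longleftrightarrow> prefix (c @ [y]) f"
        unfolding f'_def using prefix_fmul_iff fX(1) cy(3) by blast
      then show ?thesis using mv gc by (simp add: cy(1) behind_map_def)
    next
      case 2
      consider "prefix (c @ [y]) f" "prefix (c @ [y]) f'" | "\<not> prefix (c @ [y]) f" "\<not> prefix (c @ [y]) f'"
        | "prefix (c @ [y]) f" "\<not> prefix (c @ [y]) f'" | "\<not> prefix (c @ [y]) f" "prefix (c @ [y]) f'" by blast
      then show ?thesis
      proof cases
        \<comment> \<open>Leaving the half space by \<open>x\<close> is the same as entering it from
          \<open>f'\<close> by the inverse letter, so \<open>(f', n)\<close> is the gate.\<close>
        case 3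
        have "fmul f' (Th n [(x, False)]) = f" unfolding f'_def using cancel_letter fX xX by blast
        then have "gate c y n = (f', n)"
          using crossing_gate[of f' c y "(x, False)" n] 3 2 cy fX by simp
        then show ?thesis using 3 mv by (simp add: cy(1) behind_map_def)
      next
        case 4
        have "gate c y n = (f, n)"
          using crossing_gate[of f c y "(x, True)" n] 4 2 cy fX by (simp add: f'_def)
        then show ?thesis using 4 mv by (simp add: cy(1) behind_map_def)
      qed (use mv gc in \<open>simp_all add: cy(1) behind_map_def\<close>)
    qed
    then show ?thesis unfolding f'_def .
  qed
  then show "\<exists>E. finite E \<and> E \<subseteq> carrier G \<and>
       (\<forall>\<rho>\<in>?R. \<forall>f\<in>words (A \<union> Z). \<forall>n. inv\<^bsub>G\<^esub> (\<rho> (f, n)) \<otimes>\<^bsub>G\<^esub> \<rho> (fmul f (Th n [(x, True)]), n) \<in> E)"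
    using finite_G_pair[OF xX] by (intro exI[of _ ?E]) blast
qed

lemma first_Z_letter:
  assumes "f \<in> words (A \<union> Z)" "f \<notin> words A"
  obtains c y where "c \<in> words A" "fst y \<in> Z" "prefix (c @ [y]) f"
proof -
  have "\<exists>x\<in>set f. fst x \<notin> A" using assms by (auto simp: words_iff_Ball)
  then obtain c y g where f: "f = c @ y # g" "fst y \<notin> A" "\<forall>x\<in>set c. fst x \<in> A"
    using split_list_first_prop[of f "\<lambda>x. fst x \<notin> A"] by auto
  then have "c \<in> words A" "fst y \<in> Z" using assms(1) by (auto simp: words_iff_Ball reduced_append)
  then show thesis using that f by (simp add: prefix_def)
qed

lemma fold_map_behind:
  assumes "c \<in> words A" "fst y \<in> Z" "prefix (c @ [y]) f"
  shows "fold_map (f, n) = gate c y n" "f \<notin> words A"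
proof -
  obtain g where g: "f = c @ y # g" using assms(3) by (auto simp: prefix_def)
  have yA: "fst y \<notin> A" using assms(2) Z_not_A by blast
  then show nA: "f \<notin> words A" unfolding g by (auto simp: words_iff mem_Times_iff)
  have "dropWhile (\<lambda>x. fst x \<in> A) f = y # g"
    unfolding g using assms(1) yA by (subst dropWhile_append2) (auto simp: words_iff mem_Times_iff)
  then show "fold_map (f, n) = gate c y n"
    using nA g assms yA by (simp add: fold_map_def)
qed

lemma gate_lev: "c \<in> words A \<Longrightarrow> fst y \<in> Z \<Longrightarrow> gate c y n \<in> lev A"
  using gate_factor by (simp add: gate_def)

lemma fold_map_lev:
  assumes "g \<in> lev (A \<union> Z)" shows "fold_map g \<in> lev A"
proof (cases "fst g \<in> words A")
  case True
  then show ?thesis by (cases g) (simp add: fold_map_def)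
next
  case False
  obtain f n where g: "g = (f, n)" by (cases g)
  obtain c y where "c \<in> words A" "fst y \<in> Z" "prefix (c @ [y]) f"
    using first_Z_letter[of f] assms False g by auto
  then show ?thesis using fold_map_behind(1) gate_lev g by simp
qed

lemma fold_map_id: "g \<in> lev A \<Longrightarrow> fold_map g = g"
  by (auto simp: fold_map_def lev_def)

lemma controlled_fold_map: "controlled G (lev (A \<union> Z)) {fold_map}"
proof (rule controlled_lev[OF invariant_AZ])
  obtain E where E: "finite E" "E \<subseteq> carrier G"
    "\<And>c y n. c \<in> words X \<Longrightarrow> fst y \<in> Z \<Longrightarrow> inv\<^bsub>G\<^esub> (gate c y n) \<otimes>\<^bsub>G\<^esub> gate c y (n + 1) \<in> E"
    using gate_step by blast
  have levG: "lev A \<subseteq> carrier G" using words_A_X by (auto simp: lev_def carrier_G)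
  show "\<rho> (f, n) \<in> carrier G" if "\<rho> \<in> {fold_map}" "f \<in> words (A \<union> Z)" for \<rho> f n
    using fold_map_lev[of "(f, n)"] that levG by auto
  have "inv\<^bsub>G\<^esub> (fold_map (f, n)) \<otimes>\<^bsub>G\<^esub> fold_map (f, n + 1) \<in> insert \<tau> E" if f: "f \<in> words (A \<union> Z)" for f n
  proof (cases "f \<in> words A")
    case True
    then show ?thesis using words_A_X by (simp add: fold_map_def)
  next
    case False
    then obtain c y where cy: "c \<in> words A" "fst y \<in> Z" "prefix (c @ [y]) f" using first_Z_letter f by blast
    then show ?thesis using fold_map_behind(1)[OF cy] E(3)[of c y n] words_A_X by simp
  qed
  then show "\<exists>E. finite E \<and> E \<subseteq> carrier G \<and> (\<forall>\<rho>\<in>{fold_map}. \<forall>f\<in>words (A \<union> Z). \<forall>n. inv\<^bsub>G\<^esub> (\<rho> (f, n)) \<otimes>\<^bsub>G\<^esub> \<rho> (f, n + 1) \<in> E)"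
    using E(1,2) by (intro exI[of _ "insert \<tau> E"]) auto
  fix x assume x: "x \<in> A \<union> Z"
  then have xX: "x \<in> X" using A_X Z_X by auto
  let ?E = "{([(x, True)], 0 :: int), \<one>\<^bsub>G\<^esub>}"
  have "inv\<^bsub>G\<^esub> (fold_map (f, n)) \<otimes>\<^bsub>G\<^esub> fold_map (fmul f (Th n [(x, True)]), n) \<in> ?E"
    if f: "f \<in> words (A \<union> Z)" for f n
  proof -
    define f' where "f' = fmul f (Th n [(x, True)])"
    have fX: "f \<in> words X" "f' \<in> words X" using words_AZ_X[OF f] xX by (simp_all add: f'_def)
    have mv: "inv\<^bsub>G\<^esub> (f, n) \<otimes>\<^bsub>G\<^esub> (f', n) = ([(x, True)], 0)"
      unfolding f'_def using fX(1) xX by simp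
    have fc: "fold_map (f, n) \<in> carrier G" using fold_map_lev[of "(f, n)"] f levG by auto
    have same: ?thesis if "fold_map (f', n) = fold_map (f, n)"
      using that fc unfolding f'_def by simp
    consider "x \<in> A" "f \<in> words A" | "x \<in> A" "f \<notin> words A" | "x \<in> Z" "f \<in> words A" | "x \<in> Z" "f \<notin> words A" using x by blast
    then show ?thesis
    proof cases
      case 1
      then have "f' \<in> words A" unfolding f'_def using Th_A[of "[(x, True)]" n] by simp
      then show ?thesis using mv 1 by (simp add: fold_map_def f'_def)
    next
      case 2
      then obtain c y where cy: "c \<in> words A" "fst y \<in> Z" "prefix (c @ [y]) f" using first_Z_letter f by blast
      have "Th n [(x, True)] \<in> words A" using 2 by (intro Th_A) simp
      then have "prefix (c @ [y]) f'" unfolding f'_def using cy prefix_fmul_iff fX(1) by blast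
      then show ?thesis using same fold_map_behind(1)[OF cy(1,2)] cy(3) by simp
    next
      \<comment> \<open>A stable letter appended to a word over \<open>A\<close> enters a half space
        whose gate at height \<open>n\<close> is \<open>(f, n)\<close> itself, so folding undoes the
        move.\<close>
      case 3
      obtain p q x' where *: "p \<in> words A" "q \<in> words A" "fst x' \<in> Z" "Th n [(x, True)] = fmul (fmul p [x']) q"
        using Th_letter[of "(x, True)" n] 3 by (metis fst_conv)
      have X: "p \<in> words X" "q \<in> words X" "[x'] \<in> words X" using * words_A_X Z_X by auto
      have fp: "fmul f p \<in> words A" using 3 * by simp
      have "f' = fmul (fmul (fmul f p) [x']) q"
        unfolding f'_def using X fX by (simp add: *(4) fmul_assoc)
      also have "\<dots> = fmul f p @ [x'] @ q"
        using fmul_sandwich[OF fp *(2) Z_not_A[OF *(3)]] by simp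
      finally have b: "prefix (fmul f p @ [x']) f'" by (simp add: prefix_def)
      have nb: "\<not> prefix (fmul f p @ [x']) f" using fold_map_behind(2)[OF fp *(3)] 3 by blast
      have g: "gate (fmul f p) x' n = (f, n)"
        using crossing_gate[of f "fmul f p" x' "(x, True)" n] nb b * 3 fX X by (simp add: f'_def)
      show ?thesis
        by (rule same) (use fold_map_behind(1)[OF fp *(3) b, of n] fold_map_id[of "(f, n)"] 3 g in simp)
    next
      case 4
      then obtain c y where cy: "c \<in> words A" "fst y \<in> Z" "prefix (c @ [y]) f" using first_Z_letter f by blast
      show ?thesis
      proof (cases "prefix (c @ [y]) f'")
        case True
        then show ?thesis using same fold_map_behind(1)[OF cy(1,2)] cy(3) by simp
      next
        case False
        have "fmul f' (Th n [(x, False)]) = f" unfolding f'_def using cancel_letter fX xX by blast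
        then have g: "gate c y n = (f', n)"
          using crossing_gate[of f' c y "(x, False)" n] False cy fX 4 words_A_X by simp
        then have "(f', n) \<in> lev A" using gate_lev[OF cy(1,2), of n] by simp
        then show ?thesis using same fold_map_id[of "(f', n)"] fold_map_behind(1)[OF cy] g by simp
      qed
    qed
  qed
  then show "\<exists>E. finite E \<and> E \<subseteq> carrier G \<and>
       (\<forall>\<rho>\<in>{fold_map}. \<forall>f\<in>words (A \<union> Z). \<forall>n. inv\<^bsub>G\<^esub> (\<rho> (f, n)) \<otimes>\<^bsub>G\<^esub> \<rho> (fmul f (Th n [(x, True)]), n) \<in> E)"
    using finite_G_pair[OF xX] by (intro exI[of _ ?E]) blast
qed

end


section \<open>Normal forms in the subgroup\<close>

context free_by_cyclic
begin

definition el :: "'x \<times> bool \<Rightarrow> ('x \<times> bool) list \<times> int" where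
  "el x = (if snd x then ([x], e (fst x)) else (Th (- e (fst x)) [x], - e (fst x)))"

definition ev :: "('x \<times> bool) list \<Rightarrow> ('x \<times> bool) list \<times> int" where
  "ev w = foldr (\<lambda>x g. el x \<otimes>\<^bsub>G\<^esub> g) w \<one>\<^bsub>G\<^esub>"

lemma ev_Nil [simp]: "ev [] = \<one>\<^bsub>G\<^esub>"
  by (simp add: ev_def)

lemma ev_Cons: "ev (x # w) = el x \<otimes>\<^bsub>G\<^esub> ev w"
  by (simp add: ev_def)

lemma el_closed [simp]: "fst x \<in> X \<Longrightarrow> el x \<in> carrier G"
  by (simp add: el_def)

lemma words_ConsD: "x # w \<in> words B \<Longrightarrow> fst x \<in> B \<and> w \<in> words B"
  by (auto simp: words_iff_Ball reduced_Cons)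

lemma words_appendD: "u @ v \<in> words B \<Longrightarrow> u \<in> words B \<and> v \<in> words B"
  by (auto simp: words_iff_Ball reduced_append)

lemma ev_closed [simp]: "w \<in> words X \<Longrightarrow> ev w \<in> carrier G"
proof (induction w)
  case (Cons x w)
  then show ?case using words_ConsD[of x w X] by (simp add: ev_Cons)
qed simp

lemma el_inverse: "fst x \<in> X \<Longrightarrow> el (inverse_letter x) = inv\<^bsub>G\<^esub> (el x)"
proof -
  assume x: "fst x \<in> X"
  obtain a b where ab: "x = (a, b)" by (cases x)
  have *: "inv\<^bsub>G\<^esub> (el (a, True)) = el (a, False)"
    using x ab Th_finv[of "[(a, True)]" "- e a"] by (simp add: el_def inv_G inverse_letter_def)
  have "inv\<^bsub>G\<^esub> (el (a, False)) = el (a, True)"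
    unfolding *[symmetric] using x ab by simp
  then show ?thesis using * ab by (cases b) (simp_all add: inverse_letter_def)
qed

lemma ev_append: "u @ v \<in> words X \<Longrightarrow> ev (u @ v) = ev u \<otimes>\<^bsub>G\<^esub> ev v"
proof (induction u)
  case (Cons x u)
  have "fst x \<in> X" "u @ v \<in> words X" using words_ConsD[of x "u @ v"] Cons.prems by auto
  moreover then have "u \<in> words X" "v \<in> words X" using words_appendD by auto
  ultimately show ?case using Cons.IH by (simp add: ev_Cons G.m_assoc)
qed simp

lemma ev_single: "fst x \<in> X \<Longrightarrow> ev [x] = el x"
  by (simp add: ev_Cons)

lemma ev_fmul: "u \<in> words X \<Longrightarrow> v \<in> words X \<Longrightarrow> ev (fmul u v) = ev u \<otimes>\<^bsub>G\<^esub> ev v"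
proof (induction rule: free_group_induct)
  case (Cons x w)
  have one: "ev (fmul [x] u) = el x \<otimes>\<^bsub>G\<^esub> ev u" if u: "u \<in> words X" for u
  proof -
    have "fmul [x] u = cancel_Cons x u"
      using u by (simp add: fmul_def free_reduce_append del: append_Cons)
    moreover have "ev (cancel_Cons x u) = el x \<otimes>\<^bsub>G\<^esub> ev u"
    proof (cases u)
      case (Cons y w)
      have y: "fst y \<in> X" "w \<in> words X" using words_ConsD[of y w X] u Cons by simp_all
      have "el x \<otimes>\<^bsub>G\<^esub> (el y \<otimes>\<^bsub>G\<^esub> ev w) = ev w" if "y = inverse_letter x"
        using that y el_inverse[of x] \<open>fst x \<in> X\<close> by (simp flip: G.m_assoc)
      then show ?thesis using Cons by (simp add: ev_Cons)
    qed (simp add: ev_Cons)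
    ultimately show ?thesis by simp
  qed
  have "fmul (x # w) v = fmul [x] (fmul w v)"
    using Cons by (metis fmul_assoc red_X words_single)
  then show ?case
    using one[of "fmul w v"] Cons by (simp add: ev_Cons G.m_assoc)
qed simp

lemma ev_finv: "w \<in> words X \<Longrightarrow> ev (finv w) = inv\<^bsub>G\<^esub> (ev w)"
  using ev_fmul[of "finv w" w] by (intro G.inv_equality[symmetric]) simp_all

lemma el_lev: "invariant A \<Longrightarrow> fst x \<in> A \<Longrightarrow> el x \<in> lev A"
  by (simp add: el_def invariant_def)

lemma ev_lev: "invariant A \<Longrightarrow> w \<in> words A \<Longrightarrow> ev w \<in> lev A"
proof (induction w)
  case Nil
  then show ?case by (simp add: one_G)
next
  case (Cons x w)
  then show ?case
    using words_ConsD[of x w] el_lev subgroup.m_closed[OF subgroup_lev] by (auto simp: ev_Cons)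
qed

lemma inv_mult_lev:
  assumes "invariant A" "f \<in> words X" "g \<in> words A"
  shows "inv\<^bsub>G\<^esub> (f, n) \<otimes>\<^bsub>G\<^esub> (fmul f g, m) \<in> lev A"
proof -
  have g: "g \<in> words X" "Th (- n) g \<in> words A" using assms words_mono by (auto simp: invariant_def)
  have "inv\<^bsub>G\<^esub> (f, n) \<otimes>\<^bsub>G\<^esub> (fmul f g, m) = (Th (- n) g, m - n)"
    using assms g by (simp add: inv_G Th_fmul Th_finv)
  then show ?thesis using g by simp
qed

text \<open>In the free group on \<open>B\<close> the length of a common prefix is a Gromov product,
  so this is the criterion for a Cannon--Thurston map on the subgroup generated by \<open>B\<close>,
  with products taken in \<open>G\<close> for every \<open>B\<close>.\<close>

definition cannon_thurston_at :: "(('x \<times> bool) list \<times> int) set \<Rightarrow> 'x set \<Rightarrow> bool" where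
  "cannon_thurston_at S B \<longleftrightarrow> (\<forall>M. \<exists>N. \<forall>P U V. P @ U \<in> words B \<longrightarrow> P @ V \<in> words B \<longrightarrow> N \<le> length P \<longrightarrow>
     M \<le> gromov_product G S \<one>\<^bsub>G\<^esub> (ev (P @ U)) (ev (P @ V)))"

text \<open>Such an \<open>r\<close> extends each controlled retraction of \<open>lev B\<close> to
  all of \<open>G\<close>, where hyperbolicity applies.\<close>

definition retract :: "'x set \<Rightarrow> bool" where
  "retract B \<longleftrightarrow> (\<exists>r. controlled G (carrier G) {r} \<and> (\<forall>g\<in>carrier G. r g \<in> lev B) \<and> (\<forall>g\<in>lev B. r g = g))"

lemma retract_X: "retract X"
  unfolding retract_def
proof (intro exI[of _ "\<lambda>g. g"] conjI)
  show "controlled G (carrier G) {\<lambda>g. g}"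
    unfolding controlled_def
  proof (intro conjI ballI)
    fix g assume "g \<in> carrier G"
    then show "\<exists>E. finite E \<and> E \<subseteq> carrier G \<and> (\<forall>\<rho>\<in>{\<lambda>g. g}. \<forall>h\<in>carrier G. inv\<^bsub>G\<^esub> (\<rho> h) \<otimes>\<^bsub>G\<^esub> \<rho> (h \<otimes>\<^bsub>G\<^esub> g) \<in> E)"
      by (intro exI[of _ "{g}"]) (auto simp flip: G.m_assoc)
  qed auto
qed (auto simp: lev_def carrier_G)

end

context cyclic_step
begin

lemma retract_step: "retract (A \<union> Z) \<Longrightarrow> retract A"
proof -
  assume "retract (A \<union> Z)"
  then obtain r where r: "controlled G (carrier G) {r}" "\<And>g. g \<in> carrier G \<Longrightarrow> r g \<in> lev (A \<union> Z)"
    "\<And>g. g \<in> lev (A \<union> Z) \<Longrightarrow> r g = g" unfolding retract_def by blast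
  have "controlled G (carrier G) {\<rho>' \<circ> \<rho> | \<rho>' \<rho>. \<rho>' \<in> {fold_map} \<and> \<rho> \<in> {r}}"
    by (rule G.controlled_comp[OF r(1) _ subgroup_lev[OF invariant_AZ] _ _ controlled_fold_map])
       (use r in auto)
  moreover have "{\<rho>' \<circ> \<rho> | \<rho>' \<rho>. \<rho>' \<in> {fold_map} \<and> \<rho> \<in> {r}} = {fold_map \<circ> r}" by auto
  moreover have "lev A \<subseteq> lev (A \<union> Z)" using words_mono[of A "A \<union> Z"] by (auto simp: lev_def)
  ultimately show ?thesis
    unfolding retract_def using r fold_map_lev fold_map_id
    by (intro exI[of _ "fold_map \<circ> r"]) (auto simp: subset_iff)
qed

text \<open>The generator of the subgroup is \<open>z t\<close>, so its inverse starts with a power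
  \<open>-1\<close> of \<open>t\<close>: an inverse stable letter is crossed one unit below the
  current height.\<close>

definition sh :: "'a \<times> bool \<Rightarrow> int" where
  "sh y = (if snd y then 0 else - 1)"

lemma mult_el:
  assumes "fst y \<in> Z" "f \<in> words X"
  shows "\<exists>m. (f, n) \<otimes>\<^bsub>G\<^esub> el y = (fmul f (Th (n + sh y) [y]), m)"
proof -
  have "[y] \<in> words X" using assms Z_X by auto
  then show ?thesis using e_Z[OF assms(1)] Th_add[of "[y]" n "- 1"] by (simp add: el_def sh_def)
qed

text \<open>The half space that is entered on the way from \<open>ev P\<close> to \<open>ev (P @ [y])\<close>.\<close>

definition wall :: "('a \<times> bool) list \<Rightarrow> 'a \<times> bool \<Rightarrow> ('a \<times> bool) list \<times> ('a \<times> bool)" where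
  "wall P y = (let w = Th (snd (ev P) + sh y) [y] in
     (fmul (fst (ev P)) (pre w), hd (dropWhile (\<lambda>x. fst x \<in> A) w)))"

lemma wallE:
  assumes "fst y \<in> Z" "ev P = (f, n)"
  obtains p q y' where "p \<in> words A" "q \<in> words A" "fst y' \<in> Z"
    "Th (n + sh y) [y] = fmul (fmul p [y']) q" "wall P y = (fmul f p, y')"
proof -
  obtain p q y' where *: "p \<in> words A" "q \<in> words A" "fst y' \<in> Z"
    "Th (n + sh y) [y] = p @ [y'] @ q" "Th (n + sh y) [y] = fmul (fmul p [y']) q"
    using Th_letter[OF assms(1)] by metis
  have y'A: "fst y' \<notin> A" using * Z_not_A by blast
  have "dropWhile (\<lambda>x. fst x \<in> A) (p @ y' # q) = y' # q"
    using *(1) y'A by (subst dropWhile_append2) (auto simp: words_iff_Ball)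
  then have "wall P y = (fmul f p, y')"
    using * y'A assms(2) by (simp add: wall_def)
  with * that show thesis by blast
qed

lemma words_AZ_mono: "w \<in> words A \<Longrightarrow> w \<in> words (A \<union> Z)"
  by (rule words_mono) auto

end

text \<open>In the Bass--Serre tree, the path through the edges of \<open>y\<close> and
  \<open>x\<close> returns to its starting vertex only by immediate backtracking. This encodes that
  the subgroup generated by \<open>A\<close> meets the edge groups at the vertex of
  \<open>lev A\<close> trivially.\<close>

locale malnormal_step = cyclic_step +
  assumes cross: "m \<in> words A \<Longrightarrow> fst y \<in> Z \<Longrightarrow> fst x \<in> Z \<Longrightarrow>
      el y \<otimes>\<^bsub>G\<^esub> ev m \<otimes>\<^bsub>G\<^esub> el x \<in> lev A \<Longrightarrow> m = [] \<and> x = inverse_letter y"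
begin

section \<open>Words of the subgroup do not backtrack in the Bass--Serre tree\<close>

lemma last_Z_letter:
  assumes "w \<in> words (A \<union> Z)" "w \<notin> words A"
  obtains P y m where "w = P @ [y] @ m" "fst y \<in> Z" "m \<in> words A" "P \<in> words (A \<union> Z)"
proof -
  have "\<exists>x\<in>set w. fst x \<notin> A" using assms by (auto simp: words_iff_Ball)
  then obtain P y m where w: "w = P @ y # m" "fst y \<notin> A" "\<forall>x\<in>set m. fst x \<in> A"
    using split_list_last_prop[of w "\<lambda>x. fst x \<notin> A"] by auto
  then have "fst y \<in> Z" "m \<in> words A" "P \<in> words (A \<union> Z)"
    using assms(1) by (auto simp: words_iff_Ball reduced_append reduced_Cons)
  then show thesis using that w by simp
qed

text \<open>A letter cancelled by \<open>x'\<close> would have to be the one produced by the last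
  stable letter \<open>y\<close> of \<open>W\<close>. Then \<open>el y\<close>, \<open>ev m\<close>
  and \<open>el x\<close> multiply into \<open>lev A\<close>, and \<open>cross\<close> makes
  \<open>x\<close> the inverse of \<open>y\<close> with nothing between them, although
  \<open>W @ [x]\<close> is reduced.\<close>

lemma no_cancellation:
  assumes W: "W @ [x] \<in> words (A \<union> Z)" and x: "fst x \<in> Z" and fn: "ev W = (f, n)"
    and IH: "\<And>P y Q. W = P @ [y] @ Q \<Longrightarrow> fst y \<in> Z \<Longrightarrow> prefix (fst (wall P y) @ [snd (wall P y)]) f"
    and p: "p \<in> words A" "q \<in> words A" "fst x' \<in> Z" "Th (n + sh x) [x] = fmul (fmul p [x']) q"
  shows "\<not> (fmul f p \<noteq> [] \<and> last (fmul f p) = inverse_letter x')"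
proof
  assume can: "fmul f p \<noteq> [] \<and> last (fmul f p) = inverse_letter x'"
  have WB: "W \<in> words (A \<union> Z)" using W words_appendD by blast
  have WX: "W \<in> words X" by (rule words_AZ_X[OF WB])
  have fX: "f \<in> words X" using ev_closed[OF WX] fn by simp
  have pX: "p \<in> words X" "q \<in> words X" "[x'] \<in> words X" using p words_A_X Z_X by auto
  have nA: "fmul f p \<notin> words A"
  proof
    assume "fmul f p \<in> words A"
    moreover have "last (fmul f p) \<in> set (fmul f p)" using can by (intro last_in_set) simp
    ultimately have "fst (last (fmul f p)) \<in> A" unfolding words_iff_Ball by blast
    then show False using can p(3) Z_not_A by auto
  qed
  have "W \<notin> words A"
  proof
    assume "W \<in> words A"
    then have "f \<in> words A" using ev_lev[OF inv_A, of W] fn by simp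
    then show False using nA p(1) by simp
  qed
  then obtain P y m where Wm: "W = P @ [y] @ m" "fst y \<in> Z" "m \<in> words A" "P \<in> words (A \<union> Z)"
    using last_Z_letter[OF WB] by blast
  have PX: "P \<in> words X" "m \<in> words X" "fst y \<in> X" using Wm words_AZ_X words_A_X Z_X by auto
  obtain c0 n0 where P: "ev P = (c0, n0)" by (cases "ev P")
  have c0: "c0 \<in> words X" using ev_closed[OF PX(1)] P by simp
  obtain p0 q0 y' where *: "p0 \<in> words A" "q0 \<in> words A" "fst y' \<in> Z"
    "Th (n0 + sh y) [y] = fmul (fmul p0 [y']) q0" "wall P y = (fmul c0 p0, y')"
    using wallE[OF Wm(2) P] by metis
  have X: "p0 \<in> words X" "q0 \<in> words X" "[y'] \<in> words X" using * words_A_X Z_X by auto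
  define c where "c = fmul c0 p0"
  have cX: "c \<in> words X" using c0 X by (simp add: c_def)
  have evW: "ev W = ev P \<otimes>\<^bsub>G\<^esub> el y \<otimes>\<^bsub>G\<^esub> ev m"
    using ev_append[of P "[y] @ m"] ev_append[of "[y]" m] WX Wm(1) words_appendD[of P "[y] @ m" X] PX
    by (simp add: ev_single G.m_assoc)
  obtain n1 where n1: "ev P \<otimes>\<^bsub>G\<^esub> el y = (fmul c0 (Th (n0 + sh y) [y]), n1)"
    using mult_el[OF Wm(2) c0] P by metis
  obtain g k where g: "ev m = (g, k)" by (cases "ev m")
  have gA: "g \<in> words A" using ev_lev[OF inv_A Wm(3)] g by simp
  define \<beta> where "\<beta> = fmul q0 (Th n1 g)"
  have \<beta>: "\<beta> \<in> words A" unfolding \<beta>_def using * gA Th_A by simp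
  have \<beta>X: "\<beta> \<in> words X" by (rule words_A_X[OF \<beta>])
  have pf: "prefix (c @ [y']) f" using IH[OF Wm(1,2)] * by (simp add: c_def)
  then have redc: "reduced (c @ [y'])" using fX by (auto simp: prefix_def reduced_append reduced_Cons[of y' "[]"] dest!: red_X)
  have "f = fmul (fmul c0 (fmul (fmul p0 [y']) q0)) (Th n1 g)"
    using evW n1 g fn *(4) by simp
  also have "\<dots> = fmul (fmul c [y']) \<beta>"
    using c0 X words_A_X[OF gA] by (simp add: c_def \<beta>_def fmul_assoc)
  also have "fmul c [y'] = c @ [y']" by (rule fmul_append[OF redc])
  finally have f: "f = fmul (c @ [y']) \<beta>" .
  have \<beta>2: "fmul \<beta> p \<in> words A" using \<beta> p by simp
  have "fmul f p = fmul (c @ [y']) (fmul \<beta> p)"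
    unfolding f using redc \<beta>X pX by (simp add: fmul_assoc)
  also have "\<dots> = (c @ [y']) @ fmul \<beta> p"
  proof (rule fmul_append)
    have "reduced ([y'] @ fmul \<beta> p)"
      using reduced_sandwich(2)[OF words_Nil \<beta>2] *(3) Z_not_A by blast
    then show "reduced ((c @ [y']) @ fmul \<beta> p)"
      using redc by (auto simp: reduced_append reduced_Cons)
  qed
  finally have fp: "fmul f p = (c @ [y']) @ fmul \<beta> p" .
  \<comment> \<open>Otherwise the last letter of \<open>fmul f p\<close> would lie in
    \<open>A\<close>, but it is the inverse of a stable letter.\<close>
  have nil: "fmul \<beta> p = []"
  proof (rule ccontr)
    assume ne: "fmul \<beta> p \<noteq> []"
    then have "last (fmul \<beta> p) \<in> set (fmul \<beta> p)" by (rule last_in_set)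
    then have "fst (last (fmul \<beta> p)) \<in> A" using \<beta>2 unfolding words_iff_Ball by blast
    then have "fst (last (fmul f p)) \<in> A" using fp ne by simp
    then show False using can p(3) Z_not_A by auto
  qed
  then have y'x': "y' = inverse_letter x'" using can fp by simp
  obtain m1 where m1: "ev W \<otimes>\<^bsub>G\<^esub> el x = (fmul f (Th (n + sh x) [x]), m1)"
    using mult_el[OF x fX] fn by metis
  have "fmul f (Th (n + sh x) [x]) = fmul (fmul (fmul f p) [x']) q"
    using fX pX by (simp add: p(4) fmul_assoc)
  also have "fmul (fmul f p) [x'] = c"
    using fp nil y'x' redc by (simp add: fmul_letter)
  also have "fmul c q = fmul c0 (fmul p0 q)" using c0 X pX by (simp add: c_def fmul_assoc)
  finally have "ev W \<otimes>\<^bsub>G\<^esub> el x = (fmul c0 (fmul p0 q), m1)" using m1 by simp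
  then have "inv\<^bsub>G\<^esub> (ev P) \<otimes>\<^bsub>G\<^esub> (ev W \<otimes>\<^bsub>G\<^esub> el x) \<in> lev A"
    using inv_mult_lev[OF inv_A c0, of "fmul p0 q"] * p P by simp
  moreover have "inv\<^bsub>G\<^esub> (ev P) \<otimes>\<^bsub>G\<^esub> (ev W \<otimes>\<^bsub>G\<^esub> el x) = el y \<otimes>\<^bsub>G\<^esub> ev m \<otimes>\<^bsub>G\<^esub> el x"
    unfolding evW using PX x Z_X by (simp add: G.m_assoc subset_iff) (simp flip: G.m_assoc)
  ultimately have "m = [] \<and> x = inverse_letter y" using cross[OF Wm(3,2) x] by simp
  then have "reduced (P @ [y] @ [inverse_letter y])" using W Wm(1) words_reduced by auto
  then show False by (simp add: reduced_append reduced_Cons)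
qed

text \<open>Each stable letter of \<open>W\<close> leaves a letter in the free part that no later
  factor cancels, so a half space once entered is never left. The wall depends only on the initial
  segment \<open>P\<close> and on \<open>y\<close>, hence stays the same while \<open>W\<close>
  grows.\<close>

lemma normal_form:
  assumes "W \<in> words (A \<union> Z)" "W = P @ [y] @ Q" "fst y \<in> Z"
  shows "prefix (fst (wall P y) @ [snd (wall P y)]) (fst (ev W))"
  using assms
proof (induction W arbitrary: P y Q rule: rev_induct)
  case (snoc x W)
  have WB: "W \<in> words (A \<union> Z)" and xB: "fst x \<in> A \<union> Z" using snoc.prems(1) snoc_wordsD by blast+
  have WX: "W \<in> words X" by (rule words_AZ_X[OF WB])
  have xX: "fst x \<in> X" using xB A_X Z_X by auto
  obtain f n where fn: "ev W = (f, n)" by (cases "ev W")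
  have fX: "f \<in> words X" using ev_closed[OF WX] fn by simp
  have evWx: "ev (W @ [x]) = ev W \<otimes>\<^bsub>G\<^esub> el x"
    using ev_append[of W "[x]"] words_AZ_X[OF snoc.prems(1)] xX by (simp add: ev_single)
  have IH: "prefix (fst (wall P' y') @ [snd (wall P' y')]) f" if "W = P' @ [y'] @ Q'" "fst y' \<in> Z" for P' y' Q'
    using snoc.IH[OF WB that] fn by simp
  show ?case
  proof (cases "fst x \<in> A")
    case True
    obtain Q' where Q: "Q = Q' @ [x]"
      using snoc.prems(2,3) True Z_not_A by (cases Q rule: rev_cases) auto
    then have "W = P @ [y] @ Q'" using snoc.prems(2) by simp
    then have pf: "prefix (fst (wall P y) @ [snd (wall P y)]) f" using IH snoc.prems(3) by blast
    obtain g k where g: "el x = (g, k)" by (cases "el x")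
    have gA: "g \<in> words A" using el_lev[OF inv_A True] g by simp
    obtain p q y' where w: "fst y' \<in> Z" "wall P y = (fmul (fst (ev P)) p, y')"
      using wallE[OF snoc.prems(3), of P "fst (ev P)" "snd (ev P)"] by (metis prod.collapse)
    then show ?thesis
      using pf evWx fn g prefix_fmul_iff[OF fX Th_A[OF gA] w(1)] by simp
  next
    case False
    then have xZ: "fst x \<in> Z" using xB by simp
    obtain p q x' where *: "p \<in> words A" "q \<in> words A" "fst x' \<in> Z"
      "Th (n + sh x) [x] = fmul (fmul p [x']) q" "wall W x = (fmul f p, x')"
      using wallE[OF xZ fn] by metis
    have pX: "p \<in> words X" "q \<in> words X" "[x'] \<in> words X" using * words_A_X Z_X by auto
    have nc: "\<not> (fmul f p \<noteq> [] \<and> last (fmul f p) = inverse_letter x')"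
      by (rule no_cancellation[OF snoc.prems(1) xZ fn IH *(1-4)])
    obtain k where "ev W \<otimes>\<^bsub>G\<^esub> el x = (fmul f (Th (n + sh x) [x]), k)"
      using mult_el[OF xZ fX] fn by metis
    then have "fst (ev (W @ [x])) = fmul (fmul (fmul f p) [x']) q"
      using evWx fX pX by (simp add: *(4) fmul_assoc)
    then have res: "fst (ev (W @ [x])) = fmul (fmul f p @ [x']) q"
      using nc fmul_letter[of "fmul f p" x'] by auto
    have rX: "fmul f p @ [x'] \<in> words X"
      using fmul_letter[of "fmul f p" x'] nc fX pX words_fmul[of "fmul f p" X "[x']"] by auto
    show ?thesis
    proof (cases Q rule: rev_cases)
      case Nil
      then have "P = W" "y = x" using snoc.prems(2) by auto
      then show ?thesis using res *(5) prefix_fmul_iff[OF rX *(2,3)] by simp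
    next
      case (snoc Q' x2)
      then have "W = P @ [y] @ Q'" using snoc.prems(2) by simp
      then have pf: "prefix (fst (wall P y) @ [snd (wall P y)]) f" using IH snoc.prems(3) by blast
      obtain p2 q2 y' where w: "fst y' \<in> Z" "wall P y = (fmul (fst (ev P)) p2, y')"
        using wallE[OF snoc.prems(3), of P "fst (ev P)" "snd (ev P)"] by (metis prod.collapse)
      have "prefix (fst (wall P y) @ [snd (wall P y)]) (fmul f p)"
        using pf prefix_fmul_iff[OF fX *(1) w(1)] w by simp
      then have "prefix (fst (wall P y) @ [snd (wall P y)]) (fmul f p @ [x'])"
        by (rule prefix_prefix)
      then show ?thesis using res prefix_fmul_iff[OF rX *(2) w(1)] w by simp
    qed
  qed
qed simp

abbreviation wall_word :: "('a \<times> bool) list \<Rightarrow> 'a \<times> bool \<Rightarrow> ('a \<times> bool) list" where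
  "wall_word P y \<equiv> fst (wall P y) @ [snd (wall P y)]"

lemma wall_words:
  assumes "P @ [y] \<in> words (A \<union> Z)" "fst y \<in> Z"
  shows "wall_word P y \<in> words (A \<union> Z)" "fst (snd (wall P y)) \<in> Z"
proof -
  have "ev (P @ [y]) \<in> lev (A \<union> Z)" by (rule ev_lev[OF invariant_AZ assms(1)])
  then have "fst (ev (P @ [y])) \<in> words (A \<union> Z)" by (auto simp: lev_def)
  moreover have "prefix (wall_word P y) (fst (ev (P @ [y])))"
    using normal_form[OF assms(1), of P y "[]"] assms(2) by simp
  ultimately show "wall_word P y \<in> words (A \<union> Z)" by (metis prefixE words_appendD)
  obtain p q y' where "fst y' \<in> Z" "wall P y = (fmul (fst (ev P)) p, y')"
    using wallE[OF assms(2), of P "fst (ev P)" "snd (ev P)"] by (metis prod.collapse)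
  then show "fst (snd (wall P y)) \<in> Z" by simp
qed

text \<open>An analogue of Britton's lemma for words in the generators of the subgroup.\<close>

lemma ev_not_lev:
  assumes "W \<in> words (A \<union> Z)" "W \<notin> words A"
  shows "fst (ev W) \<notin> words A"
proof -
  obtain c y where cy: "c \<in> words A" "fst y \<in> Z" "prefix (c @ [y]) W" using first_Z_letter[OF assms] by blast
  obtain Q where Q: "W = c @ [y] @ Q" using cy(3) by (auto simp: prefix_def)
  have cy': "c @ [y] \<in> words (A \<union> Z)" using assms(1) words_appendD[of "c @ [y]" Q] Q by simp
  have "prefix (wall_word c y) (fst (ev W))" by (rule normal_form[OF assms(1) Q cy(2)])
  then show ?thesis using wall_words(2)[OF cy' cy(2)] Z_not_A
    by (auto simp: prefix_def words_iff_Ball)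
qed

lemma ev_trivial_height:
  assumes "\<And>w. w \<in> words A \<Longrightarrow> fst (ev w) = [] \<Longrightarrow> w = []" "W \<in> words (A \<union> Z)" "fst (ev W) = []"
  shows "W = []"
  using assms ev_not_lev[of W] by fastforce

text \<open>Equal walls put both ends of the two crossings into common cosets of
  \<open>lev A\<close>. The first coincidence makes \<open>W = fmul (finv P) P'\<close> a word over
  \<open>A\<close>; the second places \<open>W\<close> between \<open>inverse_letter y\<close> and
  \<open>y'\<close>, so that \<open>cross\<close> yields \<open>W = []\<close> and
  \<open>y' = y\<close>.\<close>

lemma wall_inj:
  assumes P: "P @ [y] \<in> words (A \<union> Z)" and y: "fst y \<in> Z"
    and P': "P' @ [y'] \<in> words (A \<union> Z)" and y': "fst y' \<in> Z" and eq: "wall P y = wall P' y'"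
  shows "P = P' \<and> y = y'"
proof -
  have PX: "P \<in> words X" "P' \<in> words X" "fst y \<in> X" "fst y' \<in> X" "P @ [y] \<in> words X" "P' @ [y'] \<in> words X"
    "P \<in> words (A \<union> Z)" "P' \<in> words (A \<union> Z)"
    using words_AZ_X P P' snoc_wordsD(1) y y' Z_X by blast+
  obtain f n where fn: "ev P = (f, n)" by (cases "ev P")
  obtain f' n' where fn': "ev P' = (f', n')" by (cases "ev P'")
  have fX: "f \<in> words X" "f' \<in> words X" using ev_closed PX fn fn' by (metis carrier_G_iff)+
  obtain p q l where w1: "p \<in> words A" "q \<in> words A" "fst l \<in> Z"
    "Th (n + sh y) [y] = fmul (fmul p [l]) q" "wall P y = (fmul f p, l)"
    using wallE[OF y fn] by metis
  obtain p' q' l' where w2: "p' \<in> words A" "q' \<in> words A" "fst l' \<in> Z"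
    "Th (n' + sh y') [y'] = fmul (fmul p' [l']) q'" "wall P' y' = (fmul f' p', l')"
    using wallE[OF y' fn'] by metis
  have ll: "l' = l" and fp: "fmul f p = fmul f' p'" using eq w1(5) w2(5) by auto
  have X: "p \<in> words X" "q \<in> words X" "[l] \<in> words X" "p' \<in> words X" "q' \<in> words X"
    using w1 w2 words_A_X Z_X by auto
  define W where "W = fmul (finv P) P'"
  have W: "W \<in> words (A \<union> Z)" "ev W = inv\<^bsub>G\<^esub> (ev P) \<otimes>\<^bsub>G\<^esub> ev P'"
    using PX ev_fmul[of "finv P" P'] ev_finv[of P] by (auto simp: W_def)
  have "f' = fmul (fmul f' p') (finv p')" using fX X by (simp add: fmul_assoc)
  also have "\<dots> = fmul f (fmul p (finv p'))" using fX X by (simp add: fmul_assoc flip: fp)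
  finally have "ev W \<in> lev A"
    using inv_mult_lev[OF inv_A fX(1), of "fmul p (finv p')"] w1(1) w2(1) W(2) fn fn' by simp
  then have "fst (ev W) \<in> words A" by (auto simp: lev_def)
  then have WA: "W \<in> words A" using ev_not_lev[OF W(1)] by blast
  obtain m where m: "ev (P @ [y]) = (fmul f (Th (n + sh y) [y]), m)"
    using mult_el[OF y fX(1), of n] fn ev_append[of P "[y]"] PX by (auto simp: ev_single)
  obtain m' where m': "ev (P' @ [y']) = (fmul f' (Th (n' + sh y') [y']), m')"
    using mult_el[OF y' fX(2), of n'] fn' ev_append[of P' "[y']"] PX by (auto simp: ev_single)
  define c where "c = fmul (fmul f p) [l]"
  have cX: "c \<in> words X" using fX X by (simp add: c_def)
  have c1: "fmul f (Th (n + sh y) [y]) = fmul c q" using fX X by (simp add: w1(4) c_def fmul_assoc)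
  have c2: "fmul f' (Th (n' + sh y') [y']) = fmul c q'"
    unfolding c_def fp using fX X by (simp add: w2(4) ll fmul_assoc)
  have "fmul c q' = fmul (fmul c q) (fmul (finv q) q')" using cX X by (simp add: fmul_assoc)
  then have "inv\<^bsub>G\<^esub> (ev (P @ [y])) \<otimes>\<^bsub>G\<^esub> ev (P' @ [y']) \<in> lev A"
    using inv_mult_lev[OF inv_A, of "fmul c q" "fmul (finv q) q'" m m'] cX X w1(2) w2(2) m m' c1 c2 by simp
  moreover have "inv\<^bsub>G\<^esub> (ev (P @ [y])) \<otimes>\<^bsub>G\<^esub> ev (P' @ [y']) = el (inverse_letter y) \<otimes>\<^bsub>G\<^esub> ev W \<otimes>\<^bsub>G\<^esub> el y'"
    using PX W(2) ev_append[of P "[y]"] ev_append[of P' "[y']"]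
    by (simp add: ev_single el_inverse G.inv_mult_group G.m_assoc)
  ultimately have "W = [] \<and> y' = y"
    using cross[OF WA, of "inverse_letter y" y'] y y' by simp
  then show ?thesis
    using PX fmul_finv_cancel(1)[of P P'] by (simp add: W_def)
qed

lemma behind_map_fixes:
  assumes "P @ [y] @ Q \<in> words (A \<union> Z)" "fst y \<in> Z"
  shows "case_prod behind_map (wall P y) (ev (P @ [y] @ Q)) = ev (P @ [y] @ Q)"
  using normal_form[OF assms(1) refl assms(2)] by (simp add: behind_map_def split_beta)

text \<open>The point from which \<open>y\<close> is crossed is the gate at its height. It lies in
  the retract, like everything behind the wall, yet is within one power of \<open>t\<close> of
  \<open>ev P\<close>.\<close>

lemma gate_fixes:
  assumes P: "P @ [y] \<in> words (A \<union> Z)" and y: "fst y \<in> Z"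
  shows "case_prod behind_map (wall P y) (ev P \<otimes>\<^bsub>G\<^esub> ([], sh y)) = ev P \<otimes>\<^bsub>G\<^esub> ([], sh y)"
proof -
  have PX: "P \<in> words X" "P @ [y] \<in> words X" "fst y \<in> X" using words_AZ_X P snoc_wordsD(1) y Z_X by blast+
  obtain f n where fn: "ev P = (f, n)" by (cases "ev P")
  have fX: "f \<in> words X" using ev_closed[OF PX(1)] fn by simp
  obtain p q l where *: "p \<in> words A" "q \<in> words A" "fst l \<in> Z"
    "Th (n + sh y) [y] = fmul (fmul p [l]) q" "wall P y = (fmul f p, l)"
    using wallE[OF y fn] by metis
  have pX: "p \<in> words X" by (rule words_A_X[OF *(1)])
  obtain m where m: "ev (P @ [y]) = (fmul f (Th (n + sh y) [y]), m)"
    using mult_el[OF y fX, of n] fn ev_append[of P "[y]"] PX by (auto simp: ev_single)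
  have b: "prefix (fmul f p @ [l]) (fmul f (Th (n + sh y) [y]))"
    using normal_form[OF P, of P y "[]"] y * m by simp
  have nb: "\<not> prefix (fmul f p @ [l]) f"
    using prefix_fmul_iff[OF fX *(1,3), of "fmul f p"] by (auto simp: prefix_def)
  have "gate (fmul f p) l (n + sh y) = (f, n + sh y)"
    by (rule crossing_gate[symmetric, OF fX _ *(3) y nb b]) (use fX pX in simp)
  then show ?thesis using * fn fX nb by (simp add: behind_map_def)
qed

end


section \<open>Adding a layer of stable letters\<close>

context malnormal_step
begin

lemma behind_map_lev:
  assumes "c \<in> words (A \<union> Z)" "fst y \<in> Z" "g \<in> lev (A \<union> Z)"
  shows "behind_map c y g \<in> lev (A \<union> Z)"
  using assms gate_factor(1)[of y "snd g"] words_AZ_mono by (auto simp: behind_map_def gate_def)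

text \<open>Either \<open>c @ [y]\<close> is a prefix of the free part of \<open>b\<close>, or
  \<open>b\<close> is the gate at its height, and then \<open>c\<close> can be recovered from
  \<open>b\<close> and \<open>y\<close>.\<close>

lemma finite_behind_maps_fixing:
  assumes "b \<in> lev (A \<union> Z)"
  shows "finite {(c, y). c @ [y] \<in> words (A \<union> Z) \<and> fst y \<in> Z \<and> behind_map c y b = b}" (is "finite ?W")
proof -
  obtain f n where b: "b = (f, n)" by (cases b)
  let ?E1 = "(\<lambda>p. (butlast p, last p)) ` set (prefixes f)"
  let ?E2 = "(\<lambda>y. (fmul f (finv (Th n (pre (Th (- n) [y])))), y)) ` (Z \<times> UNIV)"
  have "finite (?E1 \<union> ?E2)"
    using finite_X Z_X finite_subset by (intro finite_UnI finite_imageI finite_cartesian_product) auto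
  moreover have "?W \<subseteq> ?E1 \<union> ?E2"
  proof clarify
    fix c y1 y2 assume cy: "c @ [(y1, y2)] \<in> words (A \<union> Z)" and y: "fst (y1, y2) \<in> Z"
      and fx: "behind_map c (y1, y2) b = b" and nE2: "(c, y1, y2) \<notin> ?E2"
    define y where "y = (y1, y2)"
    have c: "c \<in> words X" using snoc_wordsD(1)[OF cy] words_AZ_X by blast
    show "(c, y1, y2) \<in> ?E1"
    proof (cases "prefix (c @ [y]) f")
      case True
      then show ?thesis by (intro image_eqI[of _ _ "c @ [y]"]) (auto simp: y_def in_set_prefixes)
    next
      case False
      then have "gate c y n = (f, n)" using fx b by (simp add: behind_map_def y_def)
      then have "f = fmul c (Th n (pre (Th (- n) [y])))" by (simp add: gate_def)
      moreover have "Th n (pre (Th (- n) [y])) \<in> words X"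
        using gate_factor(1)[of y n] words_A_X y by (simp add: y_def)
      ultimately have "c = fmul f (finv (Th n (pre (Th (- n) [y]))))" using c by (simp add: fmul_assoc)
      then have "(c, y1, y2) \<in> ?E2" using y by (intro image_eqI[of _ _ y]) (auto simp: y_def)
      then show ?thesis using nE2 by blast
    qed
  qed
  ultimately show ?thesis by (rule finite_subset[rotated])
qed

text \<open>If the product of two points in the retract of a wall is below \<open>M\<close>,
  quasiconvexity puts a point of that retract into the ball of radius \<open>M + K\<close>. Only
  finitely many walls have such a point, and \<open>wall_inj\<close> turns this into a bound on the
  length of \<open>P\<close>.\<close>

lemma deep_walls:
  assumes hyp: "hyperbolic_word_metric G S \<delta>" and retr: "retract (A \<union> Z)"
  shows "\<exists>N. \<forall>P y u v. P @ [y] \<in> words (A \<union> Z) \<longrightarrow> fst y \<in> Z \<longrightarrow> N \<le> length P \<longrightarrow>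
    u \<in> lev (A \<union> Z) \<longrightarrow> v \<in> lev (A \<union> Z) \<longrightarrow> case_prod behind_map (wall P y) u = u \<longrightarrow>
    case_prod behind_map (wall P y) v = v \<longrightarrow> M \<le> gromov_product G S \<one>\<^bsub>G\<^esub> u v"
proof -
  interpret H: hyperbolic_word_metric G S \<delta> by fact
  let ?B = "A \<union> Z"
  have levG: "lev ?B \<subseteq> carrier G" by (rule subgroup.subset[OF subgroup_lev[OF invariant_AZ]])
  obtain r where r: "controlled G (carrier G) {r}" "\<And>g. g \<in> carrier G \<Longrightarrow> r g \<in> lev ?B"
    "\<And>g. g \<in> lev ?B \<Longrightarrow> r g = g" using retr unfolding retract_def by blast
  let ?R0 = "{behind_map c y | c y. c @ [y] \<in> words ?B \<and> fst y \<in> Z}"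
  let ?R = "{\<rho>' \<circ> \<rho> | \<rho>' \<rho>. \<rho>' \<in> ?R0 \<and> \<rho> \<in> {r}}"
  have R: "controlled G (carrier G) ?R"
    by (rule G.controlled_comp[OF r(1) _ subgroup_lev[OF invariant_AZ] _ _ controlled_behind_map])
       (use r in auto)
  have bl: "behind_map c y g \<in> lev ?B" "behind_map c y (behind_map c y g) = behind_map c y g"
    if "c @ [y] \<in> words ?B" "fst y \<in> Z" "g \<in> lev ?B" for c y g
    using behind_map_lev[of c y g] behind_map_idem[of c y g] snoc_wordsD(1)[OF that(1)] words_AZ_X that by auto
  have idem: "\<rho> (\<rho> g) = \<rho> g" if rg: "\<rho> \<in> ?R" "g \<in> carrier G" for \<rho> g
  proof -
    obtain c y where cy: "\<rho> = behind_map c y \<circ> r" "c @ [y] \<in> words ?B" "fst y \<in> Z" using rg(1) by blast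
    show ?thesis using bl[OF cy(2,3) r(2)[OF rg(2)]] r(3) cy(1) by simp
  qed
  obtain K where K: "\<And>\<rho> u v p. \<rho> \<in> ?R \<Longrightarrow> u \<in> carrier G \<Longrightarrow> v \<in> carrier G \<Longrightarrow> p \<in> carrier G \<Longrightarrow> \<rho> u = u \<Longrightarrow> \<rho> v = v \<Longrightarrow>
    \<exists>b\<in>carrier G. \<rho> b = b \<and> H.dis p b \<le> H.gp p u v + K"
    using H.controlled_retractions_quasiconvex[OF R idem] by blast
  define Ball where "Ball = {b \<in> lev ?B. H.len b \<le> nat \<lceil>M + K\<rceil>}"
  have "finite Ball"
    by (rule finite_subset[OF _ H.finite_ball[of "nat \<lceil>M + K\<rceil>"]]) (use levG in \<open>auto simp: Ball_def\<close>)
  define bad where "bad = (\<Union>b\<in>Ball. {(c, y). c @ [y] \<in> words ?B \<and> fst y \<in> Z \<and> behind_map c y b = b})"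
  have "finite bad" unfolding bad_def using \<open>finite Ball\<close> finite_behind_maps_fixing
    by (intro finite_UN_I) (auto simp: Ball_def)
  define D where "D = {(P, y). P @ [y] \<in> words ?B \<and> fst y \<in> Z}"
  have "inj_on (case_prod wall) D"
  proof (rule inj_onI)
    fix a b assume "a \<in> D" "b \<in> D" "case_prod wall a = case_prod wall b"
    then show "a = b" using wall_inj[of "fst a" "snd a" "fst b" "snd b"]
      by (simp add: D_def split_beta prod_eq_iff)
  qed
  then have fin: "finite {x \<in> D. case_prod wall x \<in> bad}"
    using finite_vimage_IntI[OF \<open>finite bad\<close>, of "case_prod wall" D] by (simp add: vimage_def Int_def conj_commute)
  \<comment> \<open>The inserted 0 keeps the maximum defined when there is no bad wall.\<close>
  define N where "N = Suc (Max (insert 0 ((\<lambda>x. length (fst x)) ` {x \<in> D. case_prod wall x \<in> bad})))"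
  have "M \<le> H.gp \<one>\<^bsub>G\<^esub> u v"
    if P: "P @ [y] \<in> words ?B" "fst y \<in> Z" "N \<le> length P" and uv: "u \<in> lev ?B" "v \<in> lev ?B"
      "case_prod behind_map (wall P y) u = u" "case_prod behind_map (wall P y) v = v" for P y u v
  proof (rule ccontr)
    assume less: "\<not> ?thesis"
    obtain c y' where w: "wall P y = (c, y')" by (cases "wall P y")
    have cy: "c @ [y'] \<in> words ?B" "fst y' \<in> Z" using wall_words[OF P(1,2)] w by auto
    have rR: "behind_map c y' \<circ> r \<in> ?R" using cy by blast
    obtain b where b: "b \<in> carrier G" "behind_map c y' (r b) = b" "H.dis \<one>\<^bsub>G\<^esub> b \<le> H.gp \<one>\<^bsub>G\<^esub> u v + K"
    proof -
      have "u \<in> carrier G" "v \<in> carrier G" using uv(1,2) levG by blast+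
      then show thesis using K[OF rR, of u v "\<one>\<^bsub>G\<^esub>"] uv w r(3) that by auto
    qed
    have bB: "b \<in> lev ?B" "behind_map c y' b = b"
      using bl[OF cy r(2)[OF b(1)]] b(2) by auto
    have "real (H.len b) \<le> M + K" using b less H.dis_one(1)[OF b(1)] by simp
    then have "b \<in> Ball" using bB by (simp add: Ball_def) linarith
    then have "(c, y') \<in> bad" using bB cy unfolding bad_def by auto
    then have "(P, y) \<in> {x \<in> D. case_prod wall x \<in> bad}" using P w by (auto simp: D_def)
    then have "length P \<in> (\<lambda>x. length (fst x)) ` {x \<in> D. case_prod wall x \<in> bad}" by force
    then have "length P < N" unfolding N_def using fin by (intro le_imp_less_Suc Max_ge) auto
    then show False using P(3) by simp
  qed
  then show ?thesis by blast
qed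

text \<open>If the common prefix has a stable letter late enough, both words lie behind the same
  deep wall. Otherwise, after a bounded translation, the common prefix is a long word over
  \<open>A\<close>. Each of the two words is then compared with a word over \<open>A\<close> that
  has the same prefix, to which the assumption for \<open>A\<close> applies.\<close>

lemma cannon_thurston_step:
  assumes hyp: "hyperbolic_word_metric G S \<delta>" and retr: "retract (A \<union> Z)"
    and CT: "cannon_thurston_at S A"
  shows "cannon_thurston_at S (A \<union> Z)"
  unfolding cannon_thurston_at_def
proof
  interpret H: hyperbolic_word_metric G S \<delta> by fact
  let ?B = "A \<union> Z"
  have levG: "lev ?B \<subseteq> carrier G" by (rule subgroup.subset[OF subgroup_lev[OF invariant_AZ]])
  have evB: "ev w \<in> lev ?B" "ev w \<in> carrier G" if "w \<in> words ?B" for w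
    using ev_lev[OF invariant_AZ that] levG by auto
  fix M
  let ?deep = "\<lambda>M N. \<forall>P y u v. P @ [y] \<in> words ?B \<longrightarrow> fst y \<in> Z \<longrightarrow> N \<le> length P \<longrightarrow>
    u \<in> lev ?B \<longrightarrow> v \<in> lev ?B \<longrightarrow> case_prod behind_map (wall P y) u = u \<longrightarrow>
    case_prod behind_map (wall P y) v = v \<longrightarrow> M \<le> H.gp \<one>\<^bsub>G\<^esub> u v"
  obtain N1 where N1: "?deep M N1" using deep_walls[OF hyp retr, of M] by blast
  have "finite {Q \<in> words ?B. length Q \<le> N1}"
  proof (rule finite_subset)
    show "{Q \<in> words ?B. length Q \<le> N1} \<subseteq> {Q. set Q \<subseteq> X \<times> UNIV \<and> length Q \<le> N1}"
    proof
      fix Q assume "Q \<in> {Q \<in> words ?B. length Q \<le> N1}"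
      then have "Q \<in> words X" "length Q \<le> N1" using words_AZ_X by blast+
      then show "Q \<in> {Q. set Q \<subseteq> X \<times> UNIV \<and> length Q \<le> N1}" by (simp add: words_iff)
    qed
    show "finite {Q :: ('a \<times> bool) list. set Q \<subseteq> X \<times> UNIV \<and> length Q \<le> N1}"
      using finite_X by (intro finite_lists_length_le finite_cartesian_product) auto
  qed
  then obtain L where L: "\<And>Q. Q \<in> words ?B \<Longrightarrow> length Q \<le> N1 \<Longrightarrow> real (H.len (ev Q)) \<le> L"
    using H.finite_len_bound[of "ev ` {Q \<in> words ?B. length Q \<le> N1}"] by auto
  define l where "l = real (H.len \<tau>) + \<delta>"
  have shl: "real (H.len ([], sh y)) \<le> l" "([], sh y) \<in> carrier G" for y
  proof -
    have "([], - 1) = inv\<^bsub>G\<^esub> \<tau>" by (simp add: \<tau>_def inv_G)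
    then show "real (H.len ([], sh y)) \<le> l"
      using H.len_inv[of \<tau>] H.len_one H.delta_ge_1 by (auto simp: sh_def l_def one_G[symmetric])
  qed simp
  \<comment> \<open>The losses ahead: \<open>l\<close> from a gate to the nearby word over
    \<open>A\<close>, \<open>2 * \<delta>\<close> for passing through two intermediate points, and
    \<open>L\<close> for translating by \<open>ev Q\<close>.\<close>
  define M' where "M' = M + L + l + 2 * \<delta>"
  obtain N2 where N2: "?deep M' N2" using deep_walls[OF hyp retr, of M'] by blast
  obtain N3 where N3: "\<And>P U V. P @ U \<in> words A \<Longrightarrow> P @ V \<in> words A \<Longrightarrow> N3 \<le> length P \<Longrightarrow>
     M' \<le> H.gp \<one>\<^bsub>G\<^esub> (ev (P @ U)) (ev (P @ V))" using CT unfolding cannon_thurston_at_def by metis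
  \<comment> \<open>Cut \<open>\<pi> @ U\<close> just before its first stable letter
    \<open>y\<close>. The whole element and the gate in front of \<open>y\<close> belong to the
    retract of one deep wall, and that gate is within \<open>l\<close> of the part \<open>c\<close>
    that was kept.\<close>
  have head: "\<exists>m. \<pi> @ m \<in> words A \<and> M' - l \<le> H.gp \<one>\<^bsub>G\<^esub> (ev (\<pi> @ U)) (ev (\<pi> @ m))"
    if W: "\<pi> @ U \<in> words ?B" and \<pi>: "\<pi> \<in> words A" "max N2 N3 \<le> length \<pi>" for \<pi> U
  proof (cases "\<pi> @ U \<in> words A")
    case True
    have "0 \<le> l" using H.delta_ge_1 by (simp add: l_def)
    then show ?thesis using N3[of \<pi> U U] True \<pi>(2) by (intro exI[of _ U]) auto
  next
    case False
    obtain c y where cy: "c \<in> words A" "fst y \<in> Z" "prefix (c @ [y]) (\<pi> @ U)"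
      using first_Z_letter[OF W False] by blast
    have "\<not> prefix (c @ [y]) \<pi>" using fold_map_behind(2)[OF cy(1,2)] \<pi>(1) by blast
    moreover have "prefix \<pi> (c @ [y]) \<or> prefix (c @ [y]) \<pi>"
      by (rule prefix_same_cases[OF _ cy(3)]) simp
    ultimately have "prefix \<pi> c" by (auto simp: prefix_snoc)
    then obtain m where m: "c = \<pi> @ m" by (auto simp: prefix_def)
    obtain Q where Q: "\<pi> @ U = c @ [y] @ Q" using cy(3) by (auto simp: prefix_def)
    have W': "c @ [y] @ Q \<in> words ?B" "c @ [y] \<in> words ?B" "c \<in> words ?B"
      using W Q words_appendD[of "c @ [y]" Q] words_appendD[of c "[y]"] by auto
    have g: "ev c \<otimes>\<^bsub>G\<^esub> ([], sh y) \<in> lev ?B"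
      by (rule subgroup.m_closed[OF subgroup_lev[OF invariant_AZ] evB(1)[OF W'(3)]]) simp
    have len: "N2 \<le> length c" using \<pi>(2) m by simp
    have "M' \<le> H.gp \<one>\<^bsub>G\<^esub> (ev (c @ [y] @ Q)) (ev c \<otimes>\<^bsub>G\<^esub> ([], sh y))"
      using N2 W'(2) cy(2) len evB(1)[OF W'(1)] g behind_map_fixes[OF W'(1) cy(2)] gate_fixes[OF W'(2) cy(2)]
      by blast
    moreover have "H.gp \<one>\<^bsub>G\<^esub> (ev (c @ [y] @ Q)) (ev c \<otimes>\<^bsub>G\<^esub> ([], sh y)) - H.dis (ev c \<otimes>\<^bsub>G\<^esub> ([], sh y)) (ev c)
        \<le> H.gp \<one>\<^bsub>G\<^esub> (ev (c @ [y] @ Q)) (ev c)"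
      by (rule H.gp_Lipschitz) (use evB[OF W'(1)] evB[OF W'(3)] g levG in auto)
    moreover have "H.dis (ev c \<otimes>\<^bsub>G\<^esub> ([], sh y)) (ev c) \<le> l"
      using H.dis_mult_right[OF evB(2)[OF W'(3)] shl(2)] shl(1) g levG evB[OF W'(3)]
        H.dis_commute[of "ev c \<otimes>\<^bsub>G\<^esub> ([], sh y)" "ev c"] by (auto simp: subset_iff)
    ultimately show ?thesis using Q m cy(1) by (intro exI[of _ m]) auto
  qed
  have main: "M \<le> H.gp \<one>\<^bsub>G\<^esub> (ev (P @ U)) (ev (P @ V))"
    if PU: "P @ U \<in> words ?B" and PV: "P @ V \<in> words ?B" and len: "N1 + max N2 N3 \<le> length P" for P U V
  proof (cases "\<exists>P1 y P2. P = P1 @ [y] @ P2 \<and> fst y \<in> Z \<and> N1 \<le> length P1")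
    case True
    then obtain P1 y P2 where P: "P = P1 @ [y] @ P2" "fst y \<in> Z" "N1 \<le> length P1" by blast
    have "P1 @ [y] \<in> words ?B" using PU P(1) words_appendD[of "P1 @ [y]" "P2 @ U"] by auto
    moreover have "P @ U = P1 @ [y] @ (P2 @ U)" "P @ V = P1 @ [y] @ (P2 @ V)" using P by simp_all
    ultimately show ?thesis
      using N1 P(2,3) PU PV evB(1)[OF PU] evB(1)[OF PV] behind_map_fixes by metis
  next
    case False
    \<comment> \<open>All stable letters of \<open>P\<close> are among its first \<open>N1\<close>
      letters, so the rest is a word over \<open>A\<close>, and \<open>ev Q\<close> takes finitely
      many values.\<close>
    define Q where "Q = take N1 P"
    define \<pi> where "\<pi> = drop N1 P"
    have P: "P = Q @ \<pi>" by (simp add: Q_def \<pi>_def)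
    have Qlen: "length Q = N1" using len by (simp add: Q_def)
    have \<pi>len: "max N2 N3 \<le> length \<pi>" using len unfolding \<pi>_def length_drop by linarith
    have PB: "P \<in> words ?B" using words_appendD[OF PU] by blast
    have QB: "Q \<in> words ?B" "\<pi> \<in> words ?B" using PB words_appendD P by blast+
    have "fst x \<in> A" if x: "x \<in> set \<pi>" for x
    proof -
      obtain \<pi>1 \<pi>2 where "\<pi> = \<pi>1 @ x # \<pi>2" using split_list[OF x] by blast
      then have "P = (Q @ \<pi>1) @ [x] @ \<pi>2" using P by simp
      then have "fst x \<notin> Z" using False Qlen by (metis le_add1 length_append)
      then show ?thesis using QB(2) x by (auto simp: words_iff_Ball)
    qed
    then have \<pi>A: "\<pi> \<in> words A" using QB(2) by (auto simp: words_iff_Ball)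
    have W: "\<pi> @ U \<in> words ?B" "\<pi> @ V \<in> words ?B"
      using PU PV words_appendD[of Q] P by auto
    obtain m where m: "\<pi> @ m \<in> words A" "M' - l \<le> H.gp \<one>\<^bsub>G\<^esub> (ev (\<pi> @ U)) (ev (\<pi> @ m))"
      using head[OF W(1) \<pi>A \<pi>len] by blast
    obtain m' where m': "\<pi> @ m' \<in> words A" "M' - l \<le> H.gp \<one>\<^bsub>G\<^esub> (ev (\<pi> @ V)) (ev (\<pi> @ m'))"
      using head[OF W(2) \<pi>A \<pi>len] by blast
    have mm: "M' \<le> H.gp \<one>\<^bsub>G\<^esub> (ev (\<pi> @ m)) (ev (\<pi> @ m'))" using N3 m(1) m'(1) \<pi>len by simp
    have c: "ev (\<pi> @ U) \<in> carrier G" "ev (\<pi> @ V) \<in> carrier G" "ev (\<pi> @ m) \<in> carrier G" "ev (\<pi> @ m') \<in> carrier G"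
      "ev Q \<in> carrier G"
      using evB(2) W QB m(1) m'(1) words_AZ_mono by auto
    have "H.gp \<one>\<^bsub>G\<^esub> (ev (\<pi> @ m')) (ev (\<pi> @ V)) = H.gp \<one>\<^bsub>G\<^esub> (ev (\<pi> @ V)) (ev (\<pi> @ m'))"
      using c H.gp_commute by simp
    moreover have "min (H.gp \<one>\<^bsub>G\<^esub> (ev (\<pi> @ U)) (ev (\<pi> @ m))) (H.gp \<one>\<^bsub>G\<^esub> (ev (\<pi> @ m)) (ev (\<pi> @ m'))) - \<delta>
        \<le> H.gp \<one>\<^bsub>G\<^esub> (ev (\<pi> @ U)) (ev (\<pi> @ m'))"
      "min (H.gp \<one>\<^bsub>G\<^esub> (ev (\<pi> @ U)) (ev (\<pi> @ m'))) (H.gp \<one>\<^bsub>G\<^esub> (ev (\<pi> @ m')) (ev (\<pi> @ V))) - \<delta>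
        \<le> H.gp \<one>\<^bsub>G\<^esub> (ev (\<pi> @ U)) (ev (\<pi> @ V))"
      using H.gp_min c by auto
    moreover have "0 \<le> l" using H.delta_ge_1 by (simp add: l_def)
    ultimately have g: "M + L \<le> H.gp \<one>\<^bsub>G\<^esub> (ev (\<pi> @ U)) (ev (\<pi> @ V))"
      using m(2) m'(2) mm H.delta_ge_1 unfolding M'_def by linarith
    have "H.gp (ev Q) (ev Q \<otimes>\<^bsub>G\<^esub> ev (\<pi> @ U)) (ev Q \<otimes>\<^bsub>G\<^esub> ev (\<pi> @ V)) = H.gp \<one>\<^bsub>G\<^esub> (ev (\<pi> @ U)) (ev (\<pi> @ V))"
      using H.gp_translate[of "\<one>\<^bsub>G\<^esub>" "ev (\<pi> @ U)" "ev (\<pi> @ V)" "ev Q"] c by simp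
    moreover have "ev (P @ U) = ev Q \<otimes>\<^bsub>G\<^esub> ev (\<pi> @ U)" "ev (P @ V) = ev Q \<otimes>\<^bsub>G\<^esub> ev (\<pi> @ V)"
      using ev_append[of Q "\<pi> @ U"] ev_append[of Q "\<pi> @ V"] words_AZ_X[OF PU] words_AZ_X[OF PV] P by simp_all
    moreover have "H.gp (ev Q) (ev (P @ U)) (ev (P @ V)) - H.dis (ev Q) \<one>\<^bsub>G\<^esub> \<le> H.gp \<one>\<^bsub>G\<^esub> (ev (P @ U)) (ev (P @ V))"
      by (rule H.gp_base) (use c evB(2) PU PV in auto)
    moreover have "H.dis (ev Q) \<one>\<^bsub>G\<^esub> \<le> L" using L[OF QB(1)] Qlen H.dis_one(2)[OF c(5)] by simp
    ultimately show ?thesis using g by simp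
  qed
  then show "\<exists>N. \<forall>P U V. P @ U \<in> words ?B \<longrightarrow> P @ V \<in> words ?B \<longrightarrow> N \<le> length P \<longrightarrow>
     M \<le> H.gp \<one>\<^bsub>G\<^esub> (ev (P @ U)) (ev (P @ V))" by blast
qed

end


section \<open>The ladder over a normal free subgroup\<close>

lemma lcp_commute: "lcp u v = lcp v u"
  by (induction u v rule: longest_common_prefix.induct) auto

lemma lcp_absorb: "prefix u v \<Longrightarrow> lcp v u = u"
  by (induction v u rule: longest_common_prefix.induct) auto

lemma lcp_ultrametric: "min (length (lcp a b)) (length (lcp a c)) \<le> length (lcp b c)"
proof (induction a b arbitrary: c rule: longest_common_prefix.induct)
  case (1 x xs y ys)
  then show ?case by (cases c) auto
qed auto

lemma lcp_snoc: "lcp w (q @ [x]) = lcp w q \<or> lcp w (q @ [x]) = lcp w q @ [x]"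
proof (induction w arbitrary: q)
  case (Cons y w)
  then show ?case by (cases q) auto
qed simp

text \<open>In the Cayley tree, the point closest to the identity on the geodesic from
  \<open>u\<close> to \<open>v\<close> is their branch point \<open>lcp u v\<close>.\<close>

lemma length_geodesic_point:
  assumes "reduced u" "reduced v" "fmul (finv u) v = w1 @ w2"
  shows "length (lcp u v) \<le> length (fmul u w1)"
proof -
  define s where "s = fmul u w1"
  have sred: "reduced s" by (simp add: s_def)
  have r: "reduced (w1 @ w2)" using assms(3) fmul_reduced by metis
  then have r12: "reduced w1" "reduced w2" by (auto simp: reduced_append)
  have "fmul (finv u) s = w1" unfolding s_def using assms(1) r12 by simp
  moreover have "fmul s w2 = v"
  proof -
    have "fmul s w2 = fmul u (fmul w1 w2)" unfolding s_def using assms(1) r12 by (simp add: fmul_assoc)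
    also have "fmul w1 w2 = fmul (finv u) v" using fmul_append[OF r] assms(3) by simp
    also have "fmul u (fmul (finv u) v) = v" by (rule fmul_finv_cancel(1)[OF assms(1,2)])
    finally show ?thesis .
  qed
  then have "fmul (finv s) v = w2" using r12 s_def by auto
  ultimately have "length (fmul (finv u) s) + length (fmul (finv s) v) = length (fmul (finv u) v)"
    using assms(3) by simp
  moreover have "length (fmul (finv u) s) + 2 * length (lcp u s) = length u + length s"
    "length (fmul (finv s) v) + 2 * length (lcp s v) = length s + length v"
    "length (fmul (finv u) v) + 2 * length (lcp u v) = length u + length v"
    using length_fmul_finv[OF assms(1) sred] length_fmul_finv[OF sred assms(2)]
      length_fmul_finv[OF assms(1,2)] by simp_all
  moreover have "length (lcp u s) \<le> length s" "length (lcp s v) \<le> length s"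
    by (simp_all add: longest_common_prefix_prefix1 longest_common_prefix_prefix2 prefix_length_le)
  ultimately show ?thesis unfolding s_def[symmetric] by linarith
qed

context free_by_cyclic
begin

section \<open>Powers of the automorphism acting on the Cayley tree\<close>

lemma Th_Lipschitz:
  obtains L where "\<And>w. w \<in> words X \<Longrightarrow> length (Th n w) \<le> L * length w"
    "\<And>w. w \<in> words X \<Longrightarrow> length (Th (- n) w) \<le> L * length w"
proof -
  define L where "L = Max (insert 0 ((\<lambda>x. length (Th n [x]) + length (Th (- n) [x])) ` (X \<times> UNIV)))"
  have L: "length (Th n [x]) + length (Th (- n) [x]) \<le> L" if "fst x \<in> X" for x
    unfolding L_def using that finite_X by (intro Max_ge) (auto simp: mem_Times_iff)
  have "length (Th n w) \<le> L * length w \<and> length (Th (- n) w) \<le> L * length w" if "w \<in> words X" for w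
    using that
  proof (induction rule: free_group_induct)
    case (Cons x w)
    have x: "[x] \<in> words X" using Cons.hyps by simp
    have "Th k (x # w) = fmul (Th k [x]) (Th k w)" for k
      using Th_fmul[OF x Cons.hyps(2)] Cons.hyps(4) by simp
    then have "length (Th k (x # w)) \<le> length (Th k [x]) + length (Th k w)" for k
      using length_fmul_le[of "Th k [x]" "Th k w"] x Cons.hyps by simp
    from this[of n] this[of "- n"] show ?case using L[OF Cons.hyps(1)] Cons.IH by auto
  qed simp
  then show thesis using that by blast
qed

lemma words_take: "w \<in> words B \<Longrightarrow> take i w \<in> words B"
  by (metis append_take_drop_id words_appendD)

text \<open>The images of the initial segments of \<open>w\<close> form a path with jumps at most
  \<open>L\<close> from the identity to \<open>Th n w\<close>, so \<open>path_near_prefix\<close>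
  applies.\<close>

lemma image_path_near:
  assumes w: "w \<in> words X" and z: "prefix z (Th n w)" and L: "\<And>w. w \<in> words X \<Longrightarrow> length (Th n w) \<le> L * length w"
  shows "\<exists>i. length (fmul (finv z) (Th n (take i w))) \<le> L"
proof -
  have "\<exists>i\<le>length w. length (fmul (finv z) (Th n (take i w))) \<le> L"
  proof (rule path_near_prefix)
    fix i assume i: "i < length w"
    have t: "take (Suc i) w = take i w @ [w ! i]" using i by (simp add: take_Suc_conv_app_nth)
    have X: "take i w \<in> words X" "take (Suc i) w \<in> words X" using words_take[OF w] by blast+
    have x: "[w ! i] \<in> words X" using X(2) t words_appendD[of "take i w" "[w ! i]"] by simp
    have "take (Suc i) w = fmul (take i w) [w ! i]" using fmul_append[of "take i w" "[w ! i]"] X(2) t by simp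
    then have "fmul (finv (Th n (take i w))) (Th n (take (Suc i) w)) = Th n [w ! i]"
      using X x by (simp add: Th_fmul)
    then show "length (fmul (finv (Th n (take i w))) (Th n (take (Suc i) w))) \<le> L" using L[OF x] by simp
  qed (use words_take[OF w] z in auto)
  then show ?thesis by blast
qed

text \<open>Cooper's bounded cancellation lemma. If the images share a long prefix \<open>z\<close>,
  prefixes \<open>p\<close> of \<open>x\<close> and \<open>q\<close> of \<open>y\<close> have images
  near \<open>z\<close>, hence near each other. Applying \<open>Th (- n)\<close> makes
  \<open>p\<close> and \<open>q\<close> themselves close; as nothing cancels between
  \<open>finv p\<close> and \<open>q\<close>, both are short, and so is \<open>z\<close>.\<close>

lemma bounded_cancellation:
  obtains C where "\<And>x y. x \<in> words X \<Longrightarrow> y \<in> words X \<Longrightarrow> x = [] \<or> y = [] \<or> hd x \<noteq> hd y \<Longrightarrow>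
    length (lcp (Th n x) (Th n y)) \<le> C"
proof -
  obtain L where L: "\<And>w. w \<in> words X \<Longrightarrow> length (Th n w) \<le> L * length w"
    "\<And>w. w \<in> words X \<Longrightarrow> length (Th (- n) w) \<le> L * length w"
    using Th_Lipschitz[of n] by blast
  show thesis
  proof (rule that[of "L * (L * (2 * L)) + L"])
    fix x y assume x: "x \<in> words X" and y: "y \<in> words X" and xy: "x = [] \<or> y = [] \<or> hd x \<noteq> hd y"
    define z where "z = lcp (Th n x) (Th n y)"
    have z: "prefix z (Th n x)" "prefix z (Th n y)"
      unfolding z_def by (simp_all add: longest_common_prefix_prefix1 longest_common_prefix_prefix2)
    have zr: "reduced z" using z(1) x by (metis Th_closed prefixE red_X reduced_append)
    obtain i j where i: "length (fmul (finv z) (Th n (take i x))) \<le> L"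
      and j: "length (fmul (finv z) (Th n (take j y))) \<le> L"
      using image_path_near[OF x z(1) L(1)] image_path_near[OF y z(2) L(1)] by blast
    define p q where "p = take i x" and "q = take j y"
    have pq: "p \<in> words X" "q \<in> words X" unfolding p_def q_def using words_take x y by blast+
    have hd: "p = [] \<or> q = [] \<or> hd p \<noteq> hd q" using xy by (auto simp: p_def q_def)
    have "fmul (finv (Th n p)) (Th n q) = fmul (finv (fmul (finv z) (Th n p))) (fmul (finv z) (Th n q))"
      using pq zr by (simp add: finv_fmul fmul_assoc)
    then have d: "length (fmul (finv (Th n p)) (Th n q)) \<le> 2 * L"
      using length_fmul_le[of "finv (fmul (finv z) (Th n p))" "fmul (finv z) (Th n q)"] i j
      by (simp add: p_def q_def)
    have "fmul (finv p) q = Th (- n) (fmul (finv (Th n p)) (Th n q))"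
      using pq by (simp add: Th_fmul Th_finv)
    then have "length (fmul (finv p) q) \<le> L * length (fmul (finv (Th n p)) (Th n q))"
      using L(2)[of "fmul (finv (Th n p)) (Th n q)"] pq by simp
    also have "\<dots> \<le> L * (2 * L)" using d by (rule mult_le_mono2)
    finally have "length (fmul (finv p) q) \<le> L * (2 * L)" .
    moreover have "fmul (finv p) q = finv p @ q"
      using fmul_finv_lcp(1)[of p q "[]" p q] pq hd by simp
    ultimately have "length p \<le> L * (2 * L)" by simp
    then have "length (Th n p) \<le> L * (L * (2 * L))"
      using L(1)[OF pq(1)] mult_le_mono2[of "length p" "L * (2 * L)" L] by linarith
    moreover have "z = fmul (Th n p) (finv (fmul (finv z) (Th n p)))"
      using pq zr by (simp add: finv_fmul)
    then have "length z \<le> length (Th n p) + length (fmul (finv z) (Th n p))"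
      using length_fmul_le[of "Th n p" "finv (fmul (finv z) (Th n p))"] pq by simp
    ultimately show "length (lcp (Th n x) (Th n y)) \<le> L * (L * (2 * L)) + L"
      using i unfolding z_def[symmetric] p_def by linarith
  qed
qed

text \<open>The automorphism coarsely preserves the centre of the tripod spanned by the identity,
  \<open>v\<close> and \<open>w\<close>. Bounded cancellation limits the overlap of each two of the
  three image legs issuing from the image of the centre, so the true centre is within
  \<open>C\<close> of it.\<close>

lemma Th_lcp:
  obtains C where "\<And>v w. v \<in> words X \<Longrightarrow> w \<in> words X \<Longrightarrow>
    length (fmul (finv (Th n (lcp v w))) (lcp (Th n v) (Th n w))) \<le> C"
proof -
  obtain C where C: "\<And>x y. x \<in> words X \<Longrightarrow> y \<in> words X \<Longrightarrow> x = [] \<or> y = [] \<or> hd x \<noteq> hd y \<Longrightarrow>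
    length (lcp (Th n x) (Th n y)) \<le> C" using bounded_cancellation[of n] by blast
  show thesis
  proof (rule that[of C])
    fix v w assume v: "v \<in> words X" and w: "w \<in> words X"
    obtain x y where xy: "v = lcp v w @ x" "w = lcp v w @ y" "x = [] \<or> y = [] \<or> hd x \<noteq> hd y"
      by (rule lcp_split)
    define p where "p = lcp v w"
    have vp: "v = p @ x" "w = p @ y" using xy by (simp_all add: p_def)
    have X: "p \<in> words X" "x \<in> words X" "y \<in> words X" using v w vp words_appendD by metis+
    define a b c where "a = Th n p" and "b = Th n v" and "c = Th n w"
    have abc: "reduced a" "reduced b" "reduced c" unfolding a_def b_def c_def using X v w by simp_all
    have bx: "fmul (finv a) b = Th n x" and cy: "fmul (finv a) c = Th n y"
      using fmul_append[of p x] fmul_append[of p y] Th_fmul[of p x n] Th_fmul[of p y n] X v w vp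
      by (simp_all add: a_def b_def c_def)
    have hdf: "finv p = [] \<or> z = [] \<or> hd (finv p) \<noteq> hd z" if "p @ z \<in> words X" for z
    proof (cases "p = []")
      case False
      then have "hd (finv p) = inverse_letter (last p)" by (simp add: finv_def hd_rev last_map)
      then show ?thesis using words_reduced[OF that] False by (auto simp: reduced_append)
    qed simp
    have fa: "finv a = Th n (finv p)" using X by (simp add: a_def Th_finv)
    \<comment> \<open>Seen from \<open>a\<close>, the three legs run to the identity, to
      \<open>b\<close> and to \<open>c\<close>; they are the images of \<open>finv p\<close>,
      \<open>x\<close> and \<open>y\<close>, which start with distinct letters or are empty.\<close>
    have 1: "length (lcp (finv a) (fmul (finv a) b)) \<le> C" "length (lcp (finv a) (fmul (finv a) c)) \<le> C"
      "length (lcp (fmul (finv a) b) (fmul (finv a) c)) \<le> C"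
      unfolding bx cy unfolding fa using C X hdf v w vp xy(3) by auto
    have 2: "length (fmul (finv (finv a)) (fmul (finv a) s)) + 2 * length (lcp (finv a) (fmul (finv a) s)) =
      length (finv a) + length (fmul (finv a) s)"
      "length (fmul (finv a) s) + 2 * length (lcp a s) = length a + length s"
      "fmul (finv (finv a)) (fmul (finv a) s) = s" if "reduced s" for s
      using length_fmul_finv[of "finv a" "fmul (finv a) s"] length_fmul_finv[of a s] abc that by simp_all
    have "fmul (finv (fmul (finv a) b)) (fmul (finv a) c) = fmul (finv b) c"
      using abc by (simp add: finv_fmul fmul_assoc)
    then have 3: "length (fmul (finv b) c) + 2 * length (lcp (fmul (finv a) b) (fmul (finv a) c)) =
      length (fmul (finv a) b) + length (fmul (finv a) c)"
      "length (fmul (finv b) c) + 2 * length (lcp b c) = length b + length c"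
      using length_fmul_finv[of "fmul (finv a) b" "fmul (finv a) c"] length_fmul_finv[of b c] abc by simp_all
    define m where "m = lcp b c"
    have mb: "prefix m b" "prefix m c" unfolding m_def
      by (simp_all add: longest_common_prefix_prefix1 longest_common_prefix_prefix2)
    have mr: "reduced m" using mb(1) abc(2) by (metis prefixE reduced_append)
    have m1: "min (length (lcp a b)) (length m) \<le> length (lcp a m)"
      using lcp_ultrametric[of b a m] lcp_absorb[OF mb(1)] lcp_commute[of a b] by simp
    have m2: "min (length (lcp a c)) (length m) \<le> length (lcp a m)"
      using lcp_ultrametric[of c a m] lcp_absorb[OF mb(2)] lcp_commute[of a c] by simp
    have m3: "min (length (lcp a b)) (length (lcp a c)) \<le> length m"
      unfolding m_def by (rule lcp_ultrametric)
    have m4: "length (fmul (finv a) m) + 2 * length (lcp a m) = length a + length m"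
      using 2(2)[OF mr] .
    have "length a \<le> C + length (lcp a b)" "length a \<le> C + length (lcp a c)"
      "length a + length m \<le> C + length (lcp a b) + length (lcp a c)"
      using 1 2[OF abc(2)] 2[OF abc(3)] 3 unfolding m_def by simp_all
    then have "length (fmul (finv a) m) \<le> C"
      using m1 m2 m3 m4 by (auto simp: min_def split: if_splits)
    then show "length (fmul (finv (Th n (lcp v w))) (lcp (Th n v) (Th n w))) \<le> C"
      by (simp add: a_def m_def b_def c_def p_def)
  qed
qed

text \<open>
  Writing the points of height \<open>n\<close> as \<open>u t\<^sup>n q\<close>, the ladder map replaces \<open>q\<close> by its projection to the
  geodesic from \<open>1\<close> to \<open>t\<^sup>-\<^sup>n w t\<^sup>n\<close>.
\<close>

definition ladder :: "('x \<times> bool) list \<Rightarrow> ('x \<times> bool) list \<Rightarrow> ('x \<times> bool) list \<times> int \<Rightarrow> ('x \<times> bool) list \<times> int" where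
  "ladder u w g = (fmul u (Th (snd g) (lcp (Th (- snd g) w) (Th (- snd g) (fmul (finv u) (fst g))))), snd g)"

lemma finite_words_length: "finite {w \<in> words X. length w \<le> n}"
proof (rule finite_subset)
  show "{w \<in> words X. length w \<le> n} \<subseteq> {w. set w \<subseteq> X \<times> UNIV \<and> length w \<le> n}"
    by (auto simp: words_iff)
  show "finite {w :: ('x \<times> bool) list. set w \<subseteq> X \<times> UNIV \<and> length w \<le> n}"
    using finite_X by (intro finite_lists_length_le finite_cartesian_product) auto
qed

lemma words_lcp: "v \<in> words B \<Longrightarrow> lcp v w \<in> words B"
  by (metis longest_common_prefix_prefix1 prefixE words_appendD)

lemma ladder_idem:
  assumes "u \<in> words X" "w \<in> words X" "g \<in> carrier G"
  shows "ladder u w (ladder u w g) = ladder u w g"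
proof -
  define p where "p = lcp (Th (- snd g) w) (Th (- snd g) (fmul (finv u) (fst g)))"
  have p: "p \<in> words X" unfolding p_def using assms by (intro words_lcp) simp
  have "prefix p (Th (- snd g) w)" unfolding p_def by (rule longest_common_prefix_prefix1)
  then have "lcp (Th (- snd g) w) p = p" by (rule lcp_absorb)
  then show ?thesis using assms p by (simp add: ladder_def p_def[symmetric])
qed

lemma ladder_lev:
  assumes "invariant A" "u \<in> words A" "w \<in> words A" "g \<in> lev A"
  shows "ladder u w g \<in> lev A"
proof -
  obtain f n where g: "g = (f, n)" by (cases g)
  have "lcp (Th (- n) w) (Th (- n) (fmul (finv u) f)) \<in> words A"
    using assms by (intro words_lcp) (simp add: invariant_def)
  then show ?thesis using assms g by (simp add: ladder_def invariant_def)
qed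

text \<open>A horizontal move changes the projected word by one letter, so its common prefix with
  the rung changes by at most that letter. A vertical move applies \<open>Th (- 1)\<close> to the
  rung and to the point, and \<open>Th_lcp\<close> compares the two projections. Neither bound
  depends on \<open>u\<close> or \<open>w\<close>.\<close>

lemma controlled_ladder:
  assumes A: "invariant A"
  shows "controlled G (lev A) {ladder u w | u w. u \<in> words A \<and> w \<in> words A}" (is "controlled G _ ?R")
proof (rule controlled_lev[OF A])
  have AX: "A \<subseteq> X" using A by (simp add: invariant_def)
  have wX: "w \<in> words X" if "w \<in> words A" for w using words_mono[OF AX that] .
  have levG: "lev A \<subseteq> carrier G" by (rule subgroup.subset[OF subgroup_lev[OF A]])
  show "\<rho> (f, n) \<in> carrier G" if "\<rho> \<in> ?R" "f \<in> words A" for \<rho> f n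
    using that ladder_lev[OF A, of _ _ "(f, n)"] levG by auto
  have step: "inv\<^bsub>G\<^esub> (fmul u (Th n p), n) \<otimes>\<^bsub>G\<^esub> (fmul u (Th m p'), m) = (fmul (finv p) (Th (m - n) p'), m - n)"
    if "u \<in> words X" "p \<in> words X" "p' \<in> words X" for u p p' n m
    using that Th_add[of p' "- n" m] by (simp add: inv_G Th_fmul Th_finv finv_fmul fmul_assoc)
  obtain C where C: "\<And>v w. v \<in> words X \<Longrightarrow> w \<in> words X \<Longrightarrow>
    length (fmul (finv (Th (- 1) (lcp v w))) (lcp (Th (- 1) v) (Th (- 1) w))) \<le> C"
    using Th_lcp[of "- 1"] by blast
  let ?E = "(\<lambda>w. (Th 1 w, 1 :: int)) ` {w \<in> words X. length w \<le> C}"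
  have "inv\<^bsub>G\<^esub> (\<rho> (f, n)) \<otimes>\<^bsub>G\<^esub> \<rho> (f, n + 1) \<in> ?E" if r: "\<rho> \<in> ?R" and f: "f \<in> words A" for \<rho> f n
  proof -
    obtain u w where uw: "\<rho> = ladder u w" "u \<in> words X" "w \<in> words X" using r wX by blast
    define W q where "W = Th (- n) w" and "q = Th (- n) (fmul (finv u) f)"
    have X: "W \<in> words X" "q \<in> words X" using uw wX[OF f] by (simp_all add: W_def q_def)
    have W': "Th (- n - 1) w = Th (- 1) W" "Th (- n - 1) (fmul (finv u) f) = Th (- 1) q"
    proof -
      have "- n - 1 = - 1 + - n" by simp
      then show "Th (- n - 1) w = Th (- 1) W" "Th (- n - 1) (fmul (finv u) f) = Th (- 1) q"
        unfolding W_def q_def using Th_add uw(2,3) wX[OF f] by (metis words_fmul words_finv)+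
    qed
    have lX: "lcp W q \<in> words X" "lcp (Th (- 1) W) (Th (- 1) q) \<in> words X"
      using words_lcp[of W X q] words_lcp[of "Th (- 1) W" X] X by simp_all
    have "inv\<^bsub>G\<^esub> (\<rho> (f, n)) \<otimes>\<^bsub>G\<^esub> \<rho> (f, n + 1) = (fmul (finv (lcp W q)) (Th 1 (lcp (Th (- 1) W) (Th (- 1) q))), 1)"
      using step[OF uw(2) lX, of n "n + 1"] W' by (simp add: uw(1) ladder_def W_def q_def)
    also have "fmul (finv (lcp W q)) (Th 1 (lcp (Th (- 1) W) (Th (- 1) q))) =
        Th 1 (fmul (finv (Th (- 1) (lcp W q))) (lcp (Th (- 1) W) (Th (- 1) q)))"
      using lX by (simp add: Th_fmul Th_finv)
    finally show ?thesis using C[OF X] lX by auto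
  qed
  then show "\<exists>E. finite E \<and> E \<subseteq> carrier G \<and> (\<forall>\<rho>\<in>?R. \<forall>f\<in>words A. \<forall>n. inv\<^bsub>G\<^esub> (\<rho> (f, n)) \<otimes>\<^bsub>G\<^esub> \<rho> (f, n + 1) \<in> E)"
    using finite_words_length[of C] by (intro exI[of _ ?E]) auto
  fix x assume x: "x \<in> A"
  then have xX: "[(x, True)] \<in> words X" "[(x, False)] \<in> words X" using AX by auto
  let ?E = "{([(x, True)], 0 :: int), \<one>\<^bsub>G\<^esub>}"
  have "inv\<^bsub>G\<^esub> (\<rho> (f, n)) \<otimes>\<^bsub>G\<^esub> \<rho> (fmul f (Th n [(x, True)]), n) \<in> ?E"
    if r: "\<rho> \<in> ?R" and f: "f \<in> words A" for \<rho> f n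
  proof -
    obtain u w where uw: "\<rho> = ladder u w" "u \<in> words X" "w \<in> words X" using r wX by blast
    define W q where "W = Th (- n) w" and "q = Th (- n) (fmul (finv u) f)"
    have X: "W \<in> words X" "q \<in> words X" using uw wX[OF f] by (simp_all add: W_def q_def)
    define q' where "q' = fmul q [(x, True)]"
    have q': "Th (- n) (fmul (finv u) (fmul f (Th n [(x, True)]))) = q'"
      using uw wX[OF f] xX by (simp add: Th_fmul q_def q'_def fmul_assoc)
    have q'X: "q' \<in> words X" using X(2) xX by (simp add: q'_def)
    have lX: "lcp W q \<in> words X" "lcp W q' \<in> words X" using words_lcp[of W X] X by simp_all
    have eq: "inv\<^bsub>G\<^esub> (\<rho> (f, n)) \<otimes>\<^bsub>G\<^esub> \<rho> (fmul f (Th n [(x, True)]), n) = (fmul (finv (lcp W q)) (lcp W q'), 0)"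
      using step[OF uw(2) lX, of n n] q' lX by (simp add: uw(1) ladder_def W_def q_def Th_0)
    have "fmul (finv (lcp W q)) (lcp W q') \<in> {[], [(x, True)]}"
    proof (cases "q \<noteq> [] \<and> last q = inverse_letter (x, True)")
      case True
      then have "q = q' @ [inverse_letter (x, True)]"
        using X(2) by (simp add: q'_def fmul_letter) (metis append_butlast_last_id)
      then consider "lcp W q = lcp W q'" | "lcp W q = lcp W q' @ [inverse_letter (x, True)]"
        using lcp_snoc by metis
      then show ?thesis
      proof cases
        case 2
        have "fmul (finv (lcp W q' @ [inverse_letter (x, True)])) (lcp W q') = fmul ((x, True) # finv (lcp W q')) (lcp W q')"
          by simp
        also have "(x, True) # finv (lcp W q') = fmul [(x, True)] (finv (lcp W q'))"
          using fmul_append[of "[(x, True)]" "finv (lcp W q')"] words_reduced[OF lX(1)] reduced_finv[of "lcp W q"] 2 by simp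
        finally show ?thesis using 2 lX xX by (simp add: fmul_assoc)
      qed (use lX in simp)
    next
      case False
      then have "q' = q @ [(x, True)]" using X(2) by (auto simp: q'_def fmul_letter)
      then consider "lcp W q' = lcp W q" | "lcp W q' = lcp W q @ [(x, True)]"
        using lcp_snoc by metis
      then show ?thesis
        by cases (use lX prefix_finv_fmul[of "lcp W q" "[(x, True)]"] in auto)
    qed
    then show ?thesis unfolding eq by (auto simp: one_G)
  qed
  then show "\<exists>E. finite E \<and> E \<subseteq> carrier G \<and>
       (\<forall>\<rho>\<in>?R. \<forall>f\<in>words A. \<forall>n. inv\<^bsub>G\<^esub> (\<rho> (f, n)) \<otimes>\<^bsub>G\<^esub> \<rho> (fmul f (Th n [(x, True)]), n) \<in> E)"
    using xX by (intro exI[of _ ?E]) (auto simp: one_G)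
qed

lemma ev_height_0:
  assumes "\<And>x. x \<in> A \<Longrightarrow> e x = 0" "A \<subseteq> X" "w \<in> words A"
  shows "ev w = (w, 0)"
  using assms(3)
proof (induction rule: free_group_induct)
  case (Cons x w)
  have "[x] \<in> words X" "w \<in> words X" using Cons.hyps assms(2) words_mono[OF assms(2)] by auto
  then have "el x = ([x], 0)" using assms(1)[of "fst x"] Cons.hyps by (simp add: el_def Th_0)
  then show ?case using Cons \<open>w \<in> words X\<close> by (simp add: ev_Cons Th_0)
qed (simp add: one_G)

text \<open>Suppose the product of \<open>u\<close> and \<open>v\<close> is below \<open>M\<close>.
  Then the ladder of the geodesic from \<open>u\<close> to \<open>v\<close> has a point
  \<open>b\<close> in the ball of radius \<open>M + K\<close>. Carried back to height zero it
  becomes a vertex \<open>s\<close> of that geodesic, whose length is bounded in terms of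
  \<open>b\<close>; but no vertex of the geodesic is shorter than the common prefix
  \<open>P\<close>.\<close>

lemma cannon_thurston_normal:
  assumes hyp: "hyperbolic_word_metric G S \<delta>" and A: "invariant A" and retr: "retract A"
    and e0: "\<And>x. x \<in> A \<Longrightarrow> e x = 0"
  shows "cannon_thurston_at S A"
  unfolding cannon_thurston_at_def
proof
  interpret H: hyperbolic_word_metric G S \<delta> by fact
  have AX: "A \<subseteq> X" using A by (simp add: invariant_def)
  have wX: "w \<in> words X" if "w \<in> words A" for w using words_mono[OF AX that] .
  have levG: "lev A \<subseteq> carrier G" by (rule subgroup.subset[OF subgroup_lev[OF A]])
  obtain r where r: "controlled G (carrier G) {r}" "\<And>g. g \<in> carrier G \<Longrightarrow> r g \<in> lev A"
    "\<And>g. g \<in> lev A \<Longrightarrow> r g = g" using retr unfolding retract_def by blast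
  let ?R0 = "{ladder u w | u w. u \<in> words A \<and> w \<in> words A}"
  let ?R = "{\<rho>' \<circ> \<rho> | \<rho>' \<rho>. \<rho>' \<in> ?R0 \<and> \<rho> \<in> {r}}"
  have R: "controlled G (carrier G) ?R"
    by (rule G.controlled_comp[OF r(1) _ subgroup_lev[OF A] _ _ controlled_ladder[OF A]])
       (use r in auto)
  have idem: "\<rho> (\<rho> g) = \<rho> g" if \<rho>: "\<rho> \<in> ?R" and g: "g \<in> carrier G" for \<rho> g
  proof -
    obtain u w where uw: "\<rho> = ladder u w \<circ> r" "u \<in> words A" "w \<in> words A" using \<rho> by blast
    have "r g \<in> lev A" by (rule r(2)[OF g])
    then show ?thesis
      using ladder_lev[OF A uw(2,3), of "r g"] ladder_idem[OF wX[OF uw(2)] wX[OF uw(3)], of "r g"]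
        r(3)[of "ladder u w (r g)"] subsetD[OF levG, of "r g"] by (simp add: uw(1))
  qed
  obtain K where K: "\<And>\<rho> u v p. \<rho> \<in> ?R \<Longrightarrow> u \<in> carrier G \<Longrightarrow> v \<in> carrier G \<Longrightarrow> p \<in> carrier G \<Longrightarrow> \<rho> u = u \<Longrightarrow> \<rho> v = v \<Longrightarrow>
    \<exists>b\<in>carrier G. \<rho> b = b \<and> H.dis p b \<le> H.gp p u v + K"
    using H.controlled_retractions_quasiconvex[OF R idem] by blast
  have "\<forall>n. \<exists>L. \<forall>w\<in>words X. length (Th n w) \<le> L * length w \<and> length (Th (- n) w) \<le> L * length w"
  proof
    fix n show "\<exists>L. \<forall>w\<in>words X. length (Th n w) \<le> L * length w \<and> length (Th (- n) w) \<le> L * length w"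
    proof -
      obtain L where "\<And>w. w \<in> words X \<Longrightarrow> length (Th n w) \<le> L * length w"
        "\<And>w. w \<in> words X \<Longrightarrow> length (Th (- n) w) \<le> L * length w" using Th_Lipschitz[of n] by blast
      then show ?thesis by (intro exI[of _ L]) simp
    qed
  qed
  from choice[OF this] obtain L where
    "\<forall>n. \<forall>w\<in>words X. length (Th n w) \<le> L n * length w \<and> length (Th (- n) w) \<le> L n * length w" by blast
  then have L: "\<And>n w. w \<in> words X \<Longrightarrow> length (Th n w) \<le> L n * length w"
    "\<And>n w. w \<in> words X \<Longrightarrow> length (Th (- n) w) \<le> L n * length w" by blast+
  fix M
  define Ball where "Ball = {b \<in> carrier G. H.len b \<le> nat \<lceil>M + K\<rceil>}"
  have fin: "finite Ball" unfolding Ball_def by (rule H.finite_ball)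
  \<comment> \<open>One factor \<open>L n\<close> bounds the distance on the rung from
    \<open>p\<close> to the image of a vertex of the base geodesic; the other is the Lipschitz
    constant for carrying this difference back by \<open>Th n\<close>.\<close>
  define N where "N = Suc (Max (insert 0 ((\<lambda>b. length (fst b) + L (snd b) * L (snd b)) ` Ball)))"
  have "M \<le> H.gp \<one>\<^bsub>G\<^esub> (ev (P @ U)) (ev (P @ V))"
    if u: "P @ U \<in> words A" and v: "P @ V \<in> words A" and len: "N \<le> length P" for P U V
  proof (rule ccontr)
    assume less: "\<not> ?thesis"
    define u v where "u = P @ U" and "v = P @ V"
    have uvA: "u \<in> words A" "v \<in> words A" using u v by (simp_all add: u_def v_def)
    have uvX: "u \<in> words X" "v \<in> words X" using uvA wX by blast+
    define w where "w = fmul (finv u) v"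
    have wA: "w \<in> words A" unfolding w_def using uvA by simp
    have evs: "ev u = (u, 0)" "ev v = (v, 0)" using ev_height_0[OF e0 AX] uvA by blast+
    have uw: "fmul u w = v" unfolding w_def using uvX by simp
    have rho: "ladder u w \<circ> r \<in> ?R" using uvA wA by blast
    \<comment> \<open>At height zero the end points project to the two ends \<open>[]\<close> and
      \<open>w\<close> of the rung.\<close>
    have "(ladder u w \<circ> r) (u, 0) = (u, 0)" "(ladder u w \<circ> r) (v, 0) = (v, 0)"
      using r(3) uvA uvX wX[OF wA] uw lcp_absorb[of w w]
      by (simp_all add: ladder_def Th_0 w_def[symmetric] lcp_commute[of _ "[]"])
    then obtain b where b: "b \<in> carrier G" "ladder u w (r b) = b" "H.dis \<one>\<^bsub>G\<^esub> b \<le> H.gp \<one>\<^bsub>G\<^esub> (u, 0) (v, 0) + K"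
      using K[OF rho, of "(u, 0)" "(v, 0)" "\<one>\<^bsub>G\<^esub>"] uvX by auto
    obtain f n where fn: "r b = (f, n)" by (cases "r b")
    define p where "p = lcp (Th (- n) w) (Th (- n) (fmul (finv u) f))"
    have bp: "b = (fmul u (Th n p), n)" using b(2) fn by (simp add: ladder_def p_def)
    have pX: "p \<in> words X" unfolding p_def using wX[OF wA] by (intro words_lcp) simp
    have "prefix p (Th (- n) w)" unfolding p_def by (rule longest_common_prefix_prefix1)
    then obtain i where i: "length (fmul (finv p) (Th (- n) (take i w))) \<le> L n"
      using image_path_near[OF wX[OF wA] _ L(2)] by blast
    define s where "s = fmul u (take i w)"
    have tX: "take i w \<in> words X" "drop i w \<in> words X"
      using wX[OF wA] words_take words_appendD[of "take i w" "drop i w" X] by simp_all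
    have d: "fmul (finv (fst b)) s = Th n (fmul (finv p) (Th (- n) (take i w)))"
      using pX tX uvX by (simp add: bp s_def Th_fmul Th_finv finv_fmul fmul_assoc)
    have "length (fmul (finv (fst b)) s) \<le> L n * length (fmul (finv p) (Th (- n) (take i w)))"
      unfolding d by (rule L(1)) (use pX tX in simp)
    also have "\<dots> \<le> L n * L n" using i by (rule mult_le_mono2)
    finally have "length (fmul (finv (fst b)) s) \<le> L n * L n" .
    moreover have "s = fmul (fst b) (fmul (finv (fst b)) s)" using uvX pX tX by (simp add: bp s_def)
    then have "length s \<le> length (fst b) + length (fmul (finv (fst b)) s)"
      using length_fmul_le[of "fst b" "fmul (finv (fst b)) s"] uvX pX by (simp add: bp)
    moreover have "length P \<le> length s"
    proof -
      have "prefix P (lcp u v)" unfolding u_def v_def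
        by (rule longest_common_prefix_max_prefix) simp_all
      then have "length P \<le> length (lcp u v)" by (rule prefix_length_le)
      also have "\<dots> \<le> length s" unfolding s_def
        by (rule length_geodesic_point[where ?w2.0 = "drop i w"]) (use uvX w_def in simp_all)
      finally show ?thesis .
    qed
    ultimately have "N \<le> length (fst b) + L (snd b) * L (snd b)" using len bp by simp
    moreover have "real (H.len b) \<le> M + K"
      using b(1,3) less evs H.dis_one(1)[OF b(1)] by (simp add: u_def v_def)
    then have "b \<in> Ball" using b(1) by (simp add: Ball_def) linarith
    then have "length (fst b) + L (snd b) * L (snd b) < N"
      unfolding N_def using fin by (intro le_imp_less_Suc Max_ge) auto
    ultimately show False by simp
  qed
  then show "\<exists>N. \<forall>P U V. P @ U \<in> words A \<longrightarrow> P @ V \<in> words A \<longrightarrow> N \<le> length P \<longrightarrow>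
     M \<le> H.gp \<one>\<^bsub>G\<^esub> (ev (P @ U)) (ev (P @ V))" by blast
qed

text \<open>Translates products for the arbitrary generating set \<open>T\<close> into common
  prefixes over \<open>X\<close>. A \<open>T\<close>-geodesic from \<open>u\<close> to
  \<open>v\<close>, spelled out in words over \<open>X\<close>, passes within \<open>L\<close> of
  the branch point \<open>m\<close> in the Cayley tree. The corresponding point \<open>q\<close> has
  \<open>T\<close>-length at most \<open>C * (length m + L)\<close> and at least the Gromov product
  of \<open>u\<close> and \<open>v\<close>.\<close>

lemma common_prefix_of_gromov_product:
  assumes T: "word_metric \<Lambda> T" and mult: "monoid.mult \<Lambda> = monoid.mult G" and one: "\<one>\<^bsub>\<Lambda>\<^esub> = \<one>\<^bsub>G\<^esub>"
    and carr: "carrier \<Lambda> = ev ` words X"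
  shows "\<exists>M. \<forall>u\<in>carrier \<Lambda>. \<forall>v\<in>carrier \<Lambda>. M \<le> gromov_product \<Lambda> T \<one>\<^bsub>\<Lambda>\<^esub> u v \<longrightarrow>
    (\<exists>P U V. P @ U \<in> words X \<and> P @ V \<in> words X \<and> N \<le> length P \<and> ev (P @ U) = u \<and> ev (P @ V) = v)"
proof -
  interpret T: word_metric \<Lambda> T by fact
  have "\<forall>g\<in>carrier \<Lambda>. \<exists>w. w \<in> words X \<and> ev w = g" using carr by auto
  then obtain wd where wd: "\<And>g. g \<in> carrier \<Lambda> \<Longrightarrow> wd g \<in> words X" "\<And>g. g \<in> carrier \<Lambda> \<Longrightarrow> ev (wd g) = g" by metis
  define L where "L = Max (insert 0 ((\<lambda>g. length (wd g)) ` T.letters))"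
  have L: "length (wd g) \<le> L" if "g \<in> T.letters" for g
    unfolding L_def using that T.finite_letters by (intro Max_ge) auto
  define C where "C = Max (insert 0 ((\<lambda>x. T.len (el x)) ` (X \<times> UNIV)))"
  have C: "T.len (el x) \<le> C" if "fst x \<in> X" for x
    unfolding C_def using that finite_X by (intro Max_ge) (auto simp: mem_Times_iff)
  have len_ev: "T.len (ev y) \<le> C * length y" if "y \<in> words X" for y
    using that
  proof (induction rule: free_group_induct)
    case Nil
    show ?case by (simp flip: one)
  next
    case (Cons x w)
    have "el x \<in> carrier \<Lambda>" "ev w \<in> carrier \<Lambda>"
      using carr ev_single[OF Cons.hyps(1)] Cons.hyps by (metis image_eqI words_single, auto)
    then have "T.len (ev (x # w)) \<le> T.len (el x) + T.len (ev w)"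
      using T.len_mult[of "el x" "ev w"] by (simp add: ev_Cons mult)
    then show ?case using Cons.IH C[OF Cons.hyps(1)] by simp
  qed
  have "\<exists>P U V. P @ U \<in> words X \<and> P @ V \<in> words X \<and> N \<le> length P \<and> ev (P @ U) = u \<and> ev (P @ V) = v"
    if u: "u \<in> carrier \<Lambda>" and v: "v \<in> carrier \<Lambda>" and M: "real (C * (N + L)) + 1 \<le> T.gp \<one>\<^bsub>\<Lambda>\<^esub> u v" for u v
  proof -
    obtain w where w: "length w = T.len (inv\<^bsub>\<Lambda>\<^esub> u \<otimes>\<^bsub>\<Lambda>\<^esub> v)" "set w \<subseteq> T.letters" "T.eval w = inv\<^bsub>\<Lambda>\<^esub> u \<otimes>\<^bsub>\<Lambda>\<^esub> v"
      using T.len_word[of "inv\<^bsub>\<Lambda>\<^esub> u \<otimes>\<^bsub>\<Lambda>\<^esub> v"] u v by auto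
    have st: "set (take i w) \<subseteq> T.letters" "set (drop i w) \<subseteq> T.letters" for i
      using w(2) set_take_subset[of i w] set_drop_subset[of i w] by auto
    define z where "z i = foldl (\<lambda>a s. fmul a (wd s)) [] (take i w)" for i
    have z0: "z 0 = []" by (simp add: z_def)
    have zS: "z (Suc i) = fmul (z i) (wd (w ! i))" if "i < length w" for i
      using that by (simp add: z_def take_Suc_conv_app_nth)
    have wi: "w ! i \<in> T.letters" "w ! i \<in> carrier \<Lambda>" if "i < length w" for i
      using nth_mem[OF that] w(2) T.letters_closed by blast+
    have z: "i \<le> length w \<Longrightarrow> z i \<in> words X \<and> ev (z i) = T.eval (take i w)" for i
    proof (induction i)
      case (Suc i)
      then have i: "i < length w" "z i \<in> words X" "ev (z i) = T.eval (take i w)" by auto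
      have "T.eval (take (Suc i) w) = T.eval (take i w) \<otimes>\<^bsub>\<Lambda>\<^esub> w ! i"
        using T.eval_append[OF st(1)[of i], of "[w ! i]"] wi[OF i(1)] i(1) by (simp add: take_Suc_conv_app_nth)
      then show ?case using zS[OF i(1)] i wd[OF wi(2)[OF i(1)]] by (simp add: ev_fmul mult)
    qed (simp add: z0 one)
    define n where "n = length w"
    \<comment> \<open>\<open>V'\<close> is read off the path and not taken as \<open>wd v\<close>;
      the path then ends at \<open>V'\<close> by construction, without appeal to the injectivity of
      \<open>ev\<close>.\<close>
    define U' V' where "U' = wd u" and "V' = fmul (wd u) (z n)"
    have UX: "U' \<in> words X" "V' \<in> words X" using wd(1)[OF u] z[of n] by (simp_all add: U'_def V'_def n_def)
    have evU: "ev U' = u" unfolding U'_def by (rule wd(2)[OF u])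
    have evV: "ev V' = v"
      using z[of n] wd[OF u] w(3) u v T.mult_inv_cancel(1)[of u v] by (simp add: V'_def n_def ev_fmul flip: mult)
    obtain x y where xy: "U' = lcp U' V' @ x" "V' = lcp U' V' @ y" "x = [] \<or> y = [] \<or> hd x \<noteq> hd y"
      by (rule lcp_split)
    define m where "m = lcp U' V'"
    have mxy: "U' = m @ x" "V' = m @ y" using xy by (simp_all add: m_def)
    have mX: "m \<in> words X" "x \<in> words X" using UX mxy words_appendD by metis+
    have "z n = fmul (finv U') V'" using z[of n] UX by (simp add: U'_def V'_def n_def)
    also have "\<dots> = finv x @ y" by (rule fmul_finv_lcp(1)[OF _ _ mxy xy(3)]) (use UX in simp_all)
    finally have pz: "prefix (finv x) (z n)" by (simp add: prefix_def)
    \<comment> \<open>Seen from \<open>U'\<close>, the branch point \<open>m\<close> is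
      \<open>finv x\<close>, a vertex on the geodesic to \<open>z n\<close>.\<close>
    have "\<exists>i\<le>n. length (fmul (finv (finv x)) (z i)) \<le> L"
    proof (rule path_near_prefix[OF _ z0 pz])
      show "reduced (z i)" if "i \<le> n" for i using z[of i] that by (simp add: n_def)
      show "length (fmul (finv (z i)) (z (Suc i))) \<le> L" if "i < n" for i
        using zS[of i] z[of i] that wd(1)[OF wi(2)[of i]] L[OF wi(1)[of i]] by (simp add: n_def)
    qed
    then obtain i where i: "i \<le> n" "length (fmul x (z i)) \<le> L" by auto
    have zi: "z i \<in> words X" "ev (z i) = T.eval (take i w)" using z[of i] i by (auto simp: n_def)
    define q where "q = u \<otimes>\<^bsub>\<Lambda>\<^esub> T.eval (take i w)"
    have qc: "q \<in> carrier \<Lambda>" unfolding q_def using u st(1)[of i] by simp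
    have U'z: "fmul U' (z i) = fmul m (fmul x (z i))"
      using fmul_append[of m x] UX mX zi mxy by (simp add: fmul_assoc[symmetric])
    have "q = ev (fmul U' (z i))" using UX zi evU by (simp add: q_def ev_fmul mult)
    then have "T.len q \<le> C * length (fmul U' (z i))" using len_ev[of "fmul U' (z i)"] UX zi by simp
    also have "\<dots> \<le> C * (length m + L)"
      unfolding U'z using length_fmul_le[of m "fmul x (z i)"] mX zi i(2) by (intro mult_le_mono2) auto
    finally have qlen: "T.len q \<le> C * (length m + L)" .
    have "T.gp \<one>\<^bsub>\<Lambda>\<^esub> u v \<le> T.dis \<one>\<^bsub>\<Lambda>\<^esub> q"
    proof -
      have "T.dis u q \<le> real i"
        using T.dis_mult_right[OF u T.eval_closed[OF st(1)[of i]]] T.len_le[OF st(1)[of i]] i(1)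
        by (simp add: q_def n_def)
      moreover have "T.dis q v \<le> real n - real i"
      proof -
        have "T.eval (take i w) \<otimes>\<^bsub>\<Lambda>\<^esub> T.eval (drop i w) = inv\<^bsub>\<Lambda>\<^esub> u \<otimes>\<^bsub>\<Lambda>\<^esub> v"
          using T.eval_append[OF st(1)[of i] st(2)[of i]] w(3) by (simp only: append_take_drop_id)
        then have "q \<otimes>\<^bsub>\<Lambda>\<^esub> T.eval (drop i w) = v"
          using u v st[of i] by (simp add: q_def T.m_assoc)
        then have "T.dis q v = real (T.len (T.eval (drop i w)))"
          using T.dis_mult_right[OF qc T.eval_closed[OF st(2)[of i]]] by simp
        then show ?thesis using T.len_le[OF st(2)[of i]] i(1) by (simp add: n_def of_nat_diff)
      qed
      moreover have "T.dis u v = real n" using w(1) by (simp add: word_dist_def n_def)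
      moreover have "T.dis u \<one>\<^bsub>\<Lambda>\<^esub> \<le> T.dis u q + T.dis q \<one>\<^bsub>\<Lambda>\<^esub>" "T.dis v \<one>\<^bsub>\<Lambda>\<^esub> \<le> T.dis v q + T.dis q \<one>\<^bsub>\<Lambda>\<^esub>"
        using T.dis_triangle u v qc by auto
      moreover have "T.dis v q = T.dis q v" "T.dis q \<one>\<^bsub>\<Lambda>\<^esub> = T.dis \<one>\<^bsub>\<Lambda>\<^esub> q" using T.dis_commute u v qc by auto
      ultimately show ?thesis by (simp add: gromov_product_def)
    qed
    then have "real (C * (N + L)) + 1 \<le> real (T.len q)" using M T.dis_one(1)[OF qc] by simp
    then have "C * (N + L) < C * (length m + L)" using qlen by linarith
    then have "N \<le> length m" by simp
    then show ?thesis using mxy UX evU evV by blast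
  qed
  then show ?thesis by blast
qed

end


section \<open>Hydra groups\<close>

context free_by_cyclic
begin

lemma invariantI:
  assumes "A \<subseteq> X" "\<And>w. w \<in> words A \<Longrightarrow> Th 1 w \<in> words A" "\<And>w. w \<in> words A \<Longrightarrow> Th (- 1) w \<in> words A"
  shows "invariant A"
  unfolding invariant_def
proof (intro conjI allI ballI)
  fix n w assume w: "w \<in> words A"
  have wX: "w \<in> words X" by (rule words_mono[OF assms(1) w])
  show "Th n w \<in> words A"
  proof (induction n rule: int_induct[of _ 0])
    case base
    then show ?case using w wX by (simp add: Th_0)
  next
    case (step1 i)
    then show ?case using Th_add[OF wX, of 1 i] assms(2) by (simp add: add.commute)
  next
    case (step2 i)
    then show ?case using Th_add[OF wX, of "- 1" i] assms(3) by simp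
  qed
qed (rule assms(1))

text \<open>The set \<open>Q\<close> records the left factors that can occur: all words over the
  \<open>b\<^sub>j\<close> in the first layer, only the empty word in higher layers, where \<theta>
  multiplies the stable letter on the right.\<close>

lemma Th_letters_all:
  assumes A: "invariant A" and Z: "Z \<subseteq> X" "A \<inter> Z = {}"
    and Q: "Q \<subseteq> words A" "[] \<in> Q" "\<And>s p p'. s \<in> {1, - 1} \<Longrightarrow> p \<in> Q \<Longrightarrow> p' \<in> Q \<Longrightarrow> fmul (Th s p) p' \<in> Q"
    and base: "\<And>s z. s \<in> {1, - 1} \<Longrightarrow> z \<in> Z \<Longrightarrow>
      \<exists>p\<in>Q. \<exists>q\<in>words A. \<exists>z'\<in>Z. Th s [(z, True)] = p @ [(z', True)] @ q"
    and z: "z \<in> Z"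
  shows "\<exists>p\<in>Q. \<exists>q\<in>words A. \<exists>z'\<in>Z. Th n [(z, True)] = p @ [(z', True)] @ q"
proof -
  have zX: "[(z, True)] \<in> words X" using z Z by auto
  have AX: "w \<in> words X" if "w \<in> words A" for w using A words_mono that by (auto simp: invariant_def)
  have sand: "fmul (fmul p [(z', True)]) q = p @ [(z', True)] @ q" if "p \<in> words A" "q \<in> words A" "z' \<in> Z" for p q z'
  proof -
    have "fst (z', True) \<notin> A" using that Z by auto
    then show ?thesis by (rule fmul_sandwich[OF that(1,2)])
  qed
  have step: "\<exists>p\<in>Q. \<exists>q\<in>words A. \<exists>z'\<in>Z. Th (s + i) [(z, True)] = p @ [(z', True)] @ q"
    if s: "s \<in> {1, - 1}" and ih: "\<exists>p\<in>Q. \<exists>q\<in>words A. \<exists>z'\<in>Z. Th i [(z, True)] = p @ [(z', True)] @ q" for s i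
  proof -
    obtain p q z' where 1: "p \<in> Q" "q \<in> words A" "z' \<in> Z" "Th i [(z, True)] = p @ [(z', True)] @ q"
      using ih by blast
    obtain p1 q1 z1 where 2: "p1 \<in> Q" "q1 \<in> words A" "z1 \<in> Z" "Th s [(z', True)] = p1 @ [(z1, True)] @ q1"
      using base[OF s 1(3)] by blast
    have pA: "p \<in> words A" "p1 \<in> words A" using 1(1) 2(1) Q by auto
    have X: "p \<in> words X" "q \<in> words X" "p1 \<in> words X" "q1 \<in> words X" "[(z', True)] \<in> words X" "[(z1, True)] \<in> words X"
      using pA 1 2 AX Z by auto
    have new: "fmul (Th s p) p1 \<in> Q" "fmul q1 (Th s q) \<in> words A"
      using Q(3)[OF s 1(1) 2(1)] 1 2 A by (auto simp: invariant_def)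
    have "Th (s + i) [(z, True)] = Th s (fmul (fmul p [(z', True)]) q)"
      using Th_add[OF zX, of s i] 1(4) sand[OF pA(1) 1(2,3)] by simp
    also have "\<dots> = fmul (fmul (Th s p) (fmul (fmul p1 [(z1, True)]) q1)) (Th s q)"
      using X 2(4) sand[OF pA(2) 2(2,3)] by (simp add: Th_fmul)
    also have "\<dots> = fmul (fmul (fmul (Th s p) p1) [(z1, True)]) (fmul q1 (Th s q))"
      using X by (simp add: fmul_assoc)
    also have "\<dots> = fmul (Th s p) p1 @ [(z1, True)] @ fmul q1 (Th s q)"
      by (rule sand) (use new 2(3) Q(1) in auto)
    finally show ?thesis using new 2(3) by blast
  qed
  show ?thesis
  proof (induction n rule: int_induct[of _ 0])
    case base
    show ?case using Th_0[OF zX] z Q(2) words_Nil[of A] by (metis append_Nil append_Nil2)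
  next
    case (step1 i)
    then show ?case using step[of 1 i] by (simp add: add.commute)
  next
    case (step2 i)
    then show ?case using step[of "- 1" i] by simp
  qed
qed

end

context cyclic_step
begin

text \<open>The first coordinate of \<open>el y \<otimes> ev m \<otimes> el x\<close> is \<open>y f x\<close> up to a power of the automorphism.\<close>

lemma crossing_returns:
  assumes m: "m \<in> words A" and y: "fst y \<in> Z" and x: "fst x \<in> Z"
    and lev: "el y \<otimes>\<^bsub>G\<^esub> ev m \<otimes>\<^bsub>G\<^esub> el x \<in> lev A" and fn: "ev m = (f, n)"
  shows "snd x = (\<not> snd y)"
    "Th n [x] = p @ x' # q \<Longrightarrow> p \<in> words A \<Longrightarrow> fst x' \<in> Z \<Longrightarrow> q \<in> words A \<Longrightarrow>
       fmul (Th (if snd y then 1 else 0) f) p = [] \<and> x' = inverse_letter y"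
proof -
  have X: "[y] \<in> words X" "[x] \<in> words X" using x y Z_X by auto
  have fA: "f \<in> words A" using ev_lev[OF inv_A m] fn by simp
  then have fX: "f \<in> words X" by (rule words_A_X)
  define c where "c = (if snd y then 1 else 0 :: int)"
  define n' where "n' = n + c + sh x"
  define g where "g = fmul [y] (fmul (Th c f) (Th n' [x]))"
  have gX: "g \<in> words X" unfolding g_def using X fX by simp
  have ey: "el y = (Th (sh y) [y], if snd y then 1 else - 1)"
    using e_Z[OF y] X by (simp add: el_def sh_def Th_0)
  have yf: "el y \<otimes>\<^bsub>G\<^esub> ev m = (Th (sh y) (fmul [y] (Th c f)), n + c + sh y)"
    using X fX fn Th_add[of f "- 1" 0] unfolding ey by (simp add: sh_def c_def Th_fmul Th_0)
  obtain k where "el y \<otimes>\<^bsub>G\<^esub> ev m \<otimes>\<^bsub>G\<^esub> el x =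
      (fmul (Th (sh y) (fmul [y] (Th c f))) (Th (n + c + sh y + sh x) [x]), k)"
    unfolding yf using mult_el[OF x, of "Th (sh y) (fmul [y] (Th c f))" "n + c + sh y"] X fX by auto
  moreover have "Th (n + c + sh y + sh x) [x] = Th (sh y) (Th n' [x])"
    using Th_add[OF X(2), of "sh y" n'] by (simp add: n'_def algebra_simps)
  ultimately have "el y \<otimes>\<^bsub>G\<^esub> ev m \<otimes>\<^bsub>G\<^esub> el x = (Th (sh y) g, k)"
    using X fX by (simp add: g_def Th_fmul fmul_assoc)
  then have "Th (sh y) g \<in> words A" using lev by simp
  then have gA: "g \<in> words A" using Th_A[of "Th (sh y) g" "- sh y"] gX by simp
  have key: "fmul (Th c f) p = [] \<and> x' = inverse_letter y"
    if *: "Th n' [x] = p @ x' # q" "p \<in> words A" "fst x' \<in> Z" "q \<in> words A" for p x' q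
  proof (rule ccontr)
    assume neg: "\<not> ?thesis"
    define \<beta> where "\<beta> = fmul (Th c f) p"
    have \<beta>: "\<beta> \<in> words A" unfolding \<beta>_def using * fA Th_A by simp
    have Xs: "p \<in> words X" "q \<in> words X" "[x'] \<in> words X" "\<beta> \<in> words X"
      using * \<beta> words_A_X Z_X by auto
    have xA: "fst x' \<notin> A" "fst y \<notin> A" using * y Z_not_A by auto
    have "Th n' [x] = fmul (fmul p [x']) q"
      using *(1) fmul_sandwich[OF *(2,4) xA(1)] by simp
    then have g: "g = fmul [y] (fmul (fmul \<beta> [x']) q)"
      unfolding g_def \<beta>_def using fX Xs X by (simp add: fmul_assoc)
    have "fmul (fmul \<beta> [x']) q = \<beta> @ [x'] @ q"
      using fmul_sandwich[OF \<beta> *(4) xA(1)] by simp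
    moreover have "reduced ([y] @ \<beta> @ [x'] @ q)"
    proof (cases "\<beta> = []")
      case True
      then have "x' \<noteq> inverse_letter y" using neg by (simp add: \<beta>_def)
      then show ?thesis using True reduced_sandwich(2)[OF \<beta> *(4) xA(1)] by (simp add: reduced_Cons)
    next
      case False
      then have "hd \<beta> \<in> set \<beta>" by simp
      then have "fst (hd \<beta>) \<in> A" using \<beta> unfolding words_iff_Ball by blast
      then have "hd \<beta> \<noteq> inverse_letter y" using xA(2) by auto
      then show ?thesis using False reduced_sandwich(3)[OF \<beta> *(4) xA(1)] by (simp add: reduced_Cons)
    qed
    ultimately have "g = [y] @ \<beta> @ [x'] @ q" using g fmul_append[of "[y]" "\<beta> @ [x'] @ q"] by simp
    then show False using gA xA(2) by (simp add: words_iff_Ball)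
  qed
  obtain p0 q0 x0 where *: "p0 \<in> words A" "q0 \<in> words A" "fst x0 \<in> Z" "snd x0 = snd x" "Th n' [x] = p0 @ [x0] @ q0"
    using Th_letter[OF x] by metis
  then have "x0 = inverse_letter y" using key by simp
  then show opp: "snd x = (\<not> snd y)" using *(4) by (simp add: inverse_letter_def)
  then have "n' = n" by (auto simp: n'_def c_def sh_def)
  then show "Th n [x] = p @ x' # q \<Longrightarrow> p \<in> words A \<Longrightarrow> fst x' \<in> Z \<Longrightarrow> q \<in> words A \<Longrightarrow>
       fmul (Th (if snd y then 1 else 0) f) p = [] \<and> x' = inverse_letter y"
    using key by (simp add: c_def)
qed

end

text \<open>Index 0 stands for the \<open>b\<^sub>j\<close> alone; \<open>a\<^sub>0\<close> is
  present from index 1 on, together with \<open>a\<^sub>1\<close>, since neither letter gives an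
  invariant alphabet without the other.\<close>

definition hydra_alphabet :: "nat \<Rightarrow> nat \<Rightarrow> hydra_letter set" where
  "hydra_alphabet l i = Letter_b ` {1..l} \<union> (if i = 0 then {} else Letter_a ` {0..i})"

definition hydra_layer :: "nat \<Rightarrow> hydra_letter set" where
  "hydra_layer i = (if i = 1 then {Letter_a 0, Letter_a 1} else {Letter_a i})"

fun letter_height :: "hydra_letter \<Rightarrow> int" where
  "letter_height (Letter_a i) = 1"
| "letter_height (Letter_b j) = 0"

lemma hydra_alphabet_layer:
  assumes "1 \<le> i"
  shows "hydra_alphabet l (i - 1) \<union> hydra_layer i = hydra_alphabet l i"
    "hydra_alphabet l (i - 1) \<inter> hydra_layer i = {}"
proof -
  obtain j where i: "i = Suc j" using assms by (cases i) auto
  have "{0..i} = insert i {0..j}" using i by auto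
  then show "hydra_alphabet l (i - 1) \<union> hydra_layer i = hydra_alphabet l i"
    using i by (auto simp: hydra_alphabet_def hydra_layer_def)
  show "hydra_alphabet l (i - 1) \<inter> hydra_layer i = {}"
    using i by (auto simp: hydra_alphabet_def hydra_layer_def)
qed

lemma hydra_alphabet_mono: "i \<le> j \<Longrightarrow> hydra_alphabet l i \<subseteq> hydra_alphabet l j"
  by (auto simp: hydra_alphabet_def)

section \<open>The hydra automorphism and its layers\<close>

locale hydra =
  fixes k l :: nat and U V :: hydra_word and \<theta> :: "hydra_word \<Rightarrow> hydra_word"
  assumes k: "1 \<le> k" and aut: "hydra_automorphism k l U V \<theta>"
begin

abbreviation alph :: "nat \<Rightarrow> hydra_letter set" where "alph \<equiv> hydra_alphabet l"

definition Th :: "int \<Rightarrow> hydra_word \<Rightarrow> hydra_word" where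
  "Th n = \<theta> [^]\<^bsub>AutoGroup (hydra_free k l)\<^esub> (- n)"

lemma hydra_free_eq: "hydra_free k l = free_group (alph k)"
  using k by (auto simp: hydra_free_def hydra_alphabet_def Un_commute)

lemma theta_auto: "\<theta> \<in> carrier (AutoGroup (free_group (alph k)))"
  using aut by (simp add: hydra_automorphism_def AutoGroup_def hydra_free_eq)

lemma Th_auto: "Th n \<in> auto (free_group (alph k))"
proof -
  interpret F: group "free_group (alph k)" by (rule group_free_group)
  interpret Au: group "AutoGroup (free_group (alph k))" by (rule F.AutoGroup)
  have "Th n \<in> carrier (AutoGroup (free_group (alph k)))"
    unfolding Th_def hydra_free_eq by (rule Au.int_pow_closed[OF theta_auto])
  then show ?thesis by (simp add: AutoGroup_def)
qed

sublocale free_by_cyclic "alph k" Th letter_height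
proof
  interpret F: group "free_group (alph k)" by (rule group_free_group)
  interpret Au: group "AutoGroup (free_group (alph k))" by (rule F.AutoGroup)
  show "finite (alph k)" by (simp add: hydra_alphabet_def)
  fix w n assume w: "w \<in> words (alph k)"
  show "Th n w \<in> words (alph k)" using Th_auto[of n] w by (auto simp: auto_def hom_def)
  show "Th 0 w = w" using w by (simp add: Th_def hydra_free_eq AutoGroup_def BijGroup_def)
  fix m
  have "Th (m + n) = Th m \<otimes>\<^bsub>AutoGroup (free_group (alph k))\<^esub> Th n"
    using Au.int_pow_mult[OF theta_auto, of "- m" "- n"] by (simp add: Th_def hydra_free_eq)
  then show "Th (m + n) w = Th m (Th n w)"
    using Th_auto w by (simp add: AutoGroup_def BijGroup_def auto_def compose_def)
  fix v assume "v \<in> words (alph k)"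
  then show "Th n (fmul w v) = fmul (Th n w) (Th n v)"
    using Th_auto[of n] w by (auto simp: auto_def hom_def)
qed

lemma hydra_group_eq: "hydra_group k l \<theta> = G"
proof -
  have "(\<lambda>(x, g) (y, h). (x \<otimes>\<^bsub>hydra_free k l\<^esub> (\<theta> [^]\<^bsub>AutoGroup (hydra_free k l)\<^esub> (- g :: int)) y, g \<otimes>\<^bsub>integer_group\<^esub> h))
      = (\<lambda>(f, n) (g, m). (fmul f (Th n g), n + m))"
    by (auto simp: fun_eq_iff Th_def hydra_free_eq)
  then show ?thesis
    by (simp add: hydra_group_def mapping_torus_def semidirect_def G_def hydra_free_eq)
qed

lemma Th_minus_1: "w \<in> words (alph k) \<Longrightarrow> Th (- 1) w = \<theta> w"
proof -
  interpret F: group "free_group (alph k)" by (rule group_free_group)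
  interpret Au: group "AutoGroup (free_group (alph k))" by (rule F.AutoGroup)
  show ?thesis by (simp add: Th_def hydra_free_eq Au.int_pow_1[OF theta_auto])
qed

lemma alph_X: "i \<le> k \<Longrightarrow> alph i \<subseteq> alph k"
  by (rule hydra_alphabet_mono)

lemma subgroup_words: "A \<subseteq> alph k \<Longrightarrow> subgroup (words A) (free_group (alph k))"
  by (rule group.subgroupI[OF group_free_group])
     (use words_mono[of A "alph k"] words_Nil[of A] in \<open>auto simp del: words_Nil\<close>)

lemma carrier_hydra_free_b: "carrier (hydra_free_b k l) = words (alph 0)"
proof -
  interpret F: group "free_group (alph k)" by (rule group_free_group)
  let ?B = "gen_b ` {1..l}"
  have sub: "?B \<subseteq> words (alph k)" by (auto simp: free_gen_def hydra_alphabet_def)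
  have sub0: "?B \<subseteq> words (alph 0)" by (auto simp: free_gen_def hydra_alphabet_def)
  have "carrier (hydra_free_b k l) = generate (free_group (alph k)) ?B"
    using sub by (simp add: hydra_free_b_def hydra_free_eq carrier_subgroup_generated Int_absorb1)
  also have "\<dots> = words (alph 0)"
  proof
    show "generate (free_group (alph k)) ?B \<subseteq> words (alph 0)"
      by (rule F.generate_subgroup_incl[OF sub0 subgroup_words]) (simp add: alph_X)
    show "words (alph 0) \<subseteq> generate (free_group (alph k)) ?B"
    proof
      fix w assume "w \<in> words (alph 0)"
      then show "w \<in> generate (free_group (alph k)) ?B"
      proof (induction rule: free_group_induct)
        case Nil
        then show ?case using generate.one[of "free_group (alph k)" ?B] by simp
      next
        case (Cons x w)
        obtain j b where x: "x = (Letter_b j, b)" "j \<in> {1..l}" using Cons.hyps(1) by (cases x) (auto simp: hydra_alphabet_def)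
        have g: "gen_b j \<in> ?B" "gen_b j \<in> words (alph k)" using x sub by auto
        have "[x] \<in> generate (free_group (alph k)) ?B"
          using generate.incl[OF g(1), of "free_group (alph k)"] generate.inv[OF g(1), of "free_group (alph k)"] g(2) x
          by (cases b) (simp_all add: free_gen_def inverse_letter_def)
        from generate.eng[OF this Cons.IH] show ?case using Cons.hyps by simp
      qed
    qed
  qed
  finally show ?thesis .
qed

lemma UV: "U \<in> words (alph 0)" "V \<in> words (alph 0)"
  using aut by (simp_all add: hydra_automorphism_def carrier_hydra_free_b)

lemma invariant_alph_0: "invariant (alph 0)"
proof (rule invariantI[OF alph_X])
  have bij: "bij_betw (restrict \<theta> (words (alph 0))) (words (alph 0)) (words (alph 0))"
    using aut by (simp add: hydra_automorphism_def auto_def Bij_def carrier_hydra_free_b)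
  have wX: "w \<in> words (alph k)" if "w \<in> words (alph 0)" for w
    using words_mono[OF alph_X[of 0]] that by simp
  fix w assume w: "w \<in> words (alph 0)"
  show "Th (- 1) w \<in> words (alph 0)"
    using bij_betwE[OF bij] w by (simp add: Th_minus_1[OF wX[OF w]])
  have "w \<in> restrict \<theta> (words (alph 0)) ` words (alph 0)"
    unfolding bij_betw_imp_surj_on[OF bij] by (rule w)
  then obtain v where "v \<in> words (alph 0)" "w = restrict \<theta> (words (alph 0)) v" by (rule imageE)
  then have v: "v \<in> words (alph 0)" "w = \<theta> v" by simp_all
  then have "Th 1 w = v" using Th_minus_1[OF wX[OF v(1)]] Th_inverse(2)[OF wX[OF v(1)], of 1] by simp
  then show "Th 1 w \<in> words (alph 0)" using v by simp
qed simp

lemma theta_values: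
  "Th (- 1) (gen_a 0) = U @ [(Letter_a 1, True)] @ V"
  "Th (- 1) (gen_a 1) = gen_a 0"
  "1 < i \<Longrightarrow> i \<le> k \<Longrightarrow> Th (- 1) (gen_a i) = fmul (gen_a i) (gen_a (i - 1))"
proof -
  have g: "gen_a i \<in> words (alph k)" if "i \<le> k" for i
    using k that by (simp add: free_gen_def hydra_alphabet_def)
  have n: "fst (Letter_a 1, True) \<notin> alph 0" by (auto simp: hydra_alphabet_def)
  have "Th (- 1) (gen_a 0) = fmul (fmul U [(Letter_a 1, True)]) V"
    using aut Th_minus_1[OF g] k by (simp add: hydra_automorphism_def hydra_free_eq free_gen_def)
  also have "\<dots> = U @ [(Letter_a 1, True)] @ V"
    by (rule fmul_sandwich[OF UV n])
  finally show "Th (- 1) (gen_a 0) = U @ [(Letter_a 1, True)] @ V" .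
  show "Th (- 1) (gen_a 1) = gen_a 0"
    using aut Th_minus_1[OF g] k by (simp add: hydra_automorphism_def)
  show "Th (- 1) (gen_a i) = fmul (gen_a i) (gen_a (i - 1))" if "1 < i" "i \<le> k"
    using aut Th_minus_1[OF g] that by (simp add: hydra_automorphism_def hydra_free_eq)
qed

end


context hydra
begin

lemma gen_a_words: "i \<le> k \<Longrightarrow> gen_a i \<in> words (alph k)"
  using k by (simp add: free_gen_def hydra_alphabet_def)

text \<open>The values of \<theta> on the generators give \<open>Th (- 1)\<close>; those of
  \<open>Th 1\<close> are obtained by solving the same equations. The empty left factor for
  \<open>i > 1\<close> is what later pins down the element between two crossings.\<close>

lemma layer_letters:
  assumes i: "1 \<le> i" "i \<le> k" and inv: "invariant (alph (i - 1))" and z: "z \<in> hydra_layer i"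
  shows "\<exists>p\<in>(if i = 1 then words (alph 0) else {[]}). \<exists>q\<in>words (alph (i - 1)). \<exists>z'\<in>hydra_layer i.
    Th n [(z, True)] = p @ [(z', True)] @ q"
proof (rule Th_letters_all[OF inv _ hydra_alphabet_layer(2)[OF i(1)] _ _ _ _ z])
  show "hydra_layer i \<subseteq> alph k"
    using hydra_alphabet_layer(1)[OF i(1), of l] alph_X[OF i(2)] by auto
  show "(if i = 1 then words (alph 0) else {[]}) \<subseteq> words (alph (i - 1))" by auto
  show "[] \<in> (if i = 1 then words (alph 0) else {[]})" by auto
  show "fmul (Th s p) p' \<in> (if i = 1 then words (alph 0) else {[]})"
    if "p \<in> (if i = 1 then words (alph 0) else {[]})" "p' \<in> (if i = 1 then words (alph 0) else {[]})" for s p p'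
    using that invariant_alph_0 by (auto simp: invariant_def split: if_splits)
  fix s :: int and z assume s: "s \<in> {1, - 1}" and z: "z \<in> hydra_layer i"
  show "\<exists>p\<in>(if i = 1 then words (alph 0) else {[]}). \<exists>q\<in>words (alph (i - 1)). \<exists>z'\<in>hydra_layer i.
    Th s [(z, True)] = p @ [(z', True)] @ q"
  proof (cases "i = 1")
    case True
    have UVX: "U \<in> words (alph k)" "V \<in> words (alph k)" using UV words_mono[OF alph_X[of 0]] by auto
    have a01: "gen_a 0 \<in> words (alph k)" "gen_a 1 \<in> words (alph k)" using gen_a_words k by auto
    have n: "fst (Letter_a j, True) \<notin> alph 0" for j by (auto simp: hydra_alphabet_def)
    have sand: "fmul (fmul p (gen_a j)) q = p @ [(Letter_a j, True)] @ q" if "p \<in> words (alph 0)" "q \<in> words (alph 0)" for p q j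
      using fmul_sandwich[OF that n] by (simp add: free_gen_def)
    have t0: "Th 1 (gen_a 0) = [] @ [(Letter_a 1, True)] @ []"
      using Th_inverse(2)[OF a01(2), of 1] theta_values(2) by (simp add: free_gen_def)
    \<comment> \<open>Applying \<open>Th 1\<close> to
      \<open>\<theta>(a\<^sub>0) = U a\<^sub>1 V\<close> and solving for the image of
      \<open>a\<^sub>1\<close> produces these factors.\<close>
    define p q where "p = finv (Th 1 U)" and "q = finv (Th 1 V)"
    have pq: "p \<in> words (alph 0)" "q \<in> words (alph 0)"
      using UV invariant_alph_0 by (auto simp: p_def q_def invariant_def)
    have "gen_a 0 = Th 1 (fmul (fmul U (gen_a 1)) V)"
      using Th_inverse(2)[OF a01(1), of 1] theta_values(1) sand[OF UV] by simp
    also have "\<dots> = fmul (fmul (Th 1 U) (Th 1 (gen_a 1))) (Th 1 V)" using UVX a01 by (simp add: Th_fmul)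
    finally have "fmul (fmul p (gen_a 0)) q = Th 1 (gen_a 1)"
      using UVX a01 by (simp add: p_def q_def fmul_assoc)
    then have t1: "Th 1 (gen_a 1) = p @ [(Letter_a 0, True)] @ q" using sand[OF pq] by simp
    have t2: "Th (- 1) (gen_a 1) = [] @ [(Letter_a 0, True)] @ []" using theta_values(2) by (simp add: free_gen_def)
    have w: ?thesis
      if "Th s [(z, True)] = p @ [(Letter_a j, True)] @ q" "p \<in> words (alph 0)" "q \<in> words (alph 0)" "j \<le> 1" for p q j
    proof -
      have "Letter_a j \<in> hydra_layer i" using that(4) True by (auto simp: hydra_layer_def le_Suc_eq)
      then show ?thesis unfolding True using that by (intro bexI[of _ p] bexI[of _ q] bexI[of _ "Letter_a j"]) auto
    qed
    consider "z = Letter_a 0" "s = 1" | "z = Letter_a 0" "s = - 1" | "z = Letter_a 1" "s = 1" | "z = Letter_a 1" "s = - 1"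
      using z True s by (auto simp: hydra_layer_def)
    then show ?thesis
    proof cases
      case 1
      then show ?thesis using w[of "[]" 1 "[]"] t0 by (simp add: free_gen_def)
    next
      case 2
      then show ?thesis using w[of U 1 V] theta_values(1) UV by (simp add: free_gen_def)
    next
      case 3
      then show ?thesis using w[of p 0 q] t1 pq by (simp add: free_gen_def)
    next
      case 4
      then show ?thesis using w[of "[]" 0 "[]"] t2 by (simp add: free_gen_def)
    qed
  next
    case False
    then have i2: "1 < i" "i \<le> k" using i by auto
    have zi: "z = Letter_a i" using z False by (simp add: hydra_layer_def)
    have gX: "gen_a i \<in> words (alph k)" "gen_a (i - 1) \<in> words (alph k)" using gen_a_words i2 by auto
    have gA: "gen_a (i - 1) \<in> words (alph (i - 1))" using i2 by (simp add: free_gen_def hydra_alphabet_def)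
    have n: "fst (Letter_a i, True) \<notin> alph (i - 1)" using i2 by (auto simp: hydra_alphabet_def)
    have app: "fmul (gen_a i) q = [] @ [(Letter_a i, True)] @ q" if "q \<in> words (alph (i - 1))" for q
      using reduced_sandwich(2)[OF words_Nil that n] fmul_append[of "[(Letter_a i, True)]" q] by (simp add: free_gen_def)
    have t1: "Th (- 1) (gen_a i) = [] @ [(Letter_a i, True)] @ gen_a (i - 1)"
      using theta_values(3)[OF i2] app[OF gA] by simp
    define q where "q = finv (Th 1 (gen_a (i - 1)))"
    have q: "q \<in> words (alph (i - 1))" using inv gA by (simp add: q_def invariant_def)
    have "gen_a i = fmul (Th 1 (gen_a i)) (Th 1 (gen_a (i - 1)))"
      using Th_inverse(2)[OF gX(1), of 1] theta_values(3)[OF i2] gX by (simp add: Th_fmul)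
    then have "fmul (gen_a i) q = fmul (fmul (Th 1 (gen_a i)) (Th 1 (gen_a (i - 1)))) q" by simp
    then have "fmul (gen_a i) q = Th 1 (gen_a i)" using gX by (simp add: q_def fmul_assoc)
    then have t2: "Th 1 (gen_a i) = [] @ [(Letter_a i, True)] @ q" using app[OF q] by simp
    have "\<exists>q\<in>words (alph (i - 1)). Th s [(z, True)] = [] @ [(Letter_a i, True)] @ q"
      using s t1 t2 q gA unfolding zi free_gen_def by blast
    then show ?thesis using False by (auto simp: hydra_layer_def)
  qed
qed

lemma cyclic_step_layer:
  assumes i: "1 \<le> i" "i \<le> k" and inv: "invariant (alph (i - 1))"
  shows "cyclic_step (alph k) Th letter_height (alph (i - 1)) (hydra_layer i)"
proof
  show "hydra_layer i \<subseteq> alph k"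
    using hydra_alphabet_layer(1)[OF i(1), of l] alph_X[OF i(2)] by auto
  show "letter_height z = 1" if "z \<in> hydra_layer i" for z using that by (auto simp: hydra_layer_def split: if_splits)
  show "\<exists>p\<in>words (alph (i - 1)). \<exists>q\<in>words (alph (i - 1)). \<exists>z'\<in>hydra_layer i. Th n [(z, True)] = p @ [(z', True)] @ q"
    if z: "z \<in> hydra_layer i" for z n
  proof (cases "i = 1")
    case True
    then show ?thesis using layer_letters[OF i inv z, of n] by simp
  next
    case False
    then obtain q z' where "q \<in> words (alph (i - 1))" "z' \<in> hydra_layer i" "Th n [(z, True)] = [] @ [(z', True)] @ q"
      using layer_letters[OF i inv z, of n] by auto
    then show ?thesis by (intro bexI[of _ "[]"] bexI[of _ q] bexI[of _ z']) simp_all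
  qed
qed (use inv hydra_alphabet_layer(2)[OF i(1)] in auto)

lemma invariant_alph: "i \<le> k \<Longrightarrow> invariant (alph i)"
proof (induction i)
  case 0
  show ?case by (rule invariant_alph_0)
next
  case (Suc i)
  then have inv: "invariant (alph (Suc i - 1))" by simp
  interpret cyclic_step "alph k" Th letter_height "alph (Suc i - 1)" "hydra_layer (Suc i)"
    by (rule cyclic_step_layer[OF _ Suc.prems inv]) simp
  show ?case using invariant_AZ hydra_alphabet_layer(1)[of "Suc i" l] by simp
qed

section \<open>Trivial intersection of the subgroup with the cyclic edge groups\<close>

abbreviation shifted_power :: "nat \<Rightarrow> nat \<Rightarrow> hydra_word \<times> int" where
  "shifted_power i n \<equiv> (([], - 1) \<otimes>\<^bsub>G\<^esub> (gen_a i, 0)) [^]\<^bsub>G\<^esub> n"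

lemma shifted_power_closed: "i \<le> k \<Longrightarrow> ([], - 1) \<otimes>\<^bsub>G\<^esub> (gen_a i, 0) \<in> carrier G"
  using gen_a_words by simp

lemma ev_gen_a: "i \<le> k \<Longrightarrow> ev (gen_a i) = (gen_a i, 1)"
  using gen_a_words[of i] by (simp add: free_gen_def ev_Cons el_def one_G)

text \<open>The relation \<open>\<theta>(a\<^sub>i) = a\<^sub>i a\<^sub>i\<^sub>-\<^sub>1\<close>
  says that conjugation by \<open>a\<^sub>i t\<close> turns \<open>t\<^sup>-\<^sup>1\<close> into
  \<open>t\<^sup>-\<^sup>1 a\<^sub>i\<^sub>-\<^sub>1\<close>; this is its \<open>n\<close>-th
  power.\<close>

lemma shift_gen_a:
  assumes i: "1 < i" "i \<le> k"
  shows "([], - int n) \<otimes>\<^bsub>G\<^esub> ev (gen_a i) = ev (gen_a i) \<otimes>\<^bsub>G\<^esub> shifted_power (i - 1) n"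
proof (induction n)
  case 0
  show ?case using ev_gen_a[OF i(2)] gen_a_words[OF i(2)] by (simp add: Th_0 one_G)
next
  case (Suc n)
  let ?s = "([], - 1) \<otimes>\<^bsub>G\<^esub> (gen_a (i - 1), 0)"
  have g: "gen_a i \<in> words (alph k)" "gen_a (i - 1) \<in> words (alph k)" using gen_a_words i by auto
  have sc: "?s \<in> carrier G" using g by simp
  have one: "([], - 1) \<otimes>\<^bsub>G\<^esub> ev (gen_a i) = ev (gen_a i) \<otimes>\<^bsub>G\<^esub> ?s"
    using g theta_values(3)[OF i] by (simp add: ev_gen_a[OF i(2)])
  have "([], - int (Suc n)) = ([], - int n) \<otimes>\<^bsub>G\<^esub> ([], - 1)" by simp
  then have "([], - int (Suc n)) \<otimes>\<^bsub>G\<^esub> ev (gen_a i) = ([], - int n) \<otimes>\<^bsub>G\<^esub> (([], - 1) \<otimes>\<^bsub>G\<^esub> ev (gen_a i))"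
    using g by (simp only: G.m_assoc carrier_G_iff words_Nil ev_closed)
  also have "\<dots> = ([], - int n) \<otimes>\<^bsub>G\<^esub> ev (gen_a i) \<otimes>\<^bsub>G\<^esub> ?s"
    unfolding one using g sc by (simp only: G.m_assoc carrier_G_iff words_Nil ev_closed)
  also have "\<dots> = ev (gen_a i) \<otimes>\<^bsub>G\<^esub> shifted_power (i - 1) (Suc n)"
    unfolding Suc.IH using g sc by (simp only: G.m_assoc ev_closed G.nat_pow_closed G.nat_pow_Suc)
  finally show ?case .
qed

text \<open>
  For \<open>j > 1\<close> the first claim follows from the second one for \<open>j - 1\<close>, by \<open>shift_gen_a\<close>; the second
  one iterates the first.
\<close>

lemma hydra_descends:
  "1 \<le> j \<Longrightarrow> j \<le> k \<Longrightarrow> \<exists>\<kappa>\<in>words (alph j). \<exists>N\<ge>n + 1. ([], - int n) \<otimes>\<^bsub>G\<^esub> (gen_a j, 0) = ev \<kappa> \<otimes>\<^bsub>G\<^esub> ([], - int N)"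
  "1 \<le> j \<Longrightarrow> j \<le> k \<Longrightarrow> \<exists>\<kappa>\<in>words (alph j). \<exists>N\<ge>2 * n. shifted_power j n = ev \<kappa> \<otimes>\<^bsub>G\<^esub> ([], - int N)"
proof -
  \<comment> \<open>Each factor lowers the exponent of \<open>t\<close> twice, once by its own power
    \<open>-1\<close> of \<open>t\<close> and at least once more by \<open>D\<close>. This is the
    origin of \<open>2 * n\<close>.\<close>
  have power: "\<exists>\<kappa>\<in>words (alph j). \<exists>N\<ge>2 * n. shifted_power j n = ev \<kappa> \<otimes>\<^bsub>G\<^esub> ([], - int N)"
    if j: "1 \<le> j" "j \<le> k" and D: "\<And>n. \<exists>\<kappa>\<in>words (alph j). \<exists>N\<ge>n + 1. ([], - int n) \<otimes>\<^bsub>G\<^esub> (gen_a j, 0) = ev \<kappa> \<otimes>\<^bsub>G\<^esub> ([], - int N)"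
    for j n
  proof (induction n)
    case 0
    show ?case by (intro bexI[of _ "[]"] exI[of _ 0]) (simp_all add: one_G)
  next
    case (Suc n)
    have wX: "w \<in> words (alph k)" if "w \<in> words (alph j)" for w using words_mono[OF alph_X[OF j(2)] that] .
    obtain \<kappa> N where 1: "\<kappa> \<in> words (alph j)" "2 * n \<le> N" "shifted_power j n = ev \<kappa> \<otimes>\<^bsub>G\<^esub> ([], - int N)"
      using Suc.IH by blast
    obtain \<mu> N' where 2: "\<mu> \<in> words (alph j)" "N + 1 + 1 \<le> N'"
      "([], - int (N + 1)) \<otimes>\<^bsub>G\<^esub> (gen_a j, 0) = ev \<mu> \<otimes>\<^bsub>G\<^esub> ([], - int N')" using D[of "N + 1"] by blast
    have c: "ev \<kappa> \<in> carrier G" "ev \<mu> \<in> carrier G" "(gen_a j, 0) \<in> carrier G" "\<And>n. ([], n) \<in> carrier G"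
      using wX 1 2 gen_a_words[OF j(2)] by auto
    have sh: "([], - int N) \<otimes>\<^bsub>G\<^esub> ([], - 1) = ([], - int (N + 1))" by simp
    have "shifted_power j (Suc n) = ev \<kappa> \<otimes>\<^bsub>G\<^esub> ([], - int N) \<otimes>\<^bsub>G\<^esub> (([], - 1) \<otimes>\<^bsub>G\<^esub> (gen_a j, 0))"
      by (simp only: G.nat_pow_Suc 1(3))
    also have "\<dots> = ev \<kappa> \<otimes>\<^bsub>G\<^esub> ((([], - int N) \<otimes>\<^bsub>G\<^esub> ([], - 1)) \<otimes>\<^bsub>G\<^esub> (gen_a j, 0))"
      using c by (simp only: G.m_assoc G.m_closed)
    also have "\<dots> = ev (fmul \<kappa> \<mu>) \<otimes>\<^bsub>G\<^esub> ([], - int N')"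
      unfolding sh 2(3) using c wX 1(1) 2(1) by (simp only: ev_fmul G.m_assoc G.m_closed)
    finally show ?case using 1(1,2) 2(1,2) by (intro bexI[of _ "fmul \<kappa> \<mu>"] exI[of _ N']) simp_all
  qed
  have D: "\<exists>\<kappa>\<in>words (alph j). \<exists>N\<ge>n + 1. ([], - int n) \<otimes>\<^bsub>G\<^esub> (gen_a j, 0) = ev \<kappa> \<otimes>\<^bsub>G\<^esub> ([], - int N)"
    if "1 \<le> j" "j \<le> k" for j n
    using that
  proof (induction j arbitrary: n rule: nat_induct_at_least[of 1])
    case base
    obtain p q z' where *: "p \<in> words (alph 0)" "q \<in> words (alph 0)" "z' \<in> hydra_layer 1"
      "Th (- int n) (gen_a 1) = p @ [(z', True)] @ q"
      using layer_letters[of 1 "Letter_a 1" "- int n"] k invariant_alph_0 by (auto simp: hydra_layer_def free_gen_def)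
    have mono: "w \<in> words (alph 1)" "w \<in> words (alph k)" if "w \<in> words (alph 0)" for w
      using that words_mono hydra_alphabet_mono[of 0 1 l] alph_X[of 0] by blast+
    obtain i where z': "z' = Letter_a i" "i \<le> 1" "i \<le> k" using *(3) k by (auto simp: hydra_layer_def)
    have n0: "fst (z', True) \<notin> alph 0" using z' by (auto simp: hydra_alphabet_def)
    have q': "Th (- 1) q \<in> words (alph 0)" using invariant_alph_0 *(2) by (simp add: invariant_def)
    \<comment> \<open>Since
      \<open>a\<^sub>i q = (a\<^sub>i t) \<theta>(q) t\<^sup>-\<^sup>1\<close>, splitting off the
      generator \<open>a\<^sub>i t\<close> of the subgroup costs exactly one more power
      \<open>-1\<close> of \<open>t\<close>.\<close>
    define \<kappa> where "\<kappa> = fmul (fmul p (gen_a i)) (Th (- 1) q)"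
    have g: "gen_a i \<in> words (alph 1)" using z' by (simp add: free_gen_def hydra_alphabet_def)
    have \<kappa>: "\<kappa> \<in> words (alph 1)" unfolding \<kappa>_def using mono(1)[OF *(1)] mono(1)[OF q'] g by simp
    have X: "p \<in> words (alph k)" "q \<in> words (alph k)" "gen_a i \<in> words (alph k)" using * mono gen_a_words z' by auto
    have ev0: "ev w = (w, 0)" if "w \<in> words (alph 0)" for w
      by (rule ev_height_0[OF _ _ that]) (auto simp: hydra_alphabet_def)
    have "p @ [(z', True)] @ q = fmul (fmul p (gen_a i)) q"
      using fmul_sandwich[OF *(1,2) n0] z' by (simp add: free_gen_def)
    then have "([], - int n) \<otimes>\<^bsub>G\<^esub> (gen_a 1, 0) = (fmul (fmul p (gen_a i)) q, - int n)"
      using *(4) by simp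
    also have "\<dots> = ev \<kappa> \<otimes>\<^bsub>G\<^esub> ([], - int (n + 1))"
      using X ev0[OF *(1)] ev0[OF q'] ev_gen_a[OF z'(3)]
      by (simp add: \<kappa>_def ev_fmul Th_0 Th_add[symmetric])
    finally show ?case using \<kappa> by (intro bexI[of _ \<kappa>] exI[of _ "n + 1"]) simp_all
  next
    case (Suc j)
    have j: "1 < Suc j" "Suc j \<le> k" "1 \<le> j" "j \<le> k" using Suc by auto
    obtain \<kappa> N where *: "\<kappa> \<in> words (alph j)" "2 * n \<le> N" "shifted_power j n = ev \<kappa> \<otimes>\<^bsub>G\<^esub> ([], - int N)"
      using power[OF j(3,4) Suc.IH] j by blast
    have \<kappa>: "\<kappa> \<in> words (alph (Suc j))" using words_mono[OF hydra_alphabet_mono *(1)] by simp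
    have g: "gen_a (Suc j) \<in> words (alph (Suc j))" by (simp add: free_gen_def hydra_alphabet_def)
    have X: "\<kappa> \<in> words (alph k)" "gen_a (Suc j) \<in> words (alph k)" using words_mono[OF alph_X[OF j(2)]] \<kappa> g by auto
    have c: "ev \<kappa> \<in> carrier G" "ev (gen_a (Suc j)) \<in> carrier G" "\<And>n. ([], n) \<in> carrier G" using X by auto
    have sh: "([], - int N) \<otimes>\<^bsub>G\<^esub> ([], - 1) = ([], - int (N + 1))" by simp
    have "(gen_a (Suc j), 0) = ev (gen_a (Suc j)) \<otimes>\<^bsub>G\<^esub> ([], - 1)"
      using X by (simp add: ev_gen_a[OF j(2)])
    then have "([], - int n) \<otimes>\<^bsub>G\<^esub> (gen_a (Suc j), 0) = ([], - int n) \<otimes>\<^bsub>G\<^esub> ev (gen_a (Suc j)) \<otimes>\<^bsub>G\<^esub> ([], - 1)"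
      using c by (simp only: G.m_assoc)
    also have "\<dots> = ev (gen_a (Suc j)) \<otimes>\<^bsub>G\<^esub> (ev \<kappa> \<otimes>\<^bsub>G\<^esub> ([], - int N)) \<otimes>\<^bsub>G\<^esub> ([], - 1)"
      unfolding shift_gen_a[OF j(1,2)] using *(3) by simp
    also have "\<dots> = ev (gen_a (Suc j)) \<otimes>\<^bsub>G\<^esub> (ev \<kappa> \<otimes>\<^bsub>G\<^esub> (([], - int N) \<otimes>\<^bsub>G\<^esub> ([], - 1)))"
      using c by (simp only: G.m_assoc G.m_closed)
    also have "\<dots> = ev (fmul (gen_a (Suc j)) \<kappa>) \<otimes>\<^bsub>G\<^esub> ([], - int (N + 1))"
      unfolding sh using c X by (simp only: ev_fmul G.m_assoc G.m_closed)
    finally show ?case using \<kappa> g *(2)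
      by (intro bexI[of _ "fmul (gen_a (Suc j)) \<kappa>"] exI[of _ "N + 1"]) simp_all
  qed
  show "1 \<le> j \<Longrightarrow> j \<le> k \<Longrightarrow> \<exists>\<kappa>\<in>words (alph j). \<exists>N\<ge>n + 1. ([], - int n) \<otimes>\<^bsub>G\<^esub> (gen_a j, 0) = ev \<kappa> \<otimes>\<^bsub>G\<^esub> ([], - int N)"
    by (rule D)
  show "1 \<le> j \<Longrightarrow> j \<le> k \<Longrightarrow> \<exists>\<kappa>\<in>words (alph j). \<exists>N\<ge>2 * n. shifted_power j n = ev \<kappa> \<otimes>\<^bsub>G\<^esub> ([], - int N)"
    using power D by blast
qed

text \<open>For \<open>n = - N\<close> the equation makes \<open>ev m\<close> the power
  \<open>N\<close> of \<open>t\<^sup>-\<^sup>1 a\<^sub>i\<^sub>-\<^sub>1\<close>, which by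
  \<open>hydra_descends\<close> is an element of the subgroup times \<open>t\<close> to a power at
  most \<open>-2 * N\<close>. By \<open>TF\<close> that power of \<open>t\<close> is trivial, so
  \<open>N = 0\<close>: the strict descent leaves no room for a nontrivial intersection.\<close>

lemma no_conjugate_of_stable_letter:
  assumes i: "1 < i" "i \<le> k" and TF: "\<And>w. w \<in> words (alph (i - 1)) \<Longrightarrow> fst (ev w) = [] \<Longrightarrow> w = []"
    and m: "m \<in> words (alph (i - 1))" and ev: "ev (gen_a i) \<otimes>\<^bsub>G\<^esub> ev m = ([], n) \<otimes>\<^bsub>G\<^esub> ev (gen_a i)"
  shows "m = []"
proof -
  have gX: "gen_a i \<in> words (alph k)" using gen_a_words i by auto
  have wX: "w \<in> words (alph k)" if "w \<in> words (alph (i - 1))" for w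
    using words_mono[OF alph_X that] i by simp
  have c: "ev (gen_a i) \<in> carrier G" "\<And>n. ([], n) \<in> carrier G" using gX by auto
  have neg: "w = []" if w: "w \<in> words (alph (i - 1))" and eq: "ev (gen_a i) \<otimes>\<^bsub>G\<^esub> ev w = ([], - int N) \<otimes>\<^bsub>G\<^esub> ev (gen_a i)" for w N
  proof -
    have wc: "ev w \<in> carrier G" using wX[OF w] by simp
    obtain \<kappa> N' where *: "\<kappa> \<in> words (alph (i - 1))" "2 * N \<le> N'" "shifted_power (i - 1) N = ev \<kappa> \<otimes>\<^bsub>G\<^esub> ([], - int N')"
    proof -
      have "1 \<le> i - 1" "i - 1 \<le> k" using i by auto
      from hydra_descends(2)[OF this, of N] that show thesis by blast
    qed
    have "ev (gen_a i) \<otimes>\<^bsub>G\<^esub> ev w = ev (gen_a i) \<otimes>\<^bsub>G\<^esub> shifted_power (i - 1) N"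
      using eq shift_gen_a[OF i, of N] by simp
    then have "ev w = shifted_power (i - 1) N"
      using c(1) wc shifted_power_closed[of "i - 1"] i by (simp del: mult_G)
    then have "ev w = ev \<kappa> \<otimes>\<^bsub>G\<^esub> ([], - int N')" using *(3) by simp
    then have "inv\<^bsub>G\<^esub> (ev \<kappa>) \<otimes>\<^bsub>G\<^esub> ev w = ([], - int N')"
      using wX[OF *(1)] c(2) by (simp del: mult_G flip: G.m_assoc)
    then have e: "ev (fmul (finv \<kappa>) w) = ([], - int N')"
      using wX[OF *(1)] wX[OF w] by (simp add: ev_fmul ev_finv)
    then have "fmul (finv \<kappa>) w = []" using TF[of "fmul (finv \<kappa>) w"] *(1) w by simp
    then have "N' = 0" using e by (simp add: one_G)
    then have "N = 0" using *(2) by simp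
    then have "ev (gen_a i) \<otimes>\<^bsub>G\<^esub> ev w = ev (gen_a i) \<otimes>\<^bsub>G\<^esub> \<one>\<^bsub>G\<^esub>"
      using eq c(1) by (simp add: one_G[symmetric] del: mult_G)
    then have "ev w = \<one>\<^bsub>G\<^esub>" using c(1) wc by (simp del: mult_G G.r_one)
    then show ?thesis using TF[OF w] by (simp add: one_G)
  qed
  show ?thesis
  proof (cases "n \<le> 0")
    case True
    then show ?thesis using neg[OF m, of "nat (- n)"] ev by simp
  next
    \<comment> \<open>For positive \<open>n\<close> the equation is rewritten for
      \<open>finv m\<close>, with exponent \<open>- n\<close>.\<close>
    case False
    have mc: "ev m \<in> carrier G" using wX[OF m] by simp
    have "([], - n) \<otimes>\<^bsub>G\<^esub> (ev (gen_a i) \<otimes>\<^bsub>G\<^esub> ev m) = ev (gen_a i)"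
      unfolding ev using c gX by (simp add: G.m_assoc[symmetric] del: mult_G) (simp add: one_G[symmetric] ev_gen_a[OF i(2)] Th_0)
    then have "([], - n) \<otimes>\<^bsub>G\<^esub> ev (gen_a i) \<otimes>\<^bsub>G\<^esub> ev m \<otimes>\<^bsub>G\<^esub> inv\<^bsub>G\<^esub> (ev m) = ev (gen_a i) \<otimes>\<^bsub>G\<^esub> inv\<^bsub>G\<^esub> (ev m)"
      using c mc by (simp add: G.m_assoc del: mult_G)
    then have "([], - n) \<otimes>\<^bsub>G\<^esub> ev (gen_a i) = ev (gen_a i) \<otimes>\<^bsub>G\<^esub> ev (finv m)"
      using c mc wX[OF m] by (simp add: G.m_assoc ev_finv del: mult_G)
    then have "finv m = []" using neg[of "finv m" "nat n"] m False by simp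
    then show ?thesis by simp
  qed
qed

text \<open>A return to the vertex group forces \<open>ev m\<close> into an edge group: the powers
  of \<open>t\<close>, excluded by \<open>TF\<close>, or their conjugates by the stable letter,
  excluded by \<open>no_conjugate_of_stable_letter\<close>.\<close>

lemma malnormal_step_layer:
  assumes i: "1 \<le> i" "i \<le> k" and TF: "\<And>w. w \<in> words (alph (i - 1)) \<Longrightarrow> fst (ev w) = [] \<Longrightarrow> w = []"
  shows "malnormal_step (alph k) Th letter_height (alph (i - 1)) (hydra_layer i)"
proof -
  have inv: "invariant (alph (i - 1))" using invariant_alph i by simp
  interpret cyclic_step "alph k" Th letter_height "alph (i - 1)" "hydra_layer i"
    by (rule cyclic_step_layer[OF i inv])
  show ?thesis
  proof
    fix m y x
    assume m: "m \<in> words (alph (i - 1))" and y: "fst y \<in> hydra_layer i" and x: "fst x \<in> hydra_layer i"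
      and lev: "el y \<otimes>\<^bsub>G\<^esub> ev m \<otimes>\<^bsub>G\<^esub> el x \<in> lev (alph (i - 1))"
    obtain f n where fn: "ev m = (f, n)" by (cases "ev m")
    have fX: "f \<in> words (alph k)" using ev_closed[OF words_A_X[OF m]] fn by simp
    note cr = crossing_returns[OF m y x lev fn]
    have xX: "[x] \<in> words (alph k)" using x Z_X by auto
    show "m = [] \<and> x = inverse_letter y"
    proof (cases "i = 1")
      case True
      \<comment> \<open>In the first layer the base words have height zero, so \<open>ev\<close> is
        the identity on them and a return can only be a free cancellation.\<close>
      have "ev m = (m, 0)" by (rule ev_height_0[OF _ A_X m]) (auto simp: True hydra_alphabet_def)
      then have "f = m" "n = 0" using fn by auto
      then have "fmul (Th (if snd y then 1 else 0) m) [] = [] \<and> x = inverse_letter y"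
        using cr(2)[of "[]" x "[]"] Th_0[OF xX] x by simp
      then show ?thesis using Th_eq_Nil words_A_X[OF m] by simp
    next
      case False
      then have i2: "1 < i" using i by simp
      have layer: "hydra_layer i = {Letter_a i}" using False by (simp add: hydra_layer_def)
      then have xy: "x = inverse_letter y" using x y cr(1) by (cases x; cases y) (simp add: inverse_letter_def)
      obtain w where w: "w \<in> words (alph (i - 1))" "Th n (gen_a i) = [(Letter_a i, True)] @ w"
        using layer_letters[OF i inv, of "Letter_a i" n] False layer by (auto simp: free_gen_def)
      have gX: "gen_a i \<in> words (alph k)" using gen_a_words i by auto
      show ?thesis
      proof (cases "snd x")
        \<comment> \<open>Here \<open>y\<close> is an inverse letter: \<open>ev m\<close> conjugated
          by the inverse of \<open>a\<^sub>i t\<close> lies in the vertex group, so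
          \<open>ev m\<close> is a power of \<open>t\<close>.\<close>
        case True
        then have "[x] = gen_a i" using x layer by (cases x) (simp add: free_gen_def)
        then have "fmul (Th 0 f) [] = []"
          using cr(1) cr(2)[of "[]" "(Letter_a i, True)" w] w layer True by simp
        then show ?thesis using Th_0[OF fX] fX fn TF[OF m] xy by simp
      next
        \<comment> \<open>Here \<open>(a\<^sub>i t) (ev m) (a\<^sub>i t)\<^sup>-\<^sup>1\<close>
          lies in the vertex group and turns out to be \<open>t\<close> to the power
          \<open>n\<close>.\<close>
        case False
        then have x': "[x] = finv (gen_a i)" using x layer by (cases x) (simp add: free_gen_def inverse_letter_def)
        have "Th n [x] = finv w @ [(Letter_a i, False)] @ []"
          unfolding x' Th_finv[OF gX] w(2) by (simp add: inverse_letter_def)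
        then have "fmul (Th 1 f) (finv w) = []"
          using cr(1) cr(2)[of "finv w" "(Letter_a i, False)" "[]"] w(1) layer False by simp
        then have "fmul (fmul (Th 1 f) (finv w)) w = w" using words_A_X[OF w(1)] by simp
        then have f: "Th 1 f = w" using words_A_X[OF w(1)] fX by (simp add: fmul_assoc)
        have "fmul (gen_a i) w = [(Letter_a i, True)] @ w"
          using fmul_append[of "gen_a i" w] w Th_closed[OF gX, of n] by (simp add: free_gen_def)
        then have "ev (gen_a i) \<otimes>\<^bsub>G\<^esub> ev m = ([], n) \<otimes>\<^bsub>G\<^esub> ev (gen_a i)"
          using w(2) f gX red_X[OF Th_closed[OF gX, of n]] by (simp add: ev_gen_a[OF i(2)] fn)
        then have "m = []" using no_conjugate_of_stable_letter[OF i2 i(2) _ m] TF by blast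
        then show ?thesis using xy by simp
      qed
    qed
  qed
qed

text \<open>Trivial intersection with the powers of \<open>t\<close> and malnormality feed each
  other: the first for \<open>i\<close> gives the second for layer \<open>i + 1\<close>, whose
  normal form gives the first for \<open>i + 1\<close>.\<close>

lemma ev_trivial:
  "i \<le> k \<Longrightarrow> w \<in> words (alph i) \<Longrightarrow> fst (ev w) = [] \<Longrightarrow> w = []"
proof (induction i arbitrary: w)
  case 0
  have "ev w = (w, 0)" by (rule ev_height_0[OF _ alph_X 0(2)]) (auto simp: hydra_alphabet_def)
  then show ?case using 0 by simp
next
  case (Suc i)
  interpret malnormal_step "alph k" Th letter_height "alph (Suc i - 1)" "hydra_layer (Suc i)"
    by (rule malnormal_step_layer) (use Suc in auto)
  have "w \<in> words (alph (Suc i - 1) \<union> hydra_layer (Suc i))"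
    using Suc.prems(2) hydra_alphabet_layer(1)[of "Suc i" l] by simp
  then show ?case by (rule ev_trivial_height[rotated, OF _ Suc.prems(3)]) (use Suc in auto)
qed

lemma malnormal_layers:
  assumes i: "1 \<le> i" "i \<le> k"
  shows "malnormal_step (alph k) Th letter_height (alph (i - 1)) (hydra_layer i)"
proof (rule malnormal_step_layer[OF i])
  fix w assume "w \<in> words (alph (i - 1))" "fst (ev w) = []"
  then show "w = []" by (rule ev_trivial[rotated]) (use i in simp)
qed

text \<open>Downward induction from the identity of \<open>G\<close>, folding away one layer at a
  time.\<close>

lemma retract_alph: "i \<le> k \<Longrightarrow> retract (alph i)"
proof (induction i rule: inc_induct)
  case base
  show ?case by (rule retract_X)
next
  case (step i)
  interpret malnormal_step "alph k" Th letter_height "alph (Suc i - 1)" "hydra_layer (Suc i)"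
    by (rule malnormal_layers) (use step in auto)
  show ?case using retract_step step hydra_alphabet_layer(1)[of "Suc i" l] by simp
qed

lemma cannon_thurston_alph:
  assumes "hyperbolic_word_metric G S \<delta>"
  shows "i \<le> k \<Longrightarrow> cannon_thurston_at S (alph i)"
proof (induction i)
  case 0
  show ?case
    by (rule cannon_thurston_normal[OF assms invariant_alph_0 retract_alph])
       (auto simp: hydra_alphabet_def)
next
  case (Suc i)
  interpret malnormal_step "alph k" Th letter_height "alph (Suc i - 1)" "hydra_layer (Suc i)"
    by (rule malnormal_layers) (use Suc in auto)
  show ?case
    using cannon_thurston_step[OF assms] Suc retract_alph[OF Suc.prems] hydra_alphabet_layer(1)[of "Suc i" l] by simp
qed

lemma carrier_hydra_subgroup: "carrier (hydra_subgroup k l \<theta>) = ev ` words (alph k)"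
proof -
  let ?X = "(\<lambda>i. (gen_a i, 1 :: int)) ` {0..k} \<union> (\<lambda>j. (gen_b j, 0)) ` {1..l}"
  have X: "x \<in> ?X \<longleftrightarrow> (\<exists>z\<in>alph k. x = ev [(z, True)])" for x
  proof -
    have "ev [(z, True)] = ([(z, True)], letter_height z)" if "z \<in> alph k" for z
      using that by (simp add: ev_Cons el_def one_G)
    then show ?thesis using k by (auto simp: hydra_alphabet_def free_gen_def)
  qed
  have Xe: "?X \<subseteq> ev ` words (alph k)"
  proof
    fix x assume "x \<in> ?X"
    then obtain z where "z \<in> alph k" "x = ev [(z, True)]" using X by blast
    then show "x \<in> ev ` words (alph k)" by (intro image_eqI[of _ _ "[(z, True)]"]) simp_all
  qed
  moreover have evG: "ev ` words (alph k) \<subseteq> carrier G" using ev_closed by (rule image_subsetI)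
  ultimately have XG: "?X \<subseteq> carrier G" by (rule subset_trans)
  have "subgroup (ev ` words (alph k)) G"
  proof (rule G.subgroupI)
    show "ev ` words (alph k) \<subseteq> carrier G" by (rule evG)
    show "ev ` words (alph k) \<noteq> {}" using words_Nil by blast
    fix a assume "a \<in> ev ` words (alph k)"
    then obtain u where u: "u \<in> words (alph k)" "a = ev u" by blast
    then show "inv\<^bsub>G\<^esub> a \<in> ev ` words (alph k)" by (intro image_eqI[of _ _ "finv u"]) (simp_all add: ev_finv)
    fix b assume "b \<in> ev ` words (alph k)"
    then obtain v where v: "v \<in> words (alph k)" "b = ev v" by blast
    show "a \<otimes>\<^bsub>G\<^esub> b \<in> ev ` words (alph k)"
      using u v by (intro image_eqI[of _ _ "fmul u v"]) (simp_all add: ev_fmul)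
  qed
  then have "generate G ?X \<subseteq> ev ` words (alph k)" by (rule G.generate_subgroup_incl[OF Xe])
  moreover have "ev w \<in> generate G ?X" if "w \<in> words (alph k)" for w
    using that
  proof (induction rule: free_group_induct)
    case Nil
    show ?case by (simp add: generate.one)
  next
    case (Cons x w)
    obtain z b where x: "x = (z, b)" by (cases x)
    have z: "z \<in> alph k" using Cons.hyps x by simp
    then have g: "el (z, True) \<in> ?X" using X[of "el (z, True)"] by (auto simp: ev_single)
    have "el x \<in> generate G ?X"
      using generate.incl[OF g] generate.inv[OF g] el_inverse[of "(z, True)"] z x
      by (cases b) (simp_all add: inverse_letter_def)
    then show ?case using generate.eng[OF _ Cons.IH] by (simp add: ev_Cons)
  qed
  ultimately have "generate G ?X = ev ` words (alph k)" by blast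
  then show ?thesis
    using XG by (simp add: hydra_subgroup_def hydra_group_eq carrier_subgroup_generated Int_absorb1)
qed

end

theorem theorem1p1:
  fixes k l :: nat
    and U V :: hydra_word
    and \<theta> :: "hydra_word \<Rightarrow> hydra_word"
    and S T :: "(hydra_word \<times> int) set"
  assumes "k \<ge> 1"
    and "hydra_automorphism k l U V \<theta>"
    and "hyperbolic_group (hydra_group k l \<theta>)"
    and "finite_generating_set (hydra_group k l \<theta>) S"
    and "finite_generating_set (hydra_subgroup k l \<theta>) T"
  shows "cannon_thurston_map_exists (hydra_subgroup k l \<theta>) T (hydra_group k l \<theta>) S"
proof (rule cannon_thurston_criterion)
  interpret hydra k l U V \<theta> using assms(1,2) by unfold_locales
  let ?\<Lambda> = "hydra_subgroup k l \<theta>"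
  show "carrier ?\<Lambda> \<subseteq> carrier (hydra_group k l \<theta>)"
    unfolding carrier_hydra_subgroup hydra_group_eq by auto
  have mult: "monoid.mult ?\<Lambda> = monoid.mult G" and one: "\<one>\<^bsub>?\<Lambda>\<^esub> = \<one>\<^bsub>G\<^esub>"
    by (simp_all add: hydra_subgroup_def hydra_group_eq)
  have "group ?\<Lambda>" unfolding hydra_subgroup_def hydra_group_eq by (rule G.group_subgroup_generated)
  then have T: "word_metric ?\<Lambda> T" using assms(5) by (simp add: word_metric_def word_metric_axioms_def)
  have S: "word_metric G S" using assms(4) group_G by (simp add: word_metric_def word_metric_axioms_def hydra_group_eq)
  \<comment> \<open>Hyperbolicity supplies its own generating set \<open>S'\<close>, while
    \<open>S\<close> and \<open>T\<close> are arbitrary. The induction runs with \<open>S'\<close>;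
    \<open>M1\<close> translates products from \<open>S'\<close> to \<open>S\<close>, and
    \<open>M\<close> translates products for \<open>T\<close> into common prefixes.\<close>
  obtain S' \<delta> where S': "hyperbolic_word_metric G S' \<delta>"
    using hyperbolic_groupE assms(3) unfolding hydra_group_eq by blast
  fix r
  obtain M1 where M1: "\<And>u v. u \<in> carrier G \<Longrightarrow> v \<in> carrier G \<Longrightarrow>
      M1 \<le> gromov_product G S' \<one>\<^bsub>G\<^esub> u v \<Longrightarrow> r \<le> gromov_product G S \<one>\<^bsub>G\<^esub> u v"
    using gromov_product_change_generators[OF S' S, of r] by blast
  obtain N where N: "\<And>P U V. P @ U \<in> words (alph k) \<Longrightarrow> P @ V \<in> words (alph k) \<Longrightarrow> N \<le> length P \<Longrightarrow>
      M1 \<le> gromov_product G S' \<one>\<^bsub>G\<^esub> (ev (P @ U)) (ev (P @ V))"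
    using cannon_thurston_alph[OF S', of k] unfolding cannon_thurston_at_def by (metis order_refl)
  obtain M where M: "\<forall>u\<in>carrier ?\<Lambda>. \<forall>v\<in>carrier ?\<Lambda>. M \<le> gromov_product ?\<Lambda> T \<one>\<^bsub>?\<Lambda>\<^esub> u v \<longrightarrow>
    (\<exists>P U V. P @ U \<in> words (alph k) \<and> P @ V \<in> words (alph k) \<and> N \<le> length P \<and> ev (P @ U) = u \<and> ev (P @ V) = v)"
    using common_prefix_of_gromov_product[OF T mult one carrier_hydra_subgroup, of N] by blast
  show "\<exists>M. \<forall>u\<in>carrier ?\<Lambda>. \<forall>v\<in>carrier ?\<Lambda>. M \<le> gromov_product ?\<Lambda> T \<one>\<^bsub>?\<Lambda>\<^esub> u v \<longrightarrow>
      r \<le> gromov_product (hydra_group k l \<theta>) S \<one>\<^bsub>hydra_group k l \<theta>\<^esub> u v"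
  proof (intro exI[of _ M] ballI impI)
    fix u v assume uv: "u \<in> carrier ?\<Lambda>" "v \<in> carrier ?\<Lambda>" "M \<le> gromov_product ?\<Lambda> T \<one>\<^bsub>?\<Lambda>\<^esub> u v"
    then obtain P U V where P: "P @ U \<in> words (alph k)" "P @ V \<in> words (alph k)" "N \<le> length P"
      "ev (P @ U) = u" "ev (P @ V) = v" using M by blast
    have "r \<le> gromov_product G S \<one>\<^bsub>G\<^esub> (ev (P @ U)) (ev (P @ V))"
      by (rule M1[OF _ _ N[OF P(1-3)]]) (use P in auto)
    then show "r \<le> gromov_product (hydra_group k l \<theta>) S \<one>\<^bsub>hydra_group k l \<theta>\<^esub> u v"
      using P(4,5) by (simp add: hydra_group_eq)
  qed
qed

end
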